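(* Let $N>1$, $p\ge 2$, $s\in(0,1)$, $N>ps$, and let $\Omega\subset\mathbb{R}^N$ be a bounded domain with $C^{1,1}$ boundary. Let $f:\Omega\times\mathbb{R}\to\mathbb{R}$ be a Carathéodory function such that, for some $c_0>0$ and $q\in(p,p_s^* )$, $|f(x,t)|\le c_0(1+|t|^{q-1})$ for a.e. $x\in\Omega$ and all $t\in\mathbb{R}$. Let $(\underline{u},\overline{u})\in\widetilde{W}^{s,p}(\Omega)\times\widetilde{W}^{s,p}(\Omega)$ be a sub-supersolution pair of the problem $$(-\Delta)_p^s u=f(x,u)\ \text{ in }\Omega,\qquad u=0\ \text{ in }\Omega^c.$$ Then $\mathcal{S}(\underline{u},\overline{u})$ contains a smallest and a biggest element with respect to the pointwise a.e. order; that is, there exist $u_0,u_1\in\mathcal{S}(\underline{u},\overline{u})$ such that $u_0\le u\le u_1$ for all $u\in\mathcal{S}(\underline{u},\overline{u})$.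
   Context: Notation: $\Omega^c=\mathbb{R}^N\setminus\Omega$, $p_s^*=Np/(N-ps)$, $d\mu=|x-y|^{-N-ps}\,dx\,dy$. Inequalities between measurable functions hold almost everywhere. Functions on $\Omega$ are identified with their $0$-extension to $\mathbb{R}^N$. Spaces: $[u]_{s,p}^p=\iint_{\mathbb{R}^N\times\mathbb{R}^N}|u(x)-u(y)|^p\,d\mu$; $W^{s,p}(\mathbb{R}^N)=\{u\in L^p(\mathbb{R}^N):[u]_{s,p}<\infty\}$; $W^{s,p}_0(\Omega)=\{u\in W^{s,p}(\mathbb{R}^N):u=0\text{ in }\Omega^c\}$, normed by $\|u\|_{s,p}=[u]_{s,p}$, with dual $W^{-s,p'}(\Omega)$; $W^{s,p}_0(\Omega)_+$ is the set of its a.e. non-negative elements. For $U\subseteq\mathbb{R}^N$ open, $W^{s,p}(U)$ is the usual fractional Sobolev space ($u\in L^p(U)$ with $\iint_{U\times U}|u(x)-u(y)|^p\,d\mu<\infty$). $\widetilde{W}^{s,p}(\Omega)$ is the space of all $u\in L^p_{\rm loc}(\mathbb{R}^N)$ such that $u\in W^{s,p}(U)$ for some open $U\subseteq\mathbb{R}^N$ with $\overline\Omega\subset U$, and $\int_{\mathbb{R}^N}\frac{|u(x)|^{p-1}}{(1+|x|)^{N+ps}}\,dx<\infty$. Operator: for $u\in\widetilde{W}^{s,p}(\Omega)$, $(-\Delta)_p^su\in W^{-s,p'}(\Omega)$ is defined by $$\langle(-\Delta)_p^su,v\rangle=\iint_{\mathbb{R}^N\times\mathbb{R}^N}|u(x)-u(y)|^{p-2}(u(x)-u(y))(v(x)-v(y))\,d\mu,\quad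 v\in W^{s,p}_0(\Omega).$$ Definitions: $u\in\widetilde{W}^{s,p}(\Omega)$ is a supersolution if $u\ge0$ in $\Omega^c$ and $\langle(-\Delta)_p^su,v\rangle\ge\int_\Omega f(x,u)v\,dx$ for all $v\in W^{s,p}_0(\Omega)_+$; it is a subsolution if $u\le0$ in $\Omega^c$ and $\langle(-\Delta)_p^su,v\rangle\le\int_\Omega f(x,u)v\,dx$ for all $v\in W^{s,p}_0(\Omega)_+$. $u\in W^{s,p}_0(\Omega)$ is a solution if $\langle(-\Delta)_p^su,v\rangle=\int_\Omega f(x,u)v\,dx$ for all $v\in W^{s,p}_0(\Omega)$. $(\underline{u},\overline{u})$ is a sub-supersolution pair if $\underline{u}$ is a subsolution, $\overline{u}$ is a supersolution, and $\underline{u}\le\overline{u}$ in $\Omega$. For such a pair, $\mathcal{S}(\underline{u},\overline{u})=\{u\in W^{s,p}_0(\Omega):u\text{ is a solution},\ \underline{u}\le u\le\overline{u}\}$. *)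

theory Defs
  imports "HOL-Analysis.Analysis"
begin

text \<open>Elements of the function spaces are represented by Lebesgue measurable functions, and the
  order and all equalities between them are understood almost everywhere.\<close>

definition C11_function :: "('a::euclidean_space \<Rightarrow> real) \<Rightarrow> bool" where
  "C11_function \<gamma> \<longleftrightarrow>
     (\<exists>g L. (\<forall>x. GDERIV \<gamma> x :> g x) \<and> L-lipschitz_on UNIV g)"

text \<open>Locally, after a rotation, the set is the strict epigraph of a function of \<open>N - 1\<close>
  variables. The unit vector \<open>e\<close> is the vertical direction, and \<open>x - (x \<bullet> e) *\<^sub>R e\<close> is the
  horizontal part of \<open>x\<close>, so only the values of \<open>\<gamma>\<close> on the hyperplane orthogonal to \<open>e\<close> matter.
  Such a \<open>\<gamma>\<close> on the hyperplane extends to the whole space by composition with the projection.\<close>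

definition C11_boundary :: "'a::euclidean_space set \<Rightarrow> bool" where
  "C11_boundary \<Omega> \<longleftrightarrow>
     (\<forall>x0\<in>frontier \<Omega>. \<exists>r e \<gamma>. r > 0 \<and> norm e = 1 \<and> C11_function \<gamma> \<and>
        \<Omega> \<inter> ball x0 r = {x \<in> ball x0 r. x \<bullet> e > \<gamma> (x - (x \<bullet> e) *\<^sub>R e)})"

definition bounded_C11_domain :: "'a::euclidean_space set \<Rightarrow> bool" where
  "bounded_C11_domain \<Omega> \<longleftrightarrow>
     open \<Omega> \<and> connected \<Omega> \<and> \<Omega> \<noteq> {} \<and> bounded \<Omega> \<and> C11_boundary \<Omega>"

definition caratheodory :: "'a::euclidean_space set \<Rightarrow> ('a \<Rightarrow> real \<Rightarrow> real) \<Rightarrow> bool" where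
  "caratheodory \<Omega> f \<longleftrightarrow>
     (\<forall>t. (\<lambda>x. f x t) \<in> borel_measurable (lebesgue_on \<Omega>)) \<and>
     (AE x in lebesgue. x \<in> \<Omega> \<longrightarrow> continuous_on UNIV (f x))"

text \<open>The measure \<open>d\<mu> = |x - y|\<^bsup>-N-ps\<^esup> dx dy\<close>. The value of the density on the diagonal is
  irrelevant, the diagonal being a null set.\<close>

definition frac_measure :: "real \<Rightarrow> real \<Rightarrow> ('a::euclidean_space \<times> 'a) measure" where
  "frac_measure s p =
     density (lebesgue \<Otimes>\<^sub>M lebesgue)
       (\<lambda>z. ennreal (norm (fst z - snd z) powr (- real DIM('a) - p * s)))"

text \<open>The \<open>p\<close>-th power of the Gagliardo seminorm over \<open>U\<close>; for \<open>U = UNIV\<close> it is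
  \<open>[u]\<^sub>s\<^sub>,\<^sub>p\<close> to the power \<open>p\<close>.\<close>

definition gagliardo :: "real \<Rightarrow> real \<Rightarrow> 'a::euclidean_space set \<Rightarrow> ('a \<Rightarrow> real) \<Rightarrow> ennreal" where
  "gagliardo s p U u =
     (\<integral>\<^sup>+z\<in>U \<times> U. ennreal (\<bar>u (fst z) - u (snd z)\<bar> powr p) \<partial>frac_measure s p)"

definition Lp_on :: "real \<Rightarrow> 'a::euclidean_space set \<Rightarrow> ('a \<Rightarrow> real) set" where
  "Lp_on p U = {u. u \<in> borel_measurable (lebesgue_on U) \<and>
     (\<integral>\<^sup>+x\<in>U. ennreal (\<bar>u x\<bar> powr p) \<partial>lebesgue) < \<infinity>}"

definition Lp_loc :: "real \<Rightarrow> ('a::euclidean_space \<Rightarrow> real) set" where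
  "Lp_loc p = {u. u \<in> borel_measurable lebesgue \<and> (\<forall>K. compact K \<longrightarrow> u \<in> Lp_on p K)}"

definition frac_sobolev :: "real \<Rightarrow> real \<Rightarrow> 'a::euclidean_space set \<Rightarrow> ('a \<Rightarrow> real) set" where
  "frac_sobolev s p U = {u \<in> Lp_on p U. gagliardo s p U u < \<infinity>}"

definition frac_sobolev0 :: "real \<Rightarrow> real \<Rightarrow> 'a::euclidean_space set \<Rightarrow> ('a \<Rightarrow> real) set" where
  "frac_sobolev0 s p \<Omega> =
     {u \<in> frac_sobolev s p UNIV. AE x in lebesgue. x \<in> - \<Omega> \<longrightarrow> u x = 0}"

definition frac_sobolev0_nonneg ::
    "real \<Rightarrow> real \<Rightarrow> 'a::euclidean_space set \<Rightarrow> ('a \<Rightarrow> real) set" where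
  "frac_sobolev0_nonneg s p \<Omega> = {v \<in> frac_sobolev0 s p \<Omega>. AE x in lebesgue. v x \<ge> 0}"

definition frac_sobolev_tilde :: "real \<Rightarrow> real \<Rightarrow> 'a::euclidean_space set \<Rightarrow> ('a \<Rightarrow> real) set" where
  "frac_sobolev_tilde s p \<Omega> = {u \<in> Lp_loc p.
     (\<exists>U. open U \<and> closure \<Omega> \<subseteq> U \<and> u \<in> frac_sobolev s p U) \<and>
     (\<integral>\<^sup>+x. ennreal (\<bar>u x\<bar> powr (p - 1) / (1 + norm x) powr (real DIM('a) + p * s)) \<partial>lebesgue)
       < \<infinity>}"

text \<open>The duality pairing of \<open>(-\<Delta>)\<^sup>s\<^sub>p u\<close> with \<open>v\<close>. For \<open>u\<close> in \<open>frac_sobolev_tilde s p \<Omega>\<close> and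
  \<open>v\<close> in \<open>frac_sobolev0 s p \<Omega>\<close>, \<open>\<Omega>\<close> bounded, the integrand is absolutely integrable, so the
  convention that non-integrable functions have integral \<open>0\<close> plays no role.\<close>

definition frac_p_laplacian ::
    "real \<Rightarrow> real \<Rightarrow> ('a::euclidean_space \<Rightarrow> real) \<Rightarrow> ('a \<Rightarrow> real) \<Rightarrow> real" where
  "frac_p_laplacian s p u v =
     (LINT z|frac_measure s p.
        \<bar>u (fst z) - u (snd z)\<bar> powr (p - 2) * (u (fst z) - u (snd z)) * (v (fst z) - v (snd z)))"

definition supersolution ::
    "real \<Rightarrow> real \<Rightarrow> 'a::euclidean_space set \<Rightarrow> ('a \<Rightarrow> real \<Rightarrow> real) \<Rightarrow> ('a \<Rightarrow> real) \<Rightarrow> bool" where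
  "supersolution s p \<Omega> f u \<longleftrightarrow>
     u \<in> frac_sobolev_tilde s p \<Omega> \<and>
     (AE x in lebesgue. x \<in> - \<Omega> \<longrightarrow> u x \<ge> 0) \<and>
     (\<forall>v\<in>frac_sobolev0_nonneg s p \<Omega>.
        frac_p_laplacian s p u v \<ge> (LINT x:\<Omega>|lebesgue. f x (u x) * v x))"

definition subsolution ::
    "real \<Rightarrow> real \<Rightarrow> 'a::euclidean_space set \<Rightarrow> ('a \<Rightarrow> real \<Rightarrow> real) \<Rightarrow> ('a \<Rightarrow> real) \<Rightarrow> bool" where
  "subsolution s p \<Omega> f u \<longleftrightarrow>
     u \<in> frac_sobolev_tilde s p \<Omega> \<and>
     (AE x in lebesgue. x \<in> - \<Omega> \<longrightarrow> u x \<le> 0) \<and>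
     (\<forall>v\<in>frac_sobolev0_nonneg s p \<Omega>.
        frac_p_laplacian s p u v \<le> (LINT x:\<Omega>|lebesgue. f x (u x) * v x))"

definition solution ::
    "real \<Rightarrow> real \<Rightarrow> 'a::euclidean_space set \<Rightarrow> ('a \<Rightarrow> real \<Rightarrow> real) \<Rightarrow> ('a \<Rightarrow> real) \<Rightarrow> bool" where
  "solution s p \<Omega> f u \<longleftrightarrow>
     u \<in> frac_sobolev0 s p \<Omega> \<and>
     (\<forall>v\<in>frac_sobolev0 s p \<Omega>.
        frac_p_laplacian s p u v = (LINT x:\<Omega>|lebesgue. f x (u x) * v x))"

definition sub_supersolution_pair ::
    "real \<Rightarrow> real \<Rightarrow> 'a::euclidean_space set \<Rightarrow> ('a \<Rightarrow> real \<Rightarrow> real) \<Rightarrow>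
     ('a \<Rightarrow> real) \<Rightarrow> ('a \<Rightarrow> real) \<Rightarrow> bool" where
  "sub_supersolution_pair s p \<Omega> f lu uu \<longleftrightarrow>
     subsolution s p \<Omega> f lu \<and> supersolution s p \<Omega> f uu \<and>
     (AE x in lebesgue. x \<in> \<Omega> \<longrightarrow> lu x \<le> uu x)"

definition solution_set ::
    "real \<Rightarrow> real \<Rightarrow> 'a::euclidean_space set \<Rightarrow> ('a \<Rightarrow> real \<Rightarrow> real) \<Rightarrow>
     ('a \<Rightarrow> real) \<Rightarrow> ('a \<Rightarrow> real) \<Rightarrow> ('a \<Rightarrow> real) set" where
  "solution_set s p \<Omega> f lu uu =
     {u \<in> frac_sobolev0 s p \<Omega>. solution s p \<Omega> f u \<and>
        (AE x in lebesgue. lu x \<le> u x \<and> u x \<le> uu x)}"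

definition critical_exponent :: "real \<Rightarrow> real \<Rightarrow> real \<Rightarrow> real" where
  "critical_exponent N s p = N * p / (N - p * s)"

end

theory Submission
  imports Defs "HOL-Complex_Analysis.Great_Picard"
begin

text \<open>
  The solutions between the subsolution \<open>lu\<close> and the supersolution \<open>uu\<close> form a nonempty set that is
  directed downwards and closed under limits almost everywhere. A decreasing sequence of solutions
  whose integrals tend to the infimum therefore has a solution as its limit, and directedness makes
  this limit the smallest one (lemma \<open>smallest_solution\<close>). The biggest solution follows from the
  reflection \<open>u \<mapsto> - u\<close>, \<open>f(x, t) \<mapsto> - f(x, - t)\<close>.

  Nonemptiness and directedness are the same existence statement, lemma \<open>solution_between\<close>: above a
  subsolution and below two supersolutions there is a solution. The right-hand side is truncated,
  which bounds it by a fixed function \<open>h\<close> in the dual of \<open>L\<^sup>q\<close>; the truncated problem is solved by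
  minimisation (\<open>weak_solution_exists\<close>); and the comparison principle (\<open>comparison\<close>), which rests on the
  strict monotonicity of \<open>t \<mapsto> \<bar>t\<bar>\<^bsup>p-2\<^esup> t\<close>, shows that the truncation is not active at the solution. The
  truncation contains correction terms that permit a comparison with each supersolution on its own,
  so that minima of supersolutions never have to be studied.

  Closedness (\<open>solution_set_closed\<close>) holds because solutions have bounded energy, and a sequence that is
  bounded in some \<open>L\<^sup>r\<close>, \<open>r > 1\<close>, and converges almost everywhere converges weakly
  (\<open>AE_bounded_imp_weak_convergence\<close>).

  Three facts about fractional Sobolev spaces support this, and all of them come from the elementary
  observation that the average of \<open>\<bar>u x - u y\<bar>\<^sup>p\<close> over \<open>y\<close> in the ball of radius \<open>r\<close> around \<open>x\<close> is at most a
  multiple of \<open>r\<^bsup>ps\<^esup>\<close> times the density of the seminorm at \<open>x\<close>. First, the embedding into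
  \<open>L\<^sup>q\<close> for subcritical \<open>q\<close> (\<open>fractional_Sobolev_subcritical\<close>): the observation yields a pointwise bound
  that raises the exponent of integrability from \<open>a\<close> to \<open>p + (ps/N) a\<close>, and the iterates of this map
  tend to its fixed point, the critical exponent. Second, compactness (\<open>W0_compact\<close>): up to an error
  that is small with \<open>r\<close>, a function of bounded energy is determined by its averages over finitely many
  balls of radius \<open>r\<close>. Third, the Poincare inequality, where the values of \<open>u\<close> are compared with the
  value \<open>0\<close> outside the domain.
\<close>

section \<open>Powers\<close>

lemma powr_sum_le:
  fixes a b r :: real
  assumes "a \<ge> 0" "b \<ge> 0" "r \<ge> 0"
  shows "(a + b) powr r \<le> 2 powr r * (a powr r + b powr r)"
proof -
  have "(a + b) powr r \<le> (2 * max a b) powr r"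
    using assms by (intro powr_mono2) auto
  also have "\<dots> = 2 powr r * max a b powr r"
    using assms by (simp add: powr_mult)
  also have "max a b powr r \<le> a powr r + b powr r"
    by (simp add: max_def)
  finally show ?thesis by simp
qed

lemma abs_diff_powr_le:
  fixes a b r :: real
  assumes "r \<ge> 0"
  shows "\<bar>a - b\<bar> powr r \<le> 2 powr r * (\<bar>a\<bar> powr r + \<bar>b\<bar> powr r)"
proof -
  have "\<bar>a - b\<bar> powr r \<le> (\<bar>a\<bar> + \<bar>b\<bar>) powr r"
    using assms by (intro powr_mono2) auto
  also have "\<dots> \<le> 2 powr r * (\<bar>a\<bar> powr r + \<bar>b\<bar> powr r)"
    using assms by (intro powr_sum_le) auto
  finally show ?thesis .
qed

lemma abs_add_powr_le:
  fixes a b r :: real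
  assumes "r \<ge> 0"
  shows "\<bar>a + b\<bar> powr r \<le> 2 powr r * (\<bar>a\<bar> powr r + \<bar>b\<bar> powr r)"
  using abs_diff_powr_le[OF assms, of a "-b"] by simp

lemma powr_le_one_plus:
  fixes t a b :: real
  assumes "0 \<le> a" "a \<le> b" "t \<ge> 0"
  shows "t powr a \<le> 1 + t powr b"
proof (cases "t \<le> 1")
  case True
  then have "t powr a \<le> 1"
    using assms powr_mono2[of a t 1] by simp
  then show ?thesis using powr_ge_zero[of t b] by linarith
next
  case False
  then have "t powr a \<le> t powr b" using assms by (intro powr_mono) auto
  then show ?thesis by simp
qed

text \<open>Young's inequality with a weight, by cases on which of \<open>b\<close> and \<open>\<eta> a\<^bsup>q-1\<^esup>\<close> is larger.\<close>

lemma Young_weighted: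
  fixes q \<eta> a b :: real
  assumes "q > 1" "\<eta> > 0" "a \<ge> 0" "b \<ge> 0"
  shows "a * b \<le> \<eta> * a powr q + (1 / \<eta>) powr (1 / (q - 1)) * b powr (q / (q - 1))"
proof (cases "b \<le> \<eta> * a powr (q - 1)")
  case True
  have "a * b \<le> a * (\<eta> * a powr (q - 1))" using True assms by (intro mult_left_mono)
  also have "\<dots> = \<eta> * a powr q"
    using assms by (cases "a = 0") (simp_all add: powr_diff)
  finally show ?thesis by (simp add: add_increasing2)
next
  case False
  let ?C = "(1 / \<eta>) powr (1 / (q - 1))"
  have less: "a powr (q - 1) \<le> b / \<eta>" using False assms by (simp add: field_simps)
  have "a = (a powr (q - 1)) powr (1 / (q - 1))" using assms by (simp add: powr_powr)
  also have "\<dots> \<le> (b / \<eta>) powr (1 / (q - 1))" using less assms by (intro powr_mono2) auto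
  also have "\<dots> = ?C * b powr (1 / (q - 1))"
    using assms powr_mult[of "1/\<eta>" b "1 / (q - 1)"] by simp
  finally have "a * b \<le> ?C * b powr (1 / (q - 1)) * b" using assms by (intro mult_right_mono)
  also have "\<dots> = ?C * b powr (q / (q - 1))"
  proof -
    have "q / (q - 1) = 1 / (q - 1) + 1" using assms by (simp add: field_simps)
    then show ?thesis using assms by (cases "b = 0") (simp_all add: powr_add)
  qed
  finally show ?thesis using assms by (simp add: add_increasing)
qed

lemma Young_simple:
  fixes q a b :: real
  assumes "q > 1" "a \<ge> 0" "b \<ge> 0"
  shows "a * b \<le> a powr q + b powr (q / (q - 1))"
  using Young_weighted[of q 1 a b] assms by simp

text \<open>The derivative of \<open>t \<mapsto> \<bar>t\<bar>\<^sup>p / p\<close>. It lets the operator act on the increment of a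
  function, and its strict monotonicity is what makes comparison possible.\<close>

definition pflux :: "real \<Rightarrow> real \<Rightarrow> real" where
  "pflux p t = \<bar>t\<bar> powr (p - 2) * t"

lemma pflux_measurable [measurable]: "pflux p \<in> borel_measurable borel"
  unfolding pflux_def by measurable

lemma pflux_minus: "pflux p (- t) = - pflux p t"
  by (simp add: pflux_def)

lemma abs_pflux: "\<bar>pflux p t\<bar> = \<bar>t\<bar> powr (p - 1)"
proof (cases "t = 0")
  case False
  then have "\<bar>t\<bar> powr (p - 2) * \<bar>t\<bar> powr 1 = \<bar>t\<bar> powr (p - 1)"
    unfolding powr_add[symmetric] by simp
  with False show ?thesis by (simp add: pflux_def abs_mult)
qed (simp add: pflux_def)

lemma pflux_times_self: "p > 0 \<Longrightarrow> pflux p t * t = \<bar>t\<bar> powr p"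
proof (cases "t = 0")
  case False
  then have "\<bar>t\<bar> powr (p - 2) * \<bar>t\<bar> powr 2 = \<bar>t\<bar> powr p"
    unfolding powr_add[symmetric] by simp
  moreover have "\<bar>t\<bar> powr 2 = t * t"
    using False by (simp add: power2_eq_square)
  ultimately show ?thesis by (simp add: pflux_def mult.assoc)
qed (simp add: pflux_def)

lemma pflux_nonneg_eq: "t \<ge> 0 \<Longrightarrow> pflux p t = t powr (p - 1)"
  using abs_pflux[of p t] by (simp add: pflux_def)

lemma pflux_strict_mono:
  assumes "p > 1" "a < b" shows "pflux p a < pflux p b"
proof -
  consider "a \<ge> 0" | "a < 0" "b > 0" | "a < 0" "b \<le> 0" by linarith
  then show ?thesis
  proof cases
    case 1
    then show ?thesis using assms powr_less_mono2[of "p-1" a b] by (simp add: pflux_nonneg_eq)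
  next
    case 2
    have "pflux p a < 0" using 2 by (simp add: pflux_def mult_pos_neg)
    moreover have "pflux p b > 0" using 2 by (simp add: pflux_def)
    ultimately show ?thesis by simp
  next
    case 3
    then have "pflux p (-b) < pflux p (-a)"
      using assms powr_less_mono2[of "p-1" "-b" "-a"] by (simp add: pflux_nonneg_eq)
    then show ?thesis by (simp add: pflux_minus)
  qed
qed

lemma pflux_tendsto:
  assumes "p > 1" "(f \<longlongrightarrow> a) F"
  shows "((\<lambda>x. pflux p (f x)) \<longlongrightarrow> pflux p a) F"
proof -
  have eq: "pflux p t = sgn t * \<bar>t\<bar> powr (p - 1)" for t
    by (cases "t \<ge> 0"; cases "t = 0")
      (use pflux_nonneg_eq[of t p] pflux_nonneg_eq[of "-t" p] pflux_minus[of p t] in auto)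
  show ?thesis
  proof (cases "a = 0")
    case False
    show ?thesis unfolding eq using False assms by (intro tendsto_intros) auto
  next
    case True
    have "((\<lambda>x. \<bar>f x\<bar> powr (p - 1)) \<longlongrightarrow> \<bar>a\<bar> powr (p - 1)) F"
      using assms by (intro tendsto_powr2 tendsto_intros) auto
    then have "((\<lambda>x. \<bar>pflux p (f x)\<bar>) \<longlongrightarrow> 0) F" using True by (simp add: abs_pflux)
    then show ?thesis using True tendsto_rabs_zero_cancel by (simp add: pflux_def[of p 0])
  qed
qed

text \<open>The tangent inequality of the convex function \<open>\<bar>t\<bar>\<^sup>p / p\<close>, which is a form of Young's
  inequality. It bounds the growth of the energy along a segment, so that the energy need not be
  differentiated.\<close>

lemma powr_convex_tangent:
  fixes a c p :: real
  assumes "p > 1"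
  shows "\<bar>c\<bar> powr p / p - \<bar>a\<bar> powr p / p \<le> pflux p c * (c - a)"
proof -
  have "pflux p c * a \<le> \<bar>c\<bar> powr (p - 1) * \<bar>a\<bar>"
    by (metis abs_le_D1 abs_mult abs_pflux order_refl)
  also have "\<dots> \<le> (\<bar>c\<bar> powr (p - 1)) powr (p / (p - 1)) / (p / (p - 1)) + \<bar>a\<bar> powr p / p"
    using assms by (intro Youngs_inequality) (auto simp: field_simps)
  also have "(\<bar>c\<bar> powr (p - 1)) powr (p / (p - 1)) = \<bar>c\<bar> powr p"
    using assms by (simp add: powr_powr)
  finally have "pflux p c * a \<le> \<bar>c\<bar> powr p - \<bar>c\<bar> powr p / p + \<bar>a\<bar> powr p / p"
    using assms by (simp add: field_simps)
  then show ?thesis using pflux_times_self[of p c] assms by (simp add: algebra_simps)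
qed

section \<open>Convergence of integrals\<close>

lemma integrable_abs_bound:
  fixes f g :: "'b \<Rightarrow> real"
  assumes "integrable M g" "f \<in> borel_measurable M" "AE x in M. \<bar>f x\<bar> \<le> g x"
  shows "integrable M f"
  by (rule Bochner_Integration.integrable_bound[OF assms(1,2)]) (use assms(3) in auto)

text \<open>Lower semicontinuity under convergence almost everywhere, for energies and norms alike.\<close>

lemma Fatou_bounded:
  fixes f :: "nat \<Rightarrow> 'b \<Rightarrow> real"
  assumes "\<And>n. integrable M (f n)" "\<And>n x. f n x \<ge> 0" "AE x in M. (\<lambda>n. f n x) \<longlonglongrightarrow> g x"
    and [measurable]: "g \<in> borel_measurable M"
    and le: "\<And>n. (LINT x|M. f n x) \<le> K"
  shows "integrable M g \<and> (LINT x|M. g x) \<le> K"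
proof -
  have [measurable]: "f n \<in> borel_measurable M" for n using assms(1) by auto
  have K: "K \<ge> 0"
    using le[of 0] Bochner_Integration.integral_nonneg[of M "f 0", OF assms(2)] by linarith
  have g0: "AE x in M. g x \<ge> 0"
    using assms(3) by eventually_elim (use assms(2) in \<open>auto intro: LIMSEQ_le_const\<close>)
  have "(\<integral>\<^sup>+x. ennreal (g x) \<partial>M) = (\<integral>\<^sup>+x. liminf (\<lambda>n. ennreal (f n x)) \<partial>M)"
  proof (rule nn_integral_cong_AE)
    show "AE x in M. ennreal (g x) = liminf (\<lambda>n. ennreal (f n x))"
      using assms(3)
    proof eventually_elim
      case (elim x)
      then have "(\<lambda>n. ennreal (f n x)) \<longlonglongrightarrow> ennreal (g x)" by (intro tendsto_ennrealI)
      then show ?case by (metis lim_imp_Liminf sequentially_bot)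
    qed
  qed
  also have "\<dots> \<le> liminf (\<lambda>n. \<integral>\<^sup>+x. ennreal (f n x) \<partial>M)"
    by (intro nn_integral_liminf) auto
  also have "\<dots> \<le> liminf (\<lambda>n::nat. ennreal K)"
    by (intro Liminf_mono always_eventually allI)
       (use assms le in \<open>simp add: nn_integral_eq_integral ennreal_leI\<close>)
  also have "\<dots> = ennreal K" by (simp add: Liminf_const)
  finally have le': "(\<integral>\<^sup>+x. ennreal (g x) \<partial>M) \<le> ennreal K" .
  then have int: "integrable M g"
    using g0 by (intro integrableI_nonneg) (auto simp: less_top[symmetric] top_unique)
  then have "(LINT x|M. g x) \<le> K"
    using le' g0 K by (simp add: nn_integral_eq_integral)
  then show ?thesis using int by simp
qed

text \<open>A bounded sequence of \<open>L\<^sup>q\<close> that converges almost everywhere converges weakly. By Young's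
  inequality \<open>\<bar>d v\<bar>\<close>, with \<open>d = \<phi>\<^sub>n - \<psi>\<close>, exceeds \<open>\<eta> \<bar>d\<bar>\<^sup>q\<close> by at most a multiple of \<open>\<bar>v\<bar>\<close> to the
  conjugate power, so the excess is dominated, while the rest has integral of order \<open>\<eta>\<close>.\<close>

lemma AE_bounded_imp_weak_convergence:
  fixes \<phi> :: "nat \<Rightarrow> 'b \<Rightarrow> real" and \<psi> v :: "'b \<Rightarrow> real"
  assumes q: "q > 1"
    and [measurable]: "\<And>n. \<phi> n \<in> borel_measurable M" "\<psi> \<in> borel_measurable M"
      "v \<in> borel_measurable M"
    and conv: "AE x in M. (\<lambda>n. \<phi> n x) \<longlonglongrightarrow> \<psi> x"
    and int: "\<And>n. integrable M (\<lambda>x. \<bar>\<phi> n x\<bar> powr q)"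
    and bnd: "\<And>n. (LINT x|M. \<bar>\<phi> n x\<bar> powr q) \<le> K"
    and v: "integrable M (\<lambda>x. \<bar>v x\<bar> powr (q / (q - 1)))"
  shows "integrable M (\<lambda>x. \<bar>\<psi> x\<bar> powr q)"
    and "\<And>n. integrable M (\<lambda>x. \<phi> n x * v x)"
    and "integrable M (\<lambda>x. \<psi> x * v x)"
    and "(\<lambda>n. LINT x|M. \<bar>\<phi> n x - \<psi> x\<bar> * \<bar>v x\<bar>) \<longlonglongrightarrow> 0"
    and "(\<lambda>n. LINT x|M. \<phi> n x * v x) \<longlonglongrightarrow> (LINT x|M. \<psi> x * v x)"
proof -
  let ?p = "q / (q - 1)"
  have F: "integrable M (\<lambda>x. \<bar>\<psi> x\<bar> powr q) \<and> (LINT x|M. \<bar>\<psi> x\<bar> powr q) \<le> K"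
  proof (rule Fatou_bounded)
    show "AE x in M. (\<lambda>n. \<bar>\<phi> n x\<bar> powr q) \<longlonglongrightarrow> \<bar>\<psi> x\<bar> powr q"
      using conv by eventually_elim (use q in \<open>intro tendsto_powr2 tendsto_intros; auto\<close>)
  qed (use int bnd in auto)
  then show psi: "integrable M (\<lambda>x. \<bar>\<psi> x\<bar> powr q)" by simp
  have prod: "integrable M (\<lambda>x. g x * v x)"
    if "integrable M (\<lambda>x. \<bar>g x\<bar> powr q)" and [measurable]: "g \<in> borel_measurable M" for g
  proof (rule integrable_abs_bound)
    show "integrable M (\<lambda>x. \<bar>g x\<bar> powr q + \<bar>v x\<bar> powr ?p)" using that v by simp
    show "AE x in M. \<bar>g x * v x\<bar> \<le> \<bar>g x\<bar> powr q + \<bar>v x\<bar> powr ?p"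
      using Young_simple[OF q] by (auto simp: abs_mult)
  qed measurable
  show iphi: "integrable M (\<lambda>x. \<phi> n x * v x)" for n using prod int by simp
  show ipsi: "integrable M (\<lambda>x. \<psi> x * v x)" using prod psi by simp
  define d where "d n x = \<phi> n x - \<psi> x" for n x
  have [measurable]: "d n \<in> borel_measurable M" for n unfolding d_def by measurable
  define K' where "K' = 2 powr q * (K + K)"
  have dq: "integrable M (\<lambda>x. \<bar>d n x\<bar> powr q) \<and> (LINT x|M. \<bar>d n x\<bar> powr q) \<le> K'" for n
  proof
    have i: "integrable M (\<lambda>x. 2 powr q * (\<bar>\<phi> n x\<bar> powr q + \<bar>\<psi> x\<bar> powr q))"
      using int psi by simp
    have le: "\<bar>d n x\<bar> powr q \<le> 2 powr q * (\<bar>\<phi> n x\<bar> powr q + \<bar>\<psi> x\<bar> powr q)" for x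
      unfolding d_def using q by (intro abs_diff_powr_le) simp
    show id: "integrable M (\<lambda>x. \<bar>d n x\<bar> powr q)"
      by (rule integrable_abs_bound[OF i]) (use le in auto)
    have "(LINT x|M. \<bar>d n x\<bar> powr q) \<le> (LINT x|M. 2 powr q * (\<bar>\<phi> n x\<bar> powr q + \<bar>\<psi> x\<bar> powr q))"
      using id i le by (intro integral_mono)
    also have "\<dots> = 2 powr q * ((LINT x|M. \<bar>\<phi> n x\<bar> powr q) + (LINT x|M. \<bar>\<psi> x\<bar> powr q))"
      using int psi by simp
    also have "\<dots> \<le> K'" unfolding K'_def using F bnd by (intro mult_left_mono add_mono) auto
    finally show "(LINT x|M. \<bar>d n x\<bar> powr q) \<le> K'" .
  qed
  have "(LINT x|M. \<bar>d 0 x\<bar> powr q) \<ge> 0"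
    by (intro Bochner_Integration.integral_nonneg) simp
  then have K': "K' \<ge> 0" using dq[of 0] by linarith
  have idv: "integrable M (\<lambda>x. \<bar>d n x\<bar> * \<bar>v x\<bar>)" for n
    using integrable_abs[OF prod[of "d n"]] dq[of n] by (simp add: abs_mult)
  have lim: "(\<lambda>n. LINT x|M. \<bar>d n x\<bar> * \<bar>v x\<bar>) \<longlonglongrightarrow> 0"
  proof (rule LIMSEQ_I)
    fix e :: real assume e: "e > 0"
    \<comment> \<open>the \<open>+ 1\<close> only guards against \<open>K' = 0\<close>\<close>
    define \<eta> where "\<eta> = e / (2 * (K' + 1))"
    have \<eta>: "\<eta> > 0" "\<eta> * K' < e / 2 + e * 0"
      using e K' by (auto simp: \<eta>_def field_simps)
    define C where "C = (1 / \<eta>) powr (1 / (q - 1))"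
    have C: "C \<ge> 0"
      "\<And>a b. a \<ge> 0 \<Longrightarrow> b \<ge> 0 \<Longrightarrow> a * b \<le> \<eta> * a powr q + C * b powr ?p"
      unfolding C_def using Young_weighted[OF q \<eta>(1)] by auto
    \<comment> \<open>the dominated excess\<close>
    let ?w = "\<lambda>n x. max 0 (\<bar>d n x\<bar> * \<bar>v x\<bar> - \<eta> * \<bar>d n x\<bar> powr q)"
    have "(\<lambda>n. LINT x|M. ?w n x) \<longlonglongrightarrow> (LINT x|M. 0)"
    proof (rule integral_dominated_convergence)
      show "integrable M (\<lambda>x. C * \<bar>v x\<bar> powr ?p)" using v by simp
      show "AE x in M. (\<lambda>n. ?w n x) \<longlonglongrightarrow> 0"
        using conv
      proof eventually_elim
        case (elim x)
        then have "(\<lambda>n. d n x) \<longlonglongrightarrow> 0" unfolding d_def by (simp add: LIM_zero)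
        then have "(\<lambda>n. ?w n x) \<longlonglongrightarrow> max 0 (\<bar>0\<bar> * \<bar>v x\<bar> - \<eta> * \<bar>0\<bar> powr q)"
          using q by (intro tendsto_intros tendsto_powr2) auto
        then show ?case by simp
      qed
      show "AE x in M. norm (?w n x) \<le> C * \<bar>v x\<bar> powr ?p" for n
        using C(2)[of "\<bar>d n x\<bar>" "\<bar>v x\<bar>" for x] C(1) by (intro AE_I2) (auto simp: algebra_simps max_def)
    qed measurable
    then have "eventually (\<lambda>n. (LINT x|M. ?w n x) < e / 2) sequentially"
      using e by (intro order_tendstoD(2)) auto
    then obtain N where N: "\<And>n. n \<ge> N \<Longrightarrow> (LINT x|M. ?w n x) < e / 2"
      unfolding eventually_sequentially by blast
    show "\<exists>N. \<forall>n\<ge>N. norm ((LINT x|M. \<bar>d n x\<bar> * \<bar>v x\<bar>) - 0) < e"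
    proof (intro exI[of _ N] allI impI)
      fix n assume n: "n \<ge> N"
      have wi: "integrable M (?w n)"
        by (rule integrable_abs_bound[of _ "\<lambda>x. \<bar>d n x\<bar> * \<bar>v x\<bar>"]) (use idv \<eta> in auto)
      have "(LINT x|M. \<bar>d n x\<bar> * \<bar>v x\<bar>) \<le> (LINT x|M. \<eta> * \<bar>d n x\<bar> powr q + ?w n x)"
        using idv dq wi by (intro integral_mono) auto
      also have "\<dots> = \<eta> * (LINT x|M. \<bar>d n x\<bar> powr q) + (LINT x|M. ?w n x)"
        using dq wi by simp
      also have "\<dots> \<le> \<eta> * K' + (LINT x|M. ?w n x)"
        using dq \<eta> by (intro add_right_mono mult_left_mono) auto
      also have "\<dots> < e" using \<eta>(2) N[OF n] by simp
      finally show "norm ((LINT x|M. \<bar>d n x\<bar> * \<bar>v x\<bar>) - 0) < e" by simp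
    qed
  qed
  then show "(\<lambda>n. LINT x|M. \<bar>\<phi> n x - \<psi> x\<bar> * \<bar>v x\<bar>) \<longlonglongrightarrow> 0" by (simp add: d_def)
  have "(\<lambda>n. (LINT x|M. \<phi> n x * v x) - (LINT x|M. \<psi> x * v x)) \<longlonglongrightarrow> 0"
  proof (rule Lim_null_comparison[OF _ lim], intro always_eventually allI)
    fix n
    have "(LINT x|M. \<phi> n x * v x) - (LINT x|M. \<psi> x * v x) = (LINT x|M. d n x * v x)"
      using iphi ipsi by (simp add: d_def left_diff_distrib)
    also have "\<bar>\<dots>\<bar> \<le> (LINT x|M. \<bar>d n x * v x\<bar>)" by (rule integral_abs_bound)
    finally show "norm ((LINT x|M. \<phi> n x * v x) - (LINT x|M. \<psi> x * v x))
        \<le> (LINT x|M. \<bar>d n x\<bar> * \<bar>v x\<bar>)" by (simp add: abs_mult)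
  qed
  then show "(\<lambda>n. LINT x|M. \<phi> n x * v x) \<longlonglongrightarrow> (LINT x|M. \<psi> x * v x)"
    by (simp add: LIM_zero_iff)
qed

section \<open>The measure of the Gagliardo seminorm\<close>

interpretation lebesgue: sigma_finite_measure "lebesgue :: 'a::euclidean_space measure"
proof
  obtain A :: "nat \<Rightarrow> 'a set" where A: "range A \<subseteq> sets lborel" "(\<Union>i. A i) = space lborel"
      "\<And>i. emeasure lborel (A i) \<noteq> \<infinity>"
    using lborel.sigma_finite by metis
  show "\<exists>A. countable A \<and> A \<subseteq> sets lebesgue \<and> \<Union> A = space (lebesgue :: 'a measure) \<and>
      (\<forall>a\<in>A. emeasure lebesgue a \<noteq> \<infinity>)"
    using A by (intro exI[of _ "range A"]) (auto simp: emeasure_completion subset_eq)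
qed

interpretation lebesgue_pair: pair_sigma_finite
  "lebesgue :: 'a::euclidean_space measure" "lebesgue :: 'b::euclidean_space measure" ..

lemma ident_lebesgue_borel [measurable]: "(\<lambda>x. x) \<in> borel_measurable lebesgue"
  using id_borel_measurable_lebesgue by (simp add: id_def)

definition frac_kernel :: "real \<Rightarrow> real \<Rightarrow> 'a::euclidean_space \<Rightarrow> 'a \<Rightarrow> real" where
  "frac_kernel s p x y = norm (x - y) powr (- real DIM('a) - p * s)"

lemma frac_kernel_nonneg [simp]: "frac_kernel s p x y \<ge> 0"
  by (simp add: frac_kernel_def)

lemma frac_kernel_commute: "frac_kernel s p x y = frac_kernel s p y x"
  by (simp add: frac_kernel_def norm_minus_commute)

lemma frac_kernel_measurable [measurable]:
  assumes [measurable]: "f \<in> borel_measurable M" "g \<in> borel_measurable M"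
  shows "(\<lambda>x. frac_kernel s p (f x) (g x)) \<in> borel_measurable M"
  unfolding frac_kernel_def by measurable

lemma sets_frac_measure [measurable_cong, simp]:
  "sets (frac_measure s p :: ('a::euclidean_space \<times> 'a) measure) = sets (lebesgue \<Otimes>\<^sub>M lebesgue)"
  by (simp add: frac_measure_def)

lemma frac_measure_eq:
  "frac_measure s p = density (lebesgue \<Otimes>\<^sub>M lebesgue) (\<lambda>z. ennreal (frac_kernel s p (fst z) (snd z)))"
  by (simp add: frac_measure_def frac_kernel_def)

lemma nn_integral_frac_measure:
  fixes g :: "'a::euclidean_space \<times> 'a \<Rightarrow> ennreal"
  assumes [measurable]: "g \<in> borel_measurable (lebesgue \<Otimes>\<^sub>M lebesgue)"
  shows "(\<integral>\<^sup>+z. g z \<partial>frac_measure s p) =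
    (\<integral>\<^sup>+x. \<integral>\<^sup>+y. ennreal (frac_kernel s p x y) * g (x, y) \<partial>lebesgue \<partial>lebesgue)"
proof -
  have "(\<integral>\<^sup>+z. g z \<partial>frac_measure s p) =
      (\<integral>\<^sup>+z. ennreal (frac_kernel s p (fst z) (snd z)) * g z \<partial>(lebesgue \<Otimes>\<^sub>M lebesgue))"
    unfolding frac_measure_eq by (rule nn_integral_density) measurable
  also have "\<dots> = (\<integral>\<^sup>+x. \<integral>\<^sup>+y. ennreal (frac_kernel s p x y) * g (x, y) \<partial>lebesgue \<partial>lebesgue)"
    by (subst lebesgue.nn_integral_fst[symmetric]) simp_all
  finally show ?thesis .
qed

lemma nn_integral_frac_measure_swap:
  fixes g :: "'a::euclidean_space \<times> 'a \<Rightarrow> ennreal"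
  assumes [measurable]: "g \<in> borel_measurable (lebesgue \<Otimes>\<^sub>M lebesgue)"
  shows "(\<integral>\<^sup>+z. g z \<partial>frac_measure s p) = (\<integral>\<^sup>+z. g (snd z, fst z) \<partial>frac_measure s p)"
proof -
  have "(\<integral>\<^sup>+z. g z \<partial>frac_measure s p) =
    (\<integral>\<^sup>+x. \<integral>\<^sup>+y. ennreal (frac_kernel s p x y) * g (x, y) \<partial>lebesgue \<partial>lebesgue)"
    by (rule nn_integral_frac_measure) measurable
  also have "\<dots> = (\<integral>\<^sup>+y. \<integral>\<^sup>+x. ennreal (frac_kernel s p x y) * g (x, y) \<partial>lebesgue \<partial>lebesgue)"
    by (intro lebesgue_pair.Fubini') measurable
  also have "\<dots> = (\<integral>\<^sup>+z. g (snd z, fst z) \<partial>frac_measure s p)"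
    by (subst nn_integral_frac_measure) (simp_all add: frac_kernel_commute)
  finally show ?thesis .
qed

lemma AE_lebesgue_imp_AE_fst_snd:
  fixes P :: "'a::euclidean_space \<Rightarrow> bool"
  assumes "AE x in lebesgue. P x"
  shows "AE z in frac_measure s p. P (fst z) \<and> P (snd z)"
proof -
  obtain N where N: "N \<in> null_sets lebesgue" "{x. \<not> P x} \<subseteq> N"
    using assms by (auto simp: eventually_ae_filter)
  have [measurable]: "N \<in> sets lebesgue" using N by auto
  have "AE z in lebesgue \<Otimes>\<^sub>M (lebesgue :: 'a measure). fst z \<notin> N \<and> snd z \<notin> N"
  proof (rule lebesgue_pair.AE_pair_measure)
    show "AE x in lebesgue. AE y in lebesgue. fst (x, y) \<notin> N \<and> snd (x, y) \<notin> N"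
      using AE_not_in[OF N(1)] by auto
  qed measurable
  then have "AE z in lebesgue \<Otimes>\<^sub>M (lebesgue :: 'a measure). P (fst z) \<and> P (snd z)"
    by eventually_elim (use N in auto)
  then show ?thesis
    unfolding frac_measure_eq by (subst AE_density) auto
qed

text \<open>Going back to Lebesgue measure requires a positive density, which fails exactly on the
  diagonal.\<close>

lemma AE_frac_measure_imp_AE_AE:
  fixes P :: "'a::euclidean_space \<Rightarrow> 'a \<Rightarrow> bool"
  assumes "AE z in frac_measure s p. P (fst z) (snd z)"
  shows "AE x in lebesgue. AE y in lebesgue. x \<noteq> y \<longrightarrow> P x y"
proof -
  have "AE z in lebesgue \<Otimes>\<^sub>M lebesgue. 0 < ennreal (frac_kernel s p (fst z) (snd z))
      \<longrightarrow> P (fst z) (snd z)"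
    using assms unfolding frac_measure_eq by (subst (asm) AE_density) auto
  then have "AE x in lebesgue. AE y in lebesgue. 0 < ennreal (frac_kernel s p x y) \<longrightarrow> P x y"
    by (rule lebesgue_pair.AE_pair[THEN AE_mp]) auto
  then show ?thesis
    by (simp add: frac_kernel_def)
qed

text \<open>The contribution of a point to the Gagliardo seminorm.\<close>

definition frac_density :: "real \<Rightarrow> real \<Rightarrow> 'a::euclidean_space set \<Rightarrow> ('a \<Rightarrow> real) \<Rightarrow> 'a \<Rightarrow> ennreal"
  where "frac_density s p U u x =
    (\<integral>\<^sup>+y\<in>U. ennreal (frac_kernel s p x y * \<bar>u x - u y\<bar> powr p) \<partial>lebesgue)"

lemma frac_density_measurable [measurable]:
  assumes [measurable]: "u \<in> borel_measurable lebesgue" "U \<in> sets lebesgue"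
  shows "frac_density s p U u \<in> borel_measurable lebesgue"
  unfolding frac_density_def by measurable

lemma gagliardo_eq_density:
  fixes U :: "'a::euclidean_space set"
  assumes [measurable]: "u \<in> borel_measurable lebesgue" "U \<in> sets lebesgue"
  shows "gagliardo s p U u = (\<integral>\<^sup>+x\<in>U. frac_density s p U u x \<partial>lebesgue)"
proof -
  have [measurable]: "U \<times> U \<in> sets (lebesgue \<Otimes>\<^sub>M lebesgue)" by measurable
  have "gagliardo s p U u = (\<integral>\<^sup>+x. \<integral>\<^sup>+y. ennreal (frac_kernel s p x y) *
      (ennreal (\<bar>u x - u y\<bar> powr p) * indicator (U \<times> U) (x, y)) \<partial>lebesgue \<partial>lebesgue)"
    unfolding gagliardo_def by (subst nn_integral_frac_measure) simp_all
  also have "\<dots> = (\<integral>\<^sup>+x. \<integral>\<^sup>+y. (ennreal (frac_kernel s p x y * \<bar>u x - u y\<bar> powr p) * indicator U y) * indicator U x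
      \<partial>lebesgue \<partial>lebesgue)"
    by (intro nn_integral_cong) (auto simp: indicator_def ennreal_mult)
  also have "\<dots> = (\<integral>\<^sup>+x\<in>U. frac_density s p U u x \<partial>lebesgue)"
    unfolding frac_density_def by (subst nn_integral_multc) simp_all
  finally show ?thesis .
qed

section \<open>Subcritical fractional Sobolev embedding\<close>

abbreviation Lpow :: "real \<Rightarrow> 'a::euclidean_space set \<Rightarrow> ('a \<Rightarrow> real) \<Rightarrow> ennreal" where
  "Lpow p A u \<equiv> (\<integral>\<^sup>+x\<in>A. ennreal (\<bar>u x\<bar> powr p) \<partial>lebesgue)"

lemma emeasure_ball_powr:
  assumes "r > 0"
  shows "emeasure lebesgue (ball (c::'a::euclidean_space) r) =
    ennreal (measure lebesgue (ball (0::'a) 1) * r powr real DIM('a))"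
proof -
  have fin: "emeasure lebesgue (ball (0::'a) 1) = ennreal (measure lebesgue (ball (0::'a) 1))"
    using emeasure_lborel_ball_finite[of "0::'a" 1]
    by (subst emeasure_eq_ennreal_measure) auto
  have "emeasure lebesgue (ball c r) = ennreal (r ^ DIM('a)) * emeasure lebesgue (ball (0::'a) 1)"
    using assms by (intro emeasure_lebesgue_ball_conv_unit_ball) simp
  also have "\<dots> = ennreal (r ^ DIM('a) * measure lebesgue (ball (0::'a) 1))"
    unfolding fin using assms by (intro ennreal_mult[symmetric]) auto
  finally show ?thesis using assms by (simp add: powr_realpow mult.commute)
qed

lemma measure_unit_ball_pos: "measure lebesgue (ball (0::'a::euclidean_space) 1) > 0"
  using content_ball_pos[of 1 "0::'a"] by simp

lemma emeasure_bounded_less_top: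
  assumes "bounded (A :: 'a::euclidean_space set)" shows "emeasure lebesgue A < \<infinity>"
proof (cases "A \<in> sets lebesgue")
  case True
  then show ?thesis
    using fmeasurableD2[OF bounded_set_imp_lmeasurable[OF assms True]] by (simp add: less_top)
next
  case False
  then show ?thesis by (simp add: emeasure_notin_sets)
qed

text \<open>At distance at most \<open>r\<close> the kernel is at least \<open>r\<close> to the power \<open>-(N + ps)\<close>. On the
  diagonal, where the formula gives the kernel the value \<open>0\<close>, both sides vanish.\<close>

lemma powr_le_kernel:
  assumes "norm (x - y) \<le> r" "0 \<le> p" "0 \<le> s" "t > 0"
  shows "\<bar>u x - u y\<bar> powr t \<le> r powr (real DIM('a) + p * s) *
    (frac_kernel s p (x::'a::euclidean_space) y * \<bar>u x - u y\<bar> powr t)"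
proof (cases "x = y")
  case False
  then have n: "norm (x - y) > 0" by simp
  have "norm (x - y) powr (real DIM('a) + p * s) \<le> r powr (real DIM('a) + p * s)"
    using assms by (intro powr_mono2) auto
  then have "1 \<le> r powr (real DIM('a) + p * s) * frac_kernel s p x y"
    using n by (simp add: frac_kernel_def powr_diff powr_minus powr_add field_simps)
  then have "1 * \<bar>u x - u y\<bar> powr t \<le> (r powr (real DIM('a) + p * s) * frac_kernel s p x y) *
      \<bar>u x - u y\<bar> powr t"
    by (intro mult_right_mono) auto
  then show ?thesis by (simp add: mult.assoc)
qed (use assms in simp)

text \<open>If \<open>\<bar>u x\<bar>\<close> exceeds \<open>\<alpha> + \<beta>\<close>, then every \<open>y\<close> has \<open>\<bar>u x - u y\<bar> \<ge> \<alpha>\<close> or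
  \<open>\<bar>u y\<bar> \<ge> \<beta>\<close>. Chebyshev's inequality bounds the measures of the two sets within the ball, and the last
  hypothesis says that together they are too small to cover it.\<close>

lemma pointwise_bound:
  fixes u :: "'a::euclidean_space \<Rightarrow> real"
  defines "N \<equiv> real DIM('a)" and "\<omega> \<equiv> measure lebesgue (ball (0::'a) 1)"
  assumes [measurable]: "u \<in> borel_measurable lebesgue" "B \<in> sets lebesgue" "U \<in> sets lebesgue"
    and ball: "ball x r \<subseteq> B" "ball x r \<subseteq> U"
    and pos: "r > 0" "\<alpha> > 0" "\<beta> > 0" "p > 0" "s \<ge> 0" "a > 0" "G \<ge> 0" "K \<ge> 0"
    and G: "frac_density s p U u x \<le> ennreal G"
    and K: "Lpow a B u \<le> ennreal K"
    and less: "G * r powr (N + p * s) / \<alpha> powr p + K / \<beta> powr a < \<omega> * r powr N"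
  shows "\<bar>u x\<bar> \<le> \<alpha> + \<beta>"
proof (rule ccontr)
  assume contra: "\<not> \<bar>u x\<bar> \<le> \<alpha> + \<beta>"
  have le: "1 \<le> r powr (N + p * s) / \<alpha> powr p * (frac_kernel s p x y * \<bar>u x - u y\<bar> powr p)
      + 1 / \<beta> powr a * \<bar>u y\<bar> powr a" if y: "y \<in> ball x r" for y
  proof (cases "\<bar>u x - u y\<bar> \<ge> \<alpha>")
    case True
    have "\<alpha> powr p \<le> \<bar>u x - u y\<bar> powr p" using True pos by (intro powr_mono2) auto
    also have "\<dots> \<le> r powr (N + p * s) * (frac_kernel s p x y * \<bar>u x - u y\<bar> powr p)"
      unfolding N_def using y pos by (intro powr_le_kernel) (auto simp: dist_norm)
    finally have "1 \<le> r powr (N + p * s) / \<alpha> powr p * (frac_kernel s p x y * \<bar>u x - u y\<bar> powr p)"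
      using pos by (simp add: field_simps)
    then show ?thesis by (simp add: add_increasing2)
  next
    case False
    then have "\<beta> \<le> \<bar>u y\<bar>" using contra by linarith
    then have "\<beta> powr a \<le> \<bar>u y\<bar> powr a" using pos by (intro powr_mono2) auto
    then have "1 \<le> 1 / \<beta> powr a * \<bar>u y\<bar> powr a" using pos by (simp add: field_simps)
    moreover have "0 \<le> r powr (N + p * s) / \<alpha> powr p * (frac_kernel s p x y * \<bar>u x - u y\<bar> powr p)"
      by simp
    ultimately show ?thesis by linarith
  qed
  have "ennreal (\<omega> * r powr N) = emeasure lebesgue (ball x r)"
    unfolding \<omega>_def N_def using pos by (intro emeasure_ball_powr[symmetric]) simp
  also have "\<dots> = (\<integral>\<^sup>+y. indicator (ball x r) y \<partial>lebesgue)" by simp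
  also have "\<dots> \<le> (\<integral>\<^sup>+y. ennreal (r powr (N + p * s) / \<alpha> powr p) *
        (ennreal (frac_kernel s p x y * \<bar>u x - u y\<bar> powr p) * indicator U y)
      + ennreal (1 / \<beta> powr a) * (ennreal (\<bar>u y\<bar> powr a) * indicator B y) \<partial>lebesgue)"
  proof (rule nn_integral_mono)
    fix y
    show "indicator (ball x r) y \<le> ennreal (r powr (N + p * s) / \<alpha> powr p) *
        (ennreal (frac_kernel s p x y * \<bar>u x - u y\<bar> powr p) * indicator U y)
      + ennreal (1 / \<beta> powr a) * (ennreal (\<bar>u y\<bar> powr a) * indicator B y)"
    proof (cases "y \<in> ball x r")
      case True
      then have "y \<in> U" "y \<in> B" using ball by auto
      moreover have "ennreal 1 \<le> ennreal (r powr (N + p * s) / \<alpha> powr p *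
          (frac_kernel s p x y * \<bar>u x - u y\<bar> powr p) + 1 / \<beta> powr a * \<bar>u y\<bar> powr a)"
        using le[OF True] by (intro ennreal_leI)
      ultimately show ?thesis using True
        by (simp add: ennreal_plus ennreal_mult del: times_divide_eq_left times_divide_eq_right)
    qed simp
  qed
  also have "\<dots> = ennreal (r powr (N + p * s) / \<alpha> powr p) * frac_density s p U u x
      + ennreal (1 / \<beta> powr a) * Lpow a B u"
    unfolding frac_density_def by (subst nn_integral_add) (simp_all add: nn_integral_cmult)
  also have "\<dots> \<le> ennreal (r powr (N + p * s) / \<alpha> powr p) * ennreal G + ennreal (1 / \<beta> powr a) * ennreal K"
    using G K by (intro add_mono mult_left_mono) auto
  also have "\<dots> = ennreal (G * r powr (N + p * s) / \<alpha> powr p + K / \<beta> powr a)"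
    using pos by (simp add: ennreal_mult[symmetric] ennreal_plus[symmetric] mult.commute del: ennreal_plus)
  finally have "\<omega> * r powr N \<le> G * r powr (N + p * s) / \<alpha> powr p + K / \<beta> powr a"
    using pos by (subst (asm) ennreal_le_iff) auto
  with less show False by simp
qed

text \<open>A gain of integrability. With \<open>G\<close> the density of the seminorm at \<open>x\<close>, the preceding bound reads
  \<open>\<bar>u x\<bar> \<le> C (r\<^sup>s G\<^bsup>1/p\<^esup> + r\<^bsup>-N/a\<^esup>)\<close> for all small \<open>r\<close>. At the radius where the two terms
  are of the same order, the right-hand side is a power of \<open>G\<close>, and \<open>p + (ps/N) a\<close> is the exponent that makes it
  linear in \<open>G\<close>, hence integrable. Adding \<open>1\<close> to \<open>G\<close> keeps the radius below \<open>\<delta>\<close>.\<close>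

lemma embedding_step_pointwise:
  fixes s p a \<delta> K :: real
  defines "N \<equiv> real DIM('a::euclidean_space)"
  assumes pos: "s > 0" "p > 0" "a > 0" "\<delta> > 0" "K > 0"
  obtains C where "C \<ge> 0" "\<And>(u::'a \<Rightarrow> real) B U x. u \<in> borel_measurable lebesgue \<Longrightarrow> B \<in> sets lebesgue \<Longrightarrow>
     U \<in> sets lebesgue \<Longrightarrow> ball x \<delta> \<subseteq> B \<Longrightarrow> ball x \<delta> \<subseteq> U \<Longrightarrow>
     Lpow a B u \<le> ennreal K \<Longrightarrow>
     ennreal (\<bar>u x\<bar> powr (p + p * s / N * a)) \<le> ennreal C * (frac_density s p U u x + 1)"
proof -
  define \<omega> where "\<omega> = measure lebesgue (ball (0::'a) 1)"
  have N: "N > 0" and \<omega>: "\<omega> > 0" using measure_unit_ball_pos by (auto simp: N_def \<omega>_def)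
  define a' where "a' = p + p * s / N * a"
  define \<kappa> where "\<kappa> = a / (p * (s * a + N))"
  have a': "a' > 0" using pos N by (simp add: a'_def add_pos_pos)
  have sa: "s * a + N > 0" using pos N by (simp add: add_pos_pos)
  have a'_eq: "a' = p * (s * a + N) / N" using N by (simp add: a'_def field_simps)
  have \<kappa>: "\<kappa> > 0" using pos sa by (simp add: \<kappa>_def)
  have \<kappa>1: "1 - \<kappa> * (p * s) = p / a'"
  proof -
    have "1 - \<kappa> * (p * s) = 1 - a * s / (s * a + N)" unfolding \<kappa>_def using pos by simp
    also have "\<dots> = N / (s * a + N)" using sa by (simp add: field_simps)
    finally show ?thesis unfolding a'_eq using pos by simp
  qed
  have \<kappa>2: "\<kappa> * N = a / a'"
    unfolding \<kappa>_def a'_eq using pos sa N by (simp add: field_simps)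
  \<comment> \<open>the factors \<open>3\<close> leave a third of the measure of the ball to each of the two sets\<close>
  define c1 where "c1 = (3 * \<delta> powr (p * s) / \<omega>) powr (1 / p)"
  define c2 where "c2 = (3 * K * \<delta> powr (- N) / \<omega>) powr (1 / a)"
  have c: "c1 > 0" "c2 > 0" using pos \<omega> by (auto simp: c1_def c2_def)
  have c1p: "c1 powr p = 3 * \<delta> powr (p * s) / \<omega>" and c2a: "c2 powr a = 3 * K * \<delta> powr (- N) / \<omega>"
    using pos \<omega> by (auto simp: c1_def c2_def powr_powr)
  show thesis
  proof (rule that[of "(c1 + c2) powr a'"])
    fix u :: "'a \<Rightarrow> real" and B U x
    assume [measurable]: "u \<in> borel_measurable lebesgue" "B \<in> sets lebesgue" "U \<in> sets lebesgue"
      and ball: "ball x \<delta> \<subseteq> B" "ball x \<delta> \<subseteq> U"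
      and K: "Lpow a B u \<le> ennreal K"
    show "ennreal (\<bar>u x\<bar> powr (p + p * s / N * a)) \<le> ennreal ((c1 + c2) powr a') * (frac_density s p U u x + 1)"
    proof (cases "frac_density s p U u x = \<infinity>")
      case True
      then show ?thesis using c by (simp add: ennreal_mult_top)
    next
      case False
      define G where "G = enn2real (frac_density s p U u x)"
      have G: "frac_density s p U u x = ennreal G" "G \<ge> 0"
        using False by (simp_all add: G_def less_top)
      define G' where "G' = G + 1"
      have G': "G' \<ge> 1" "G' > 0" "G < G'" using G by (auto simp: G'_def)
      \<comment> \<open>the radius at which the two error terms balance\<close>
      define r where "r = \<delta> * G' powr (- \<kappa>)"
      have "G' powr (- \<kappa>) \<le> 1" using G' \<kappa> by (simp add: powr_minus field_simps ge_one_powr_ge_zero)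
      then have r: "r > 0" "r \<le> \<delta>" using pos G' by (simp_all add: r_def mult_left_le)
      have rps: "r powr (p * s) * G' = \<delta> powr (p * s) * G' powr (p / a')"
      proof -
        have "r powr (p * s) * G' = \<delta> powr (p * s) * (G' powr (- \<kappa> * (p * s)) * G' powr 1)"
          using pos G' by (simp add: r_def powr_mult powr_powr)
        also have "G' powr (- \<kappa> * (p * s)) * G' powr 1 = G' powr (p / a')"
          unfolding powr_add[symmetric] \<kappa>1[symmetric] by (simp add: algebra_simps)
        finally show ?thesis .
      qed
      have rN: "r powr N = \<delta> powr N * G' powr (- (a / a'))"
        using pos G' by (simp add: r_def powr_mult powr_powr flip: \<kappa>2)
      let ?\<alpha> = "c1 * G' powr (1 / a')" and ?\<beta> = "c2 * G' powr (1 / a')"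
      have "G * r powr (N + p * s) / ?\<alpha> powr p < \<omega> * r powr N / 2"
      proof -
        have "?\<alpha> powr p = 3 * \<delta> powr (p * s) / \<omega> * G' powr (p / a')"
          using c G' by (simp add: powr_mult powr_powr c1p)
        also have "\<dots> = 3 / \<omega> * (r powr (p * s) * G')" unfolding rps by simp
        finally have "G * r powr (N + p * s) / ?\<alpha> powr p = (G / G') * (\<omega> * r powr N / 3)"
          using r \<omega> G' by (simp add: powr_add mult_ac)
        also have "\<dots> \<le> 1 * (\<omega> * r powr N / 3)"
          using G' \<omega> by (intro mult_right_mono) auto
        also have "\<dots> < \<omega> * r powr N / 2" using \<omega> r by simp
        finally show ?thesis .
      qed
      moreover have "K / ?\<beta> powr a < \<omega> * r powr N / 2"
      proof -
        have "?\<beta> powr a = 3 * K * \<delta> powr (- N) / \<omega> * G' powr (a / a')"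
          using c G' by (simp add: powr_mult powr_powr c2a)
        also have "\<dots> = 3 * K / (\<omega> * r powr N)"
          unfolding rN using pos G' by (simp add: powr_minus field_simps)
        finally have "K / ?\<beta> powr a = \<omega> * r powr N / 3" using pos by simp
        also have "\<dots> < \<omega> * r powr N / 2" using \<omega> r by simp
        finally show ?thesis .
      qed
      ultimately have less: "G * r powr (N + p * s) / ?\<alpha> powr p + K / ?\<beta> powr a < \<omega> * r powr N"
        by linarith
      have "ball x r \<subseteq> ball x \<delta>" using r by auto
      then have bound: "\<bar>u x\<bar> \<le> ?\<alpha> + ?\<beta>"
        using ball pos c G' G K r less unfolding N_def \<omega>_def
        by (intro pointwise_bound[of u B U x r _ _ p s a G K]) auto
      have "\<bar>u x\<bar> powr a' \<le> ((c1 + c2) * G' powr (1 / a')) powr a'"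
        using bound a' by (intro powr_mono2) (auto simp: algebra_simps)
      also have "\<dots> = (c1 + c2) powr a' * G'"
        using c G' a' by (simp add: powr_mult powr_powr)
      finally have "ennreal (\<bar>u x\<bar> powr a') \<le> ennreal ((c1 + c2) powr a' * G')" by (rule ennreal_leI)
      also have "\<dots> = ennreal ((c1 + c2) powr a') * (frac_density s p U u x + 1)"
        using G by (simp add: ennreal_mult G'_def ennreal_plus)
      finally show ?thesis unfolding a'_def .
    qed
  qed simp
qed

text \<open>The exponents \<open>p\<^sub>s\<^sup>* (1 - (ps/N)\<^bsup>k+1\<^esup>)\<close> start at \<open>p\<close> and solve the recursion
  \<open>a\<^sub>k\<^sub>+\<^sub>1 = p + (ps/N) a\<^sub>k\<close>. A step on \<open>A\<close> uses the bound on a neighbourhood of \<open>A\<close>, which is why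
  the induction is over all \<open>A\<close> at a positive distance from the complement of \<open>U\<close>.\<close>

lemma embedding_iterate:
  fixes U :: "'a::euclidean_space set" and s p :: real
  defines "N \<equiv> real DIM('a)"
  assumes pos: "s > 0" "p > 0" "p * s < N" and U: "open U"
    and "\<delta> > 0" "bounded A" "A \<in> sets lebesgue" "\<And>x. x \<in> A \<Longrightarrow> ball x \<delta> \<subseteq> U" "K > 0"
  shows "\<exists>C\<ge>0. \<forall>u. u \<in> borel_measurable lebesgue \<longrightarrow> gagliardo s p U u \<le> ennreal K \<longrightarrow>
     Lpow p U u \<le> ennreal K \<longrightarrow>
     (\<integral>\<^sup>+y\<in>A. ennreal (\<bar>u y\<bar> powr (critical_exponent N s p * (1 - (p * s / N) ^ Suc k))) \<partial>lebesgue)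
       \<le> ennreal C"
  using assms(6-10)
proof (induction k arbitrary: \<delta> A)
  case 0
  have N: "N > 0" by (simp add: N_def)
  have eq: "critical_exponent N s p * (1 - (p * s / N) ^ Suc 0) = p"
    using pos N by (simp add: critical_exponent_def field_simps)
  show ?case unfolding eq
  proof (intro exI[of _ K] conjI allI impI)
    fix u :: "'a \<Rightarrow> real"
    assume "Lpow p U u \<le> ennreal K"
    moreover have "A \<subseteq> U" using 0 by force
    then have "Lpow p A u \<le> Lpow p U u"
      by (intro nn_integral_mono) (auto simp: indicator_def)
    ultimately show "Lpow p A u \<le> ennreal K" by order
  qed (use 0 in simp)
next
  case (Suc k)
  have N: "N > 0" by (simp add: N_def)
  let ?P = "critical_exponent N s p"
  let ?\<rho> = "p * s / N"
  have \<rho>: "0 < ?\<rho>" "?\<rho> < 1" using pos N by auto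
  have P: "?P > 0" using pos N by (simp add: critical_exponent_def)
  have P_eq: "?P * (1 - ?\<rho>) = p" using pos N by (simp add: critical_exponent_def field_simps)
  define a where "a = ?P * (1 - ?\<rho> ^ Suc k)"
  have a: "a > 0" using P \<rho> by (simp add: a_def power_Suc_less_one del: power_Suc)
  have a_Suc: "?P * (1 - ?\<rho> ^ Suc (Suc k)) = p + p * s / N * a"
  proof -
    have "?P * (1 - ?\<rho> ^ Suc (Suc k)) = ?P * (1 - ?\<rho>) + ?\<rho> * a"
      by (simp add: a_def algebra_simps)
    then show ?thesis unfolding P_eq .
  qed
  define B where "B = (\<Union>x\<in>A. ball x (\<delta> / 2))"
  have "open B" by (auto simp: B_def)
  then have [measurable]: "B \<in> sets lebesgue" by auto
  have [measurable]: "U \<in> sets lebesgue" "A \<in> sets lebesgue" using U Suc.prems by auto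
  have "B \<subseteq> {x + y |x y. x \<in> A \<and> y \<in> ball 0 (\<delta> / 2)}"
  proof
    fix z assume "z \<in> B"
    then obtain x where "x \<in> A" "z \<in> ball x (\<delta>/2)" by (auto simp: B_def)
    then show "z \<in> {x + y |x y. x \<in> A \<and> y \<in> ball 0 (\<delta> / 2)}"
      by (intro CollectI exI[of _ x] exI[of _ "z - x"]) (auto simp: dist_norm norm_minus_commute)
  qed
  then have bdd: "bounded B"
    using bounded_plus[OF Suc.prems(2) bounded_ball[of 0 "\<delta>/2"]] bounded_subset by blast
  have ballU: "ball y (\<delta> / 2) \<subseteq> U" if "y \<in> B" for y
  proof -
    obtain x where x: "x \<in> A" "dist x y < \<delta> / 2" using \<open>y \<in> B\<close> by (auto simp: B_def)
    have "ball y (\<delta> / 2) \<subseteq> ball x \<delta>"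
    proof
      fix z assume "z \<in> ball y (\<delta> / 2)"
      then show "z \<in> ball x \<delta>" using x dist_triangle[of x z y] by simp
    qed
    then show ?thesis using Suc.prems(4) x(1) by blast
  qed
  have "\<delta> / 2 > 0" using Suc.prems(1) by simp
  from Suc.IH[OF this bdd \<open>B \<in> sets lebesgue\<close> ballU Suc.prems(5), folded a_def]
  obtain C where C: "C \<ge> 0"
    "\<And>u. u \<in> borel_measurable lebesgue \<Longrightarrow> gagliardo s p U u \<le> ennreal K \<Longrightarrow>
     Lpow p U u \<le> ennreal K \<Longrightarrow>
     Lpow a B u \<le> ennreal C"
    by blast
  obtain D where D: "D \<ge> 0" "\<And>(u::'a \<Rightarrow> real) B U x. u \<in> borel_measurable lebesgue \<Longrightarrow> B \<in> sets lebesgue \<Longrightarrow>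
     U \<in> sets lebesgue \<Longrightarrow> ball x (\<delta>/2) \<subseteq> B \<Longrightarrow> ball x (\<delta>/2) \<subseteq> U \<Longrightarrow>
     Lpow a B u \<le> ennreal (C + 1) \<Longrightarrow>
     ennreal (\<bar>u x\<bar> powr (p + p * s / N * a)) \<le> ennreal D * (frac_density s p U u x + 1)"
  proof -
    have "C + 1 > 0" using C(1) by simp
    from embedding_step_pointwise[OF pos(1,2) a \<open>\<delta> / 2 > 0\<close> this, where 'a='a, folded N_def]
    show ?thesis using that by blast
  qed
  define m where "m = enn2real (emeasure lebesgue A)"
  have m: "emeasure lebesgue A = ennreal m" "m \<ge> 0"
    using emeasure_bounded_less_top[OF Suc.prems(2)] by (simp_all add: m_def)
  show ?case unfolding a_Suc
  proof (intro exI[of _ "D * (K + m)"] conjI allI impI)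
    show "D * (K + m) \<ge> 0" using D m Suc.prems by simp
    fix u :: "'a \<Rightarrow> real"
    assume [measurable]: "u \<in> borel_measurable lebesgue" and gag: "gagliardo s p U u \<le> ennreal K"
      and Lp: "Lpow p U u \<le> ennreal K"
    have "A \<subseteq> U" using Suc.prems by force
    have le: "ennreal (\<bar>u x\<bar> powr (p + p * s / N * a)) \<le> ennreal D * (frac_density s p U u x + 1)"
      if "x \<in> A" for x
    proof (rule D(2)[of u B U x])
      show "ball x (\<delta>/2) \<subseteq> B" using that by (auto simp: B_def)
      show "ball x (\<delta>/2) \<subseteq> U" using that Suc.prems(1) Suc.prems(4)[OF that] by (auto simp: subset_eq)
      have "Lpow a B u \<le> ennreal C" using C(2) gag Lp by simp
      also have "\<dots> \<le> ennreal (C + 1)" by (intro ennreal_leI) simp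
      finally show "Lpow a B u \<le> ennreal (C + 1)" .
    qed measurable
    have "Lpow (p + p * s / N * a) A u \<le>
        (\<integral>\<^sup>+y. ennreal D * (frac_density s p U u y * indicator U y + indicator A y) \<partial>lebesgue)"
    proof (rule nn_integral_mono)
      fix y
      show "ennreal (\<bar>u y\<bar> powr (p + p * s / N * a)) * indicator A y \<le>
          ennreal D * (frac_density s p U u y * indicator U y + indicator A y)"
        using le[of y] \<open>A \<subseteq> U\<close> by (cases "y \<in> A") auto
    qed
    also have "\<dots> = ennreal D * ((\<integral>\<^sup>+y\<in>U. frac_density s p U u y \<partial>lebesgue) + emeasure lebesgue A)"
      by (simp add: nn_integral_cmult nn_integral_add)
    also have "\<dots> = ennreal D * (gagliardo s p U u + ennreal m)"
      by (simp add: gagliardo_eq_density m)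
    also have "\<dots> \<le> ennreal D * (ennreal K + ennreal m)"
      using gag by (intro mult_left_mono add_right_mono) auto
    also have "\<dots> = ennreal (D * (K + m))"
      using m D Suc.prems by (simp add: ennreal_mult ennreal_plus)
    finally show "Lpow (p + p * s / N * a) A u \<le> ennreal (D * (K + m))" .
  qed
qed

text \<open>The exponents of the iteration increase to the critical one, so that finitely many steps
  reach every subcritical \<open>q\<close>. The estimate is local, because sub- and supersolutions are regular only
  near the closure of the domain.\<close>

lemma fractional_Sobolev_subcritical:
  fixes U :: "'a::euclidean_space set" and s p q :: real
  assumes pos: "s > 0" "p > 0" "p * s < real DIM('a)" and q: "0 \<le> q" "q < critical_exponent (real DIM('a)) s p"
    and U: "open U" and A: "bounded A" "A \<in> sets lebesgue" "\<delta> > 0" "\<And>x. x \<in> A \<Longrightarrow> ball x \<delta> \<subseteq> U"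
    and K: "K > 0"
  obtains C where "C \<ge> 0"
    "\<And>u. u \<in> borel_measurable lebesgue \<Longrightarrow> gagliardo s p U u \<le> ennreal K \<Longrightarrow>
     Lpow p U u \<le> ennreal K \<Longrightarrow>
     Lpow q A u \<le> ennreal C"
proof -
  let ?N = "real DIM('a)"
  let ?P = "critical_exponent ?N s p"
  have "?P > 0" using q by simp
  have "(\<lambda>k. ?P * (1 - (p * s / ?N) ^ Suc k)) \<longlonglongrightarrow> ?P * (1 - 0)"
    using pos by (intro tendsto_intros LIMSEQ_Suc LIMSEQ_power_zero) auto
  then have "eventually (\<lambda>k. ?P * (1 - (p * s / ?N) ^ Suc k) > q) sequentially"
    using q by (intro order_tendstoD(1)) auto
  then obtain k where k: "q < ?P * (1 - (p * s / ?N) ^ Suc k)" (is "_ < ?a")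
    unfolding eventually_sequentially by blast
  obtain C where C: "C \<ge> 0"
    "\<And>u. u \<in> borel_measurable lebesgue \<Longrightarrow> gagliardo s p U u \<le> ennreal K \<Longrightarrow>
     Lpow p U u \<le> ennreal K \<Longrightarrow>
     Lpow ?a A u \<le> ennreal C"
    using embedding_iterate[OF pos U A(3,1,2,4) K, of k] by auto
  define m where "m = enn2real (emeasure lebesgue A)"
  have m: "emeasure lebesgue A = ennreal m" "m \<ge> 0"
    using emeasure_bounded_less_top[OF A(1)] by (simp_all add: m_def)
  show thesis
  proof (rule that[of "m + C"])
    show "m + C \<ge> 0" using m C by simp
    fix u :: "'a \<Rightarrow> real"
    assume u[measurable]: "u \<in> borel_measurable lebesgue" and gag: "gagliardo s p U u \<le> ennreal K"
      and Lp: "Lpow p U u \<le> ennreal K"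
    have [measurable]: "A \<in> sets lebesgue" by fact
    have "Lpow q A u \<le>
       (\<integral>\<^sup>+y. indicator A y + ennreal (\<bar>u y\<bar> powr ?a) * indicator A y \<partial>lebesgue)"
    proof (rule nn_integral_mono)
      fix y
      have "ennreal (\<bar>u y\<bar> powr q) \<le> ennreal (1 + \<bar>u y\<bar> powr ?a)"
        using k q by (intro ennreal_leI powr_le_one_plus) auto
      also have "\<dots> = 1 + ennreal (\<bar>u y\<bar> powr ?a)" by (simp add: ennreal_plus)
      finally show "ennreal (\<bar>u y\<bar> powr q) * indicator A y \<le>
          indicator A y + ennreal (\<bar>u y\<bar> powr ?a) * indicator A y"
        by (cases "y \<in> A") auto
    qed
    also have "\<dots> = ennreal m + Lpow ?a A u"
      by (simp add: nn_integral_add m)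
    also have "\<dots> \<le> ennreal m + ennreal C" using C(2)[OF u gag Lp] by (intro add_left_mono)
    also have "\<dots> = ennreal (m + C)" using m C by (simp add: ennreal_plus)
    finally show "Lpow q A u \<le> ennreal (m + C)" .
  qed
qed

lemma gagliardo_UNIV:
  assumes u: "u \<in> borel_measurable lebesgue"
  shows "gagliardo s p UNIV u = (\<integral>\<^sup>+x. frac_density s p UNIV u x \<partial>lebesgue)"
proof -
  have "gagliardo s p UNIV u = (\<integral>\<^sup>+x\<in>UNIV. frac_density s p UNIV u x \<partial>lebesgue)"
    by (rule gagliardo_eq_density[OF u]) auto
  then show ?thesis by simp
qed

lemma bounded_unit_ball_outside:
  fixes \<Omega> :: "'a::euclidean_space set"
  assumes "bounded \<Omega>"
  obtains z where "ball z 1 \<inter> \<Omega> = {}"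
proof -
  obtain R where R: "R > 0" "\<Omega> \<subseteq> ball 0 R" using bounded_subset_ballD[OF assms(1), of 0] by auto
  obtain e :: 'a where e: "norm e = 1" using vector_choose_size[of 1] by auto
  have nz: "norm ((R + 1) *\<^sub>R e) = R + 1" using R e by simp
  have "y \<notin> \<Omega>" if "y \<in> ball ((R + 1) *\<^sub>R e) 1" for y
  proof
    assume "y \<in> \<Omega>"
    then have "norm y < R" using R(2) by auto
    then show False
      using nz that norm_triangle_ineq[of "(R + 1) *\<^sub>R e - y" y] by (auto simp: dist_norm)
  qed
  then show thesis using that by blast
qed

text \<open>A function that vanishes off a bounded set is compared with its value \<open>0\<close> on a ball
  outside that set, at bounded distance.\<close>

lemma fractional_Poincare:
  fixes \<Omega> :: "'a::euclidean_space set"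
  assumes "bounded \<Omega>" "s \<ge> 0" "p > 0"
  obtains C where "C \<ge> 0" "\<And>u. u \<in> borel_measurable lebesgue \<Longrightarrow>
    (AE x in lebesgue. x \<notin> \<Omega> \<longrightarrow> u x = 0) \<Longrightarrow>
    (\<integral>\<^sup>+x. ennreal (\<bar>u x\<bar> powr p) \<partial>lebesgue) \<le> ennreal C * gagliardo s p UNIV u"
proof -
  obtain z where z: "ball z 1 \<inter> \<Omega> = {}" using bounded_unit_ball_outside[OF assms(1)] by blast
  have "bounded (\<Omega> \<union> ball z 1)" using assms(1) by simp
  then obtain \<rho> where \<rho>: "\<And>x y. x \<in> \<Omega> \<union> ball z 1 \<Longrightarrow> y \<in> \<Omega> \<union> ball z 1 \<Longrightarrow> dist x y \<le> \<rho>"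
    unfolding bounded_two_points by blast
  define \<omega> where "\<omega> = measure lebesgue (ball (0::'a) 1)"
  have \<omega>: "\<omega> > 0" using measure_unit_ball_pos by (auto simp: \<omega>_def)
  have mball: "emeasure lebesgue (ball z 1) = ennreal \<omega>"
    unfolding \<omega>_def by (subst emeasure_ball_powr) auto
  define c where "c = \<rho> powr (real DIM('a) + p * s)"
  have c: "c \<ge> 0" by (simp add: c_def)
  show thesis
  proof (rule that[of "c / \<omega>"])
    fix u :: "'a \<Rightarrow> real"
    assume um [measurable]: "u \<in> borel_measurable lebesgue" and u0: "AE x in lebesgue. x \<notin> \<Omega> \<longrightarrow> u x = 0"
    have pt: "ennreal \<omega> * ennreal (\<bar>u x\<bar> powr p) \<le> ennreal c * frac_density s p UNIV u x"
      if "x \<in> \<Omega>" for x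
    proof -
      have "ennreal \<omega> * ennreal (\<bar>u x\<bar> powr p) =
          (\<integral>\<^sup>+y. ennreal (\<bar>u x\<bar> powr p) * indicator (ball z 1) y \<partial>lebesgue)"
        by (subst nn_integral_cmult_indicator) (auto simp: mball[simplified] mult.commute)
      also have "\<dots> \<le> (\<integral>\<^sup>+y. ennreal c * ennreal (frac_kernel s p x y * \<bar>u x - u y\<bar> powr p) \<partial>lebesgue)"
      proof (rule nn_integral_mono_AE)
        show "AE y in lebesgue. ennreal (\<bar>u x\<bar> powr p) * indicator (ball z 1) y \<le>
            ennreal c * ennreal (frac_kernel s p x y * \<bar>u x - u y\<bar> powr p)"
          using u0
        proof eventually_elim
          case (elim y)
          show ?case
          proof (cases "y \<in> ball z 1")
            case True
            then have uy: "u y = 0" using elim z by blast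
            have "norm (x - y) \<le> \<rho>" using \<rho>[of x y] True that by (simp add: dist_norm)
            then have "\<bar>u x - u y\<bar> powr p \<le> c * (frac_kernel s p x y * \<bar>u x - u y\<bar> powr p)"
              unfolding c_def using assms by (intro powr_le_kernel) auto
            then have "ennreal (\<bar>u x\<bar> powr p) \<le> ennreal (c * (frac_kernel s p x y * \<bar>u x - u y\<bar> powr p))"
              by (intro ennreal_leI) (simp add: uy)
            then show ?thesis using True c by (simp add: ennreal_mult)
          qed simp
        qed
      qed
      also have "\<dots> = ennreal c * frac_density s p UNIV u x"
        unfolding frac_density_def by (simp add: nn_integral_cmult)
      finally show ?thesis .
    qed
    have "ennreal \<omega> * (\<integral>\<^sup>+x. ennreal (\<bar>u x\<bar> powr p) \<partial>lebesgue) =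
        (\<integral>\<^sup>+x. ennreal \<omega> * ennreal (\<bar>u x\<bar> powr p) \<partial>lebesgue)" by (simp add: nn_integral_cmult)
    also have "\<dots> \<le> (\<integral>\<^sup>+x. ennreal c * frac_density s p UNIV u x \<partial>lebesgue)"
    proof (rule nn_integral_mono_AE)
      show "AE x in lebesgue. ennreal \<omega> * ennreal (\<bar>u x\<bar> powr p) \<le> ennreal c * frac_density s p UNIV u x"
        using u0
      proof eventually_elim
        case (elim x)
        then show ?case using pt[of x] assms by (cases "x \<in> \<Omega>") auto
      qed
    qed
    also have "\<dots> = ennreal c * gagliardo s p UNIV u"
      unfolding gagliardo_UNIV[OF um] by (intro nn_integral_cmult frac_density_measurable um) auto
    finally have le: "ennreal \<omega> * (\<integral>\<^sup>+x. ennreal (\<bar>u x\<bar> powr p) \<partial>lebesgue) \<le> ennreal c * gagliardo s p UNIV u" .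
    have "(\<integral>\<^sup>+x. ennreal (\<bar>u x\<bar> powr p) \<partial>lebesgue) =
        ennreal (1 / \<omega>) * (ennreal \<omega> * (\<integral>\<^sup>+x. ennreal (\<bar>u x\<bar> powr p) \<partial>lebesgue))"
      using \<omega> by (simp add: mult.assoc[symmetric] ennreal_mult[symmetric])
    also have "\<dots> \<le> ennreal (1 / \<omega>) * (ennreal c * gagliardo s p UNIV u)"
      using le by (intro mult_left_mono) auto
    also have "\<dots> = ennreal (c / \<omega>) * gagliardo s p UNIV u"
      using \<omega> c by (simp add: mult.assoc[symmetric] ennreal_mult[symmetric])
    finally show "(\<integral>\<^sup>+x. ennreal (\<bar>u x\<bar> powr p) \<partial>lebesgue) \<le> ennreal (c / \<omega>) * gagliardo s p UNIV u" .
  qed (use c \<omega> in simp)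
qed

text \<open>Dyadic shells: the ball of radius \<open>2\<^sup>k\<close> has volume of order \<open>2\<^bsup>kN\<^esup>\<close>, the weight on its outer
  shell is of order \<open>2\<^bsup>-kb\<^esup>\<close>, and \<open>b > N\<close>.\<close>

lemma tail_weight_finite:
  fixes b :: real
  assumes "b > real DIM('a::euclidean_space)"
  shows "(\<integral>\<^sup>+y. ennreal ((1 + norm (y::'a)) powr (- b)) \<partial>lebesgue) < \<infinity>"
proof -
  let ?N = "real DIM('a)"
  define \<omega> where "\<omega> = measure lebesgue (ball (0::'a) 1)"
  have \<omega>: "\<omega> > 0" using measure_unit_ball_pos by (auto simp: \<omega>_def)
  have b: "b > 0" using assms of_nat_0_le_iff[of "DIM('a)", where 'a=real] by linarith
  let ?g = "\<lambda>k (y::'a). ennreal (2 powr b * (2 powr (- b)) ^ k) * indicator (ball 0 (2 ^ k)) y"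
  have pt: "ennreal ((1 + norm y) powr (- b)) \<le> (\<Sum>k. ?g k y)" for y :: 'a
  proof -
    obtain k0 where "norm y < 2 ^ k0" using real_arch_pow[of 2 "norm y"] by auto
    define k where "k = (LEAST k. norm y < 2 ^ k)"
    have k: "norm y < 2 ^ k" unfolding k_def by (rule LeastI) fact
    have "(1 + norm y) powr (- b) \<le> 2 powr b * (2 powr (- b)) ^ k"
    proof (cases k)
      case 0
      have "(1 + norm y) powr (- b) \<le> 1"
        using b powr_mono2'[of "-b" 1 "1 + norm y"] by simp
      also have "1 \<le> 2 powr b" using b by (simp add: ge_one_powr_ge_zero)
      finally show ?thesis using 0 by simp
    next
      case (Suc j)
      then have "\<not> norm y < 2 ^ j" unfolding k_def using not_less_Least[of j "\<lambda>k. norm y < 2 ^ k"] by simp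
      then have "(1 + norm y) powr (- b) \<le> (2 ^ j) powr (- b)"
        using b by (intro powr_mono2') auto
      also have "\<dots> = (2 powr (- b)) ^ j"
        by (simp add: powr_realpow[symmetric] powr_powr powr_power mult.commute)
      also have "\<dots> = 2 powr b * (2 powr (- b)) ^ k"
        using Suc by (simp add: powr_minus)
      finally show ?thesis .
    qed
    then have "ennreal ((1 + norm y) powr (- b)) \<le> ?g k y"
      using k by (simp add: ennreal_leI)
    also have "\<dots> \<le> (\<Sum>k. ?g k y)"
    proof -
      have "(\<Sum>j\<in>{k}. ?g j y) \<le> (\<Sum>j. ?g j y)" by (intro sum_le_suminf) auto
      then show ?thesis by (simp only: sum.insert sum.empty finite.emptyI empty_iff not_False_eq_True add_0_right)
    qed
    finally show ?thesis .
  qed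
  have "(\<integral>\<^sup>+y. ennreal ((1 + norm (y::'a)) powr (- b)) \<partial>lebesgue) \<le> (\<integral>\<^sup>+y. (\<Sum>k. ?g k y) \<partial>lebesgue)"
    using pt by (intro nn_integral_mono)
  also have "\<dots> = (\<Sum>k. \<integral>\<^sup>+y. ?g k y \<partial>lebesgue)"
    by (intro nn_integral_suminf borel_measurable_times_ennreal borel_measurable_const
        borel_measurable_indicator) simp
  also have "\<dots> = (\<Sum>k. ennreal (2 powr b * \<omega> * (2 powr (?N - b)) ^ k))"
  proof (intro arg_cong[where f=suminf] ext)
    fix k
    have "(\<integral>\<^sup>+y. ?g k y \<partial>lebesgue) = ennreal (2 powr b * (2 powr (- b)) ^ k) * ennreal (\<omega> * (2 ^ k) powr ?N)"
    proof -
      have "emeasure lebesgue (ball (0::'a) (2 ^ k)) = ennreal (\<omega> * (2 ^ k) powr ?N)"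
        unfolding \<omega>_def by (intro emeasure_ball_powr) simp
      then show ?thesis by (subst nn_integral_cmult_indicator) auto
    qed
    also have "\<dots> = ennreal (2 powr b * \<omega> * ((2 powr (- b)) ^ k * (2 ^ k) powr ?N))"
      using \<omega> by (simp add: ennreal_mult[symmetric] mult_ac)
    also have "(2 powr (- b)) ^ k * (2 ^ k) powr ?N = (2 powr (?N - b)) ^ k"
      by (simp add: powr_power powr_realpow[symmetric] powr_powr powr_add[symmetric] algebra_simps)
    finally show "(\<integral>\<^sup>+y. ?g k y \<partial>lebesgue) = ennreal (2 powr b * \<omega> * (2 powr (?N - b)) ^ k)" .
  qed
  also have "\<dots> < \<infinity>"
  proof -
    have "2 powr (?N - b) < 2 powr (0::real)" using assms by (intro powr_less_mono) auto
    then have "summable (\<lambda>k. 2 powr b * \<omega> * (2 powr (?N - b)) ^ k)"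
      by (intro summable_mult summable_geometric) simp
    then show ?thesis using \<omega> by (simp add: suminf_ennreal2 less_top[symmetric])
  qed
  finally show ?thesis .
qed

section \<open>The spaces and the operator\<close>

abbreviation increment :: "('a \<Rightarrow> real) \<Rightarrow> 'a \<times> 'a \<Rightarrow> real" where
  "increment u z \<equiv> u (fst z) - u (snd z)"

definition energy :: "real \<Rightarrow> real \<Rightarrow> ('a::euclidean_space \<Rightarrow> real) \<Rightarrow> real" where
  "energy s p u = (LINT z|frac_measure s p. \<bar>increment u z\<bar> powr p)"

lemma frac_p_laplacian_eq:
  "frac_p_laplacian s p u v = (LINT z|frac_measure s p. pflux p (increment u z) * increment v z)"
  by (simp add: frac_p_laplacian_def pflux_def)

lemma increment_measurable [measurable]:
  assumes [measurable]: "u \<in> borel_measurable (lebesgue :: 'a::euclidean_space measure)"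
  shows "increment u \<in> borel_measurable (lebesgue \<Otimes>\<^sub>M lebesgue)"
  by measurable

lemma integrable_powr_iff:
  assumes "f \<in> borel_measurable M"
  shows "integrable M (\<lambda>x. \<bar>f x\<bar> powr p :: real) \<longleftrightarrow> (\<integral>\<^sup>+x. ennreal (\<bar>f x\<bar> powr p) \<partial>M) < \<infinity>"
proof -
  have "(\<lambda>x. \<bar>f x\<bar> powr p) \<in> borel_measurable M" using assms by measurable
  then show ?thesis by (simp add: integrable_iff_bounded)
qed

lemma gagliardo_UNIV_eq:
  "gagliardo s p UNIV u = (\<integral>\<^sup>+z. ennreal (\<bar>increment u z\<bar> powr p) \<partial>frac_measure s p)"
  by (simp add: gagliardo_def)

lemma gagliardo_less_top_iff:
  assumes [measurable]: "u \<in> borel_measurable lebesgue"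
  shows "gagliardo s p UNIV u < \<infinity> \<longleftrightarrow> integrable (frac_measure s p) (\<lambda>z. \<bar>increment u z\<bar> powr p)"
proof -
  have "increment u \<in> borel_measurable (frac_measure s p)" by measurable
  then show ?thesis unfolding gagliardo_UNIV_eq by (subst integrable_powr_iff) auto
qed

lemma gagliardo_eq_energy:
  assumes "integrable (frac_measure s p) (\<lambda>z. \<bar>increment u z\<bar> powr p)"
  shows "gagliardo s p UNIV u = ennreal (energy s p u)"
  unfolding gagliardo_UNIV_eq energy_def by (rule nn_integral_eq_integral[OF assms]) simp

lemma energy_nonneg [simp]: "energy s p u \<ge> 0"
  unfolding energy_def by (intro Bochner_Integration.integral_nonneg) simp

lemma powr_mult_le_sum:
  fixes a b p :: real
  assumes "a \<ge> 0" "b \<ge> 0" "p \<ge> 1"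
  shows "a powr (p - 1) * b \<le> a powr p + b powr p"
proof -
  have *: "t powr (p - 1) * t = t powr p" if "t \<ge> 0" for t :: real
    using that by (cases "t = 0") (simp_all add: powr_diff)
  show ?thesis
  proof (cases "a \<le> b")
    case True
    then have "a powr (p - 1) * b \<le> b powr (p - 1) * b"
      using assms by (intro mult_right_mono powr_mono2) auto
    then show ?thesis using *[OF assms(2)] powr_ge_zero[of a p] by linarith
  next
    case False
    then have "a powr (p - 1) * b \<le> a powr (p - 1) * a"
      using assms by (intro mult_left_mono) auto
    then show ?thesis using *[OF assms(1)] powr_ge_zero[of b p] by linarith
  qed
qed

text \<open>The weight against which functions of the space \<open>frac_sobolev_tilde\<close> have integrable
  powers \<open>p - 1\<close>.\<close>

definition tail_weight :: "real \<Rightarrow> real \<Rightarrow> 'a::euclidean_space \<Rightarrow> real" where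
  "tail_weight s p y = (1 + norm y) powr (- (real DIM('a) + p * s))"

lemma tail_weight_measurable [measurable]: "tail_weight s p \<in> borel_measurable lebesgue"
  unfolding tail_weight_def by measurable

lemma tail_weight_nonneg [simp]: "tail_weight s p y \<ge> 0"
  by (simp add: tail_weight_def)

lemma tail_weight_le_1:
  assumes "s \<ge> 0" "p \<ge> 0" shows "tail_weight s p (y::'a::euclidean_space) \<le> 1"
proof -
  have "real DIM('a) + p * s \<ge> 0" using assms by simp
  then show ?thesis
    unfolding tail_weight_def using powr_mono2'[of "- (real DIM('a) + p * s)" 1 "1 + norm y"] by simp
qed

lemma divide_eq_tail_weight:
  "a / (1 + norm (y::'a::euclidean_space)) powr (real DIM('a) + p * s) = a * tail_weight s p y"
  unfolding tail_weight_def powr_minus divide_inverse ..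

text \<open>On pairs of points at a positive distance, one of them in a bounded set, the kernel is
  dominated by a weight in the other point alone, and the integral factorises.\<close>

lemma nn_integral_separated_le:
  fixes \<Omega> V :: "'a::euclidean_space set"
  assumes "bounded \<Omega>" and d: "d > 0" "\<And>x y. x \<in> \<Omega> \<Longrightarrow> y \<in> V \<Longrightarrow> d \<le> dist x y"
    and "p \<ge> 0" "s \<ge> 0"
    and [measurable]: "\<Omega> \<in> sets lebesgue" "V \<in> sets lebesgue"
  obtains C where "C \<ge> 0"
    "\<And>g h. g \<in> borel_measurable lebesgue \<Longrightarrow> h \<in> borel_measurable lebesgue \<Longrightarrow>
     (\<integral>\<^sup>+z. (g (fst z) * indicator \<Omega> (fst z)) * (h (snd z) * indicator V (snd z)) \<partial>frac_measure s p) \<le>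
      ennreal C * (\<integral>\<^sup>+x\<in>\<Omega>. g x \<partial>lebesgue) *
      (\<integral>\<^sup>+y. h y * ennreal (tail_weight s p y) \<partial>lebesgue)"
proof -
  let ?b = "real DIM('a) + p * s"
  obtain R where R: "R > 0" "\<And>x. x \<in> \<Omega> \<Longrightarrow> norm x \<le> R"
    using assms(1) bounded_pos by metis
  define c where "c = (1 + R) / d + 1"
  have c: "c > 0" using R d by (simp add: c_def add_pos_pos)
  have ker: "frac_kernel s p x y \<le> c powr ?b * tail_weight s p y"
    if "x \<in> \<Omega>" "y \<in> V" for x y
  proof -
    have dd: "d \<le> norm (x - y)" using d(2)[OF that] by (simp add: dist_norm)
    have "1 + norm y \<le> (1 + R) + norm (x - y)"
      using R(2)[OF that(1)] norm_triangle_ineq4[of x "x - y"] by simp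
    also have "\<dots> \<le> (1 + R) * (norm (x - y) / d) + norm (x - y)"
    proof -
      have "(1 + R) * 1 \<le> (1 + R) * (norm (x - y) / d)"
        using dd d R by (intro mult_left_mono) (auto simp: field_simps)
      then show ?thesis by simp
    qed
    also have "\<dots> = c * norm (x - y)" by (simp add: c_def field_simps)
    finally have "(1 + norm y) / c \<le> norm (x - y)" using c by (simp add: field_simps)
    then have "norm (x - y) powr (- ?b) \<le> ((1 + norm y) / c) powr (- ?b)"
      using c mult_nonneg_nonneg[OF assms(4,5)] by (intro powr_mono2') (auto simp: add_pos_nonneg)
    also have "\<dots> = c powr ?b * tail_weight s p y"
    proof -
      have "(t / c) powr (- b) = c powr b * t powr (- b)" if "t > 0" for t b
        using c that by (simp add: powr_divide powr_minus field_simps)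
      then show ?thesis unfolding tail_weight_def by (simp only: add_pos_nonneg zero_less_one norm_ge_zero)
    qed
    finally show ?thesis by (simp add: frac_kernel_def)
  qed
  show thesis
  proof (rule that[of "c powr ?b"])
    fix g h :: "'a \<Rightarrow> ennreal"
    assume [measurable]: "g \<in> borel_measurable lebesgue" "h \<in> borel_measurable lebesgue"
    let ?W = "\<lambda>y::'a. ennreal (tail_weight s p y)"
    have "(\<integral>\<^sup>+z. (g (fst z) * indicator \<Omega> (fst z)) * (h (snd z) * indicator V (snd z)) \<partial>frac_measure s p) =
      (\<integral>\<^sup>+x. \<integral>\<^sup>+y. ennreal (frac_kernel s p x y) * ((g x * indicator \<Omega> x) * (h y * indicator V y)) \<partial>lebesgue \<partial>lebesgue)"
      by (subst nn_integral_frac_measure) simp_all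
    also have "\<dots> \<le> (\<integral>\<^sup>+x. \<integral>\<^sup>+y. (ennreal (c powr ?b) * (g x * indicator \<Omega> x)) * (h y * ?W y) \<partial>lebesgue \<partial>lebesgue)"
    proof (intro nn_integral_mono)
      fix x y :: 'a
      show "ennreal (frac_kernel s p x y) * ((g x * indicator \<Omega> x) * (h y * indicator V y)) \<le>
        (ennreal (c powr ?b) * (g x * indicator \<Omega> x)) * (h y * ?W y)"
      proof (cases "x \<in> \<Omega> \<and> y \<in> V")
        case True
        then have "ennreal (frac_kernel s p x y) \<le> ennreal (c powr ?b * tail_weight s p y)"
          using ker by (intro ennreal_leI) auto
        also have "\<dots> = ennreal (c powr ?b) * ?W y" by (simp add: ennreal_mult)
        finally have "ennreal (frac_kernel s p x y) * (g x * h y) \<le> ennreal (c powr ?b) * ?W y * (g x * h y)"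
          by (intro mult_right_mono) auto
        then show ?thesis using True by (simp add: mult_ac)
      qed auto
    qed
    also have "\<dots> = (\<integral>\<^sup>+x. (ennreal (c powr ?b) * (g x * indicator \<Omega> x)) * (\<integral>\<^sup>+y. h y * ?W y \<partial>lebesgue) \<partial>lebesgue)"
      by (intro nn_integral_cong nn_integral_cmult) measurable
    also have "\<dots> = (\<integral>\<^sup>+x. ennreal (c powr ?b) * (g x * indicator \<Omega> x) \<partial>lebesgue) * (\<integral>\<^sup>+y. h y * ?W y \<partial>lebesgue)"
      by (intro nn_integral_multc) measurable
    also have "(\<integral>\<^sup>+x. ennreal (c powr ?b) * (g x * indicator \<Omega> x) \<partial>lebesgue) =
        ennreal (c powr ?b) * (\<integral>\<^sup>+x\<in>\<Omega>. g x \<partial>lebesgue)"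
      by (intro nn_integral_cmult) measurable
    finally show "(\<integral>\<^sup>+z. (g (fst z) * indicator \<Omega> (fst z)) * (h (snd z) * indicator V (snd z)) \<partial>frac_measure s p) \<le>
      ennreal (c powr ?b) * (\<integral>\<^sup>+x\<in>\<Omega>. g x \<partial>lebesgue) * (\<integral>\<^sup>+y. h y * ?W y \<partial>lebesgue)" .
  qed simp
qed

locale frac_dirichlet =
  fixes s p :: real and \<Omega> :: "'a::euclidean_space set"
  assumes s_pos: "0 < s" and p_ge_2: "2 \<le> p"
    and open_dom: "open \<Omega>" and bounded_dom: "bounded \<Omega>"
begin

abbreviation "W0 \<equiv> frac_sobolev0 s p \<Omega>"
abbreviation "Wt \<equiv> frac_sobolev_tilde s p \<Omega>"
abbreviation "\<mu> \<equiv> (frac_measure s p :: ('a \<times> 'a) measure)"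

lemma dom_sets [measurable]: "\<Omega> \<in> sets lebesgue"
  using open_dom by auto

lemma p_pos: "p > 0" "p > 1" "p \<ge> 0" "p - 1 > 0" "p - 1 \<ge> 0" "p \<noteq> 0"
  using p_ge_2 by auto

lemma W0_iff:
  "u \<in> W0 \<longleftrightarrow> u \<in> borel_measurable lebesgue \<and> integrable lebesgue (\<lambda>x. \<bar>u x\<bar> powr p) \<and>
     integrable \<mu> (\<lambda>z. \<bar>increment u z\<bar> powr p) \<and> (AE x in lebesgue. x \<notin> \<Omega> \<longrightarrow> u x = 0)"
proof (cases "u \<in> borel_measurable lebesgue")
  case True
  then show ?thesis
    by (auto simp: frac_sobolev0_def frac_sobolev_def Lp_on_def lebesgue_on_UNIV_eq
        integrable_powr_iff[OF True] gagliardo_less_top_iff[OF True, symmetric])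
qed (auto simp: frac_sobolev0_def frac_sobolev_def Lp_on_def lebesgue_on_UNIV_eq)

lemma W0_measurable [measurable_dest]: "u \<in> W0 \<Longrightarrow> u \<in> borel_measurable lebesgue"
  by (simp add: W0_iff)

lemma W0_integrable:
  assumes "u \<in> W0"
  shows "integrable lebesgue (\<lambda>x. \<bar>u x\<bar> powr p)" "integrable \<mu> (\<lambda>z. \<bar>increment u z\<bar> powr p)"
  using assms by (auto simp: W0_iff)

lemma W0_zero: "u \<in> W0 \<Longrightarrow> AE x in lebesgue. x \<notin> \<Omega> \<longrightarrow> u x = 0"
  by (simp add: W0_iff)

lemma increment_\<mu>_measurable [measurable]:
  assumes "u \<in> borel_measurable lebesgue" shows "increment u \<in> borel_measurable \<mu>"
  using increment_measurable[OF assms] by (simp cong: measurable_cong_sets)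

text \<open>By the Poincare inequality membership in \<open>L\<^sup>p\<close> is automatic.\<close>

lemma W0I:
  assumes u: "u \<in> borel_measurable lebesgue" and zero: "AE x in lebesgue. x \<notin> \<Omega> \<longrightarrow> u x = 0"
    and int: "integrable \<mu> (\<lambda>z. \<bar>increment u z\<bar> powr p)"
  shows "u \<in> W0"
proof -
  obtain C where C: "C \<ge> 0"
    "(\<integral>\<^sup>+x. ennreal (\<bar>u x\<bar> powr p) \<partial>lebesgue) \<le> ennreal C * gagliardo s p UNIV u"
  proof -
    obtain C where "C \<ge> 0" and "\<And>u. u \<in> borel_measurable lebesgue \<Longrightarrow>
        (AE x in lebesgue. x \<notin> \<Omega> \<longrightarrow> u x = 0) \<Longrightarrow>
        (\<integral>\<^sup>+x. ennreal (\<bar>u x\<bar> powr p) \<partial>lebesgue) \<le> ennreal C * gagliardo s p UNIV u"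
      by (rule fractional_Poincare[OF bounded_dom less_imp_le[OF s_pos] p_pos(1)]) (rule that)
    with u zero that show thesis by blast
  qed
  note C(2)
  also have "ennreal C * gagliardo s p UNIV u < \<infinity>"
    unfolding gagliardo_eq_energy[OF int] by (simp add: ennreal_mult_less_top)
  finally show ?thesis using assms by (simp add: W0_iff integrable_powr_iff[OF u])
qed

lemma W0_lincomb:
  assumes u: "u \<in> W0" and v: "v \<in> W0"
  shows "(\<lambda>x. a * u x + b * v x) \<in> W0"
proof (rule W0I)
  have [measurable]: "u \<in> borel_measurable lebesgue" "v \<in> borel_measurable lebesgue"
    using u v by measurable
  show "(\<lambda>x. a * u x + b * v x) \<in> borel_measurable lebesgue" by measurable
  show "AE x in lebesgue. x \<notin> \<Omega> \<longrightarrow> a * u x + b * v x = 0"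
    using W0_zero[OF u] W0_zero[OF v] by eventually_elim auto
  show "integrable \<mu> (\<lambda>z. \<bar>increment (\<lambda>x. a * u x + b * v x) z\<bar> powr p)"
  proof (rule integrable_abs_bound)
    show "integrable \<mu> (\<lambda>z. 2 powr p * (\<bar>a\<bar> powr p * \<bar>increment u z\<bar> powr p + \<bar>b\<bar> powr p * \<bar>increment v z\<bar> powr p))"
      using W0_integrable(2)[OF u] W0_integrable(2)[OF v] by simp
    have "\<bar>increment (\<lambda>x. a * u x + b * v x) z\<bar> powr p \<le>
        2 powr p * (\<bar>a\<bar> powr p * \<bar>increment u z\<bar> powr p + \<bar>b\<bar> powr p * \<bar>increment v z\<bar> powr p)" for z
    proof -
      have "increment (\<lambda>x. a * u x + b * v x) z = a * increment u z + b * increment v z"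
        by (simp add: algebra_simps)
      then show ?thesis
        using abs_add_powr_le[of p "a * increment u z" "b * increment v z"] p_pos
        by (simp add: abs_mult powr_mult)
    qed
    then show "AE z in \<mu>. \<bar>\<bar>increment (\<lambda>x. a * u x + b * v x) z\<bar> powr p\<bar> \<le>
        2 powr p * (\<bar>a\<bar> powr p * \<bar>increment u z\<bar> powr p + \<bar>b\<bar> powr p * \<bar>increment v z\<bar> powr p)"
      by simp
  qed measurable
qed

lemma W0_minus: "u \<in> W0 \<Longrightarrow> (\<lambda>x. - u x) \<in> W0"
  using W0_lincomb[of u u "-1" 0] by simp

lemma WtE:
  assumes "u \<in> Wt"
  obtains U where "u \<in> borel_measurable lebesgue" "open U" "closure \<Omega> \<subseteq> U"
    "gagliardo s p U u < \<infinity>" "Lpow p U u < \<infinity>"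
    "(\<integral>\<^sup>+x. ennreal (\<bar>u x\<bar> powr (p - 1)) * ennreal (tail_weight s p x) \<partial>lebesgue) < \<infinity>"
proof -
  have "ennreal (\<bar>u x\<bar> powr (p - 1) / (1 + norm x) powr (real DIM('a) + p * s)) =
      ennreal (\<bar>u x\<bar> powr (p - 1)) * ennreal (tail_weight s p x)" for x
    unfolding divide_eq_tail_weight by (simp add: ennreal_mult)
  then show thesis
    using assms that
    by (auto simp: frac_sobolev_tilde_def frac_sobolev_def Lp_loc_def Lp_on_def)
qed

lemma Wt_measurable [measurable_dest]: "u \<in> Wt \<Longrightarrow> u \<in> borel_measurable lebesgue"
  by (erule WtE)

lemma tail_weight_integral: "(\<integral>\<^sup>+y. ennreal (tail_weight s p (y::'a)) \<partial>lebesgue) < \<infinity>"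
  unfolding tail_weight_def using s_pos p_pos by (intro tail_weight_finite) simp

lemma W0_subset_Wt:
  assumes u: "u \<in> W0" shows "u \<in> Wt"
proof -
  have um[measurable]: "u \<in> borel_measurable lebesgue" using u by measurable
  have Lp: "(\<integral>\<^sup>+x. ennreal (\<bar>u x\<bar> powr p) \<partial>lebesgue) < \<infinity>"
    using W0_integrable(1)[OF u] by (simp add: integrable_powr_iff[OF um])
  have on: "u \<in> Lp_on p K" for K
  proof -
    have "Lpow p K u \<le> (\<integral>\<^sup>+x. ennreal (\<bar>u x\<bar> powr p) \<partial>lebesgue)"
      by (intro nn_integral_mono) (auto simp: indicator_def)
    then show ?thesis using Lp um by (auto simp: Lp_on_def intro: measurable_restrict_space1)
  qed
  have "(\<integral>\<^sup>+x. ennreal (\<bar>u x\<bar> powr (p - 1) / (1 + norm x) powr (real DIM('a) + p * s)) \<partial>lebesgue) \<le>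
      (\<integral>\<^sup>+x. ennreal (tail_weight s p x) + ennreal (\<bar>u x\<bar> powr p) \<partial>lebesgue)"
  proof (intro nn_integral_mono)
    fix x :: 'a
    have w: "tail_weight s p x \<le> 1"
      using s_pos p_pos by (intro tail_weight_le_1) auto
    have "\<bar>u x\<bar> powr (p - 1) / (1 + norm x) powr (real DIM('a) + p * s) = \<bar>u x\<bar> powr (p - 1) * tail_weight s p x"
      by (rule divide_eq_tail_weight)
    also have "\<dots> \<le> (1 + \<bar>u x\<bar> powr p) * tail_weight s p x"
      using p_pos by (intro mult_right_mono powr_le_one_plus) auto
    also have "\<dots> \<le> tail_weight s p x + \<bar>u x\<bar> powr p"
      using mult_left_mono[OF w, of "\<bar>u x\<bar> powr p"] by (simp add: algebra_simps)
    finally show "ennreal (\<bar>u x\<bar> powr (p - 1) / (1 + norm x) powr (real DIM('a) + p * s)) \<le>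
       ennreal (tail_weight s p x) + ennreal (\<bar>u x\<bar> powr p)"
      by (simp add: ennreal_plus[symmetric] ennreal_leI del: ennreal_plus)
  qed
  also have "\<dots> = (\<integral>\<^sup>+x. ennreal (tail_weight s p (x::'a)) \<partial>lebesgue) +
      (\<integral>\<^sup>+x. ennreal (\<bar>u x\<bar> powr p) \<partial>lebesgue)"
    by (intro nn_integral_add) measurable
  also have "\<dots> < \<infinity>" using tail_weight_integral Lp by simp
  finally have "(\<integral>\<^sup>+x. ennreal (\<bar>u x\<bar> powr (p - 1) / (1 + norm x) powr (real DIM('a) + p * s)) \<partial>lebesgue) < \<infinity>" .
  moreover have "gagliardo s p UNIV u < \<infinity>"
    unfolding gagliardo_less_top_iff[OF um] by (rule W0_integrable(2)[OF u])
  ultimately show ?thesis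
    using on um by (auto simp: frac_sobolev_tilde_def frac_sobolev_def Lp_loc_def intro!: exI[of _ UNIV])
qed

lemma gagliardo_minus: "gagliardo s p U (\<lambda>x. - u x) = gagliardo s p U u"
  by (simp add: gagliardo_def abs_minus_commute)

lemma Wt_minus: "u \<in> Wt \<Longrightarrow> (\<lambda>x. - u x) \<in> Wt"
  by (auto simp: frac_sobolev_tilde_def frac_sobolev_def Lp_loc_def Lp_on_def gagliardo_minus)

lemma frac_p_laplacian_minus:
  "frac_p_laplacian s p (\<lambda>x. - u x) v = - frac_p_laplacian s p u v"
proof -
  have "pflux p (increment (\<lambda>x. - u x) z) = - pflux p (increment u z)" for z
    using pflux_minus[of p "increment u z"] by (simp add: algebra_simps)
  then show ?thesis unfolding frac_p_laplacian_eq by simp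
qed

lemma frac_p_laplacian_minus_test:
  "frac_p_laplacian s p u (\<lambda>x. - v x) = - frac_p_laplacian s p u v"
proof -
  have "pflux p (increment u z) * increment (\<lambda>x. - v x) z = - (pflux p (increment u z) * increment v z)" for z
    by (simp add: algebra_simps)
  then show ?thesis unfolding frac_p_laplacian_eq by simp
qed

lemma separation:
  assumes "open U" "closure \<Omega> \<subseteq> U"
  obtains d where "d > 0" "\<And>x y. x \<in> \<Omega> \<Longrightarrow> y \<in> - U \<Longrightarrow> d \<le> dist x y"
proof -
  have "compact (closure \<Omega>)" using bounded_dom by (simp add: compact_closure)
  then obtain d where "d > 0" "\<forall>x\<in>closure \<Omega>. \<forall>y\<in>- U. d \<le> dist x y"
    using separate_compact_closed[of "closure \<Omega>" "- U"] assms by (auto simp: closed_Compl)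
  then show thesis using that closure_subset by blast
qed

text \<open>If \<open>F\<close> vanishes whenever both points lie off \<open>\<Omega>\<close>, then only the pairs in \<open>U \<times> U\<close> and the
  pairs with one point in \<open>\<Omega>\<close> and the other off \<open>U\<close> matter, and the points of the latter are
  separated. The bound \<open>a x + b x * c y\<close> has the shape that results from
  \<open>(\<bar>u x\<bar> + \<bar>u y\<bar>)\<^bsup>p-1\<^esup> \<bar>v x\<bar>\<close>.\<close>

lemma nn_integral_\<mu>_finite_by_splitting:
  fixes F :: "'a \<times> 'a \<Rightarrow> real"
  assumes U: "open U" "closure \<Omega> \<subseteq> U"
    and [measurable]: "F \<in> borel_measurable (lebesgue \<Otimes>\<^sub>M lebesgue)" "a \<in> borel_measurable lebesgue"
      "b \<in> borel_measurable lebesgue" "c \<in> borel_measurable lebesgue"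
    and zero: "AE z in \<mu>. fst z \<notin> \<Omega> \<longrightarrow> snd z \<notin> \<Omega> \<longrightarrow> F z = 0"
    and near: "(\<integral>\<^sup>+z\<in>U \<times> U. ennreal (F z) \<partial>\<mu>) < \<infinity>"
    and far1: "AE z in \<mu>. fst z \<in> \<Omega> \<longrightarrow> snd z \<notin> U \<longrightarrow>
       ennreal (F z) \<le> a (fst z) + b (fst z) * c (snd z)"
    and far2: "AE z in \<mu>. snd z \<in> \<Omega> \<longrightarrow> fst z \<notin> U \<longrightarrow>
       ennreal (F z) \<le> a (snd z) + b (snd z) * c (fst z)"
    and a: "(\<integral>\<^sup>+x\<in>\<Omega>. a x \<partial>lebesgue) < \<infinity>" and b: "(\<integral>\<^sup>+x\<in>\<Omega>. b x \<partial>lebesgue) < \<infinity>"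
    and c: "(\<integral>\<^sup>+y. c y * ennreal (tail_weight s p y) \<partial>lebesgue) < \<infinity>"
  shows "(\<integral>\<^sup>+z. ennreal (F z) \<partial>\<mu>) < \<infinity>"
proof -
  obtain d where d: "d > 0" "\<And>x y. x \<in> \<Omega> \<Longrightarrow> y \<in> - U \<Longrightarrow> d \<le> dist x y"
    using separation[OF U] by blast
  have [measurable]: "U \<in> sets lebesgue" "- U \<in> sets lebesgue" using U(1) by auto
  have [measurable]: "U \<times> U \<in> sets (lebesgue \<Otimes>\<^sub>M lebesgue)" by measurable
  obtain C where C: "C \<ge> 0"
    "\<And>g h. g \<in> borel_measurable lebesgue \<Longrightarrow> h \<in> borel_measurable lebesgue \<Longrightarrow>
     (\<integral>\<^sup>+z. (g (fst z) * indicator \<Omega> (fst z)) * (h (snd z) * indicator (- U) (snd z)) \<partial>\<mu>) \<le>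
      ennreal C * (\<integral>\<^sup>+x\<in>\<Omega>. g x \<partial>lebesgue) *
      (\<integral>\<^sup>+y. h y * ennreal (tail_weight s p y) \<partial>lebesgue)"
  proof (rule nn_integral_separated_le[where \<Omega>=\<Omega> and V="- U" and d=d and p=p and s=s])
    show "bounded \<Omega>" "d > 0" "p \<ge> 0" "s \<ge> 0" "\<Omega> \<in> sets lebesgue" "- U \<in> sets lebesgue"
      using bounded_dom d(1) p_pos s_pos dom_sets \<open>- U \<in> sets lebesgue\<close> by auto
    show "d \<le> dist x y" if "x \<in> \<Omega>" "y \<in> - U" for x y using d(2) that by blast
  qed (rule that)
  define A where "A = (\<lambda>z::'a \<times> 'a. (a (fst z) * indicator \<Omega> (fst z)) * (1 * indicator (- U) (snd z)))"
  define B where "B = (\<lambda>z::'a \<times> 'a. (b (fst z) * indicator \<Omega> (fst z)) * (c (snd z) * indicator (- U) (snd z)))"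
  have [measurable]: "A \<in> borel_measurable (lebesgue \<Otimes>\<^sub>M lebesgue)" "B \<in> borel_measurable (lebesgue \<Otimes>\<^sub>M lebesgue)"
    unfolding A_def B_def by measurable
  have Afin: "(\<integral>\<^sup>+z. A z \<partial>\<mu>) < \<infinity>"
  proof -
    have "(\<integral>\<^sup>+z. A z \<partial>\<mu>) \<le> ennreal C * (\<integral>\<^sup>+x\<in>\<Omega>. a x \<partial>lebesgue) *
        (\<integral>\<^sup>+y. 1 * ennreal (tail_weight s p (y::'a)) \<partial>lebesgue)"
      unfolding A_def by (rule C(2)) measurable
    also have "\<dots> < \<infinity>" using a tail_weight_integral by (simp add: ennreal_mult_less_top)
    finally show ?thesis .
  qed
  have Bfin: "(\<integral>\<^sup>+z. B z \<partial>\<mu>) < \<infinity>"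
  proof -
    have "(\<integral>\<^sup>+z. B z \<partial>\<mu>) \<le> ennreal C * (\<integral>\<^sup>+x\<in>\<Omega>. b x \<partial>lebesgue) *
        (\<integral>\<^sup>+y. c y * ennreal (tail_weight s p (y::'a)) \<partial>lebesgue)"
      unfolding B_def by (rule C(2)) measurable
    also have "\<dots> < \<infinity>" using b c by (simp add: ennreal_mult_less_top)
    finally show ?thesis .
  qed
  let ?sw = "\<lambda>z::'a \<times> 'a. (snd z, fst z)"
  have "(\<integral>\<^sup>+z. ennreal (F z) \<partial>\<mu>) \<le>
     (\<integral>\<^sup>+z. ennreal (F z) * indicator (U \<times> U) z + (A z + B z) + (A (?sw z) + B (?sw z)) \<partial>\<mu>)"
  proof (rule nn_integral_mono_AE)
    have \<Omega>U: "\<Omega> \<subseteq> U" using U closure_subset by blast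
    show "AE z in \<mu>. ennreal (F z) \<le>
        ennreal (F z) * indicator (U \<times> U) z + (A z + B z) + (A (?sw z) + B (?sw z))"
      using zero far1 far2
    proof eventually_elim
      case (elim z)
      consider "fst z \<in> U" "snd z \<in> U" | "fst z \<notin> \<Omega>" "snd z \<notin> \<Omega>" | "fst z \<in> \<Omega>" "snd z \<notin> U" |
        "snd z \<in> \<Omega>" "fst z \<notin> U"
        using \<Omega>U by blast
      then show ?case
      proof cases
        case 1
        then have "z \<in> U \<times> U" by (cases z) auto
        then show ?thesis by (simp add: add.assoc)
      next
        case 2
        then show ?thesis using elim by simp
      next
        case 3
        then have "ennreal (F z) \<le> A z + B z" using elim by (simp add: A_def B_def)
        also have "\<dots> \<le> ennreal (F z) * indicator (U \<times> U) z + (A z + B z) + (A (?sw z) + B (?sw z))"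
          by (simp add: add_increasing add_increasing2)
        finally show ?thesis .
      next
        case 4
        then have "ennreal (F z) \<le> A (?sw z) + B (?sw z)" using elim by (simp add: A_def B_def)
        also have "\<dots> \<le> ennreal (F z) * indicator (U \<times> U) z + (A z + B z) + (A (?sw z) + B (?sw z))"
          by (simp add: add_increasing)
        finally show ?thesis .
      qed
    qed
  qed
  also have "\<dots> = (\<integral>\<^sup>+z\<in>U \<times> U. ennreal (F z) \<partial>\<mu>) + ((\<integral>\<^sup>+z. A z \<partial>\<mu>) + (\<integral>\<^sup>+z. B z \<partial>\<mu>)) +
      ((\<integral>\<^sup>+z. A (?sw z) \<partial>\<mu>) + (\<integral>\<^sup>+z. B (?sw z) \<partial>\<mu>))"
    by (simp add: nn_integral_add)
  also have "(\<integral>\<^sup>+z. A (?sw z) \<partial>\<mu>) = (\<integral>\<^sup>+z. A z \<partial>\<mu>)" by (rule nn_integral_frac_measure_swap[symmetric]) measurable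
  also have "(\<integral>\<^sup>+z. B (?sw z) \<partial>\<mu>) = (\<integral>\<^sup>+z. B z \<partial>\<mu>)" by (rule nn_integral_frac_measure_swap[symmetric]) measurable
  also have "(\<integral>\<^sup>+z\<in>U \<times> U. ennreal (F z) \<partial>\<mu>) + ((\<integral>\<^sup>+z. A z \<partial>\<mu>) + (\<integral>\<^sup>+z. B z \<partial>\<mu>)) +
      ((\<integral>\<^sup>+z. A z \<partial>\<mu>) + (\<integral>\<^sup>+z. B z \<partial>\<mu>)) < \<infinity>"
    using near Afin Bfin by simp
  finally show ?thesis .
qed

lemma dom_finite: "emeasure lebesgue \<Omega> < \<infinity>"
  by (rule emeasure_bounded_less_top[OF bounded_dom])

text \<open>Across the complement of \<open>U\<close>, a function supported in \<open>\<Omega>\<close> contributes to the seminorm no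
  more than it does to the \<open>L\<^sup>p\<close> norm, up to a constant.\<close>

lemma extension_by_zero:
  assumes w[measurable]: "w \<in> borel_measurable lebesgue" and zero: "AE x in lebesgue. x \<notin> \<Omega> \<longrightarrow> w x = 0"
    and U: "open U" "closure \<Omega> \<subseteq> U"
    and gag: "gagliardo s p U w < \<infinity>" and Lp: "Lpow p U w < \<infinity>"
  shows "w \<in> W0"
proof (rule W0I[OF w zero])
  have \<Omega>U: "\<Omega> \<subseteq> U" using U closure_subset by blast
  have [measurable]: "increment w \<in> borel_measurable (lebesgue \<Otimes>\<^sub>M lebesgue)" by measurable
  have "(\<integral>\<^sup>+z. ennreal (\<bar>increment w z\<bar> powr p) \<partial>\<mu>) < \<infinity>"
  proof (rule nn_integral_\<mu>_finite_by_splitting[OF U, where a = "\<lambda>x. ennreal (\<bar>w x\<bar> powr p)" and b = "\<lambda>_. 0" and c = "\<lambda>_. 0"])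
    show "AE z in \<mu>. fst z \<notin> \<Omega> \<longrightarrow> snd z \<notin> \<Omega> \<longrightarrow> \<bar>increment w z\<bar> powr p = 0"
      using AE_lebesgue_imp_AE_fst_snd[OF zero] by eventually_elim auto
    show "(\<integral>\<^sup>+z\<in>U \<times> U. ennreal (\<bar>increment w z\<bar> powr p) \<partial>\<mu>) < \<infinity>"
      using gag by (simp add: gagliardo_def)
    show "AE z in \<mu>. fst z \<in> \<Omega> \<longrightarrow> snd z \<notin> U \<longrightarrow>
       ennreal (\<bar>increment w z\<bar> powr p) \<le> ennreal (\<bar>w (fst z)\<bar> powr p) + 0 * 0"
      using AE_lebesgue_imp_AE_fst_snd[OF zero] by eventually_elim (use \<Omega>U in auto)
    show "AE z in \<mu>. snd z \<in> \<Omega> \<longrightarrow> fst z \<notin> U \<longrightarrow>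
       ennreal (\<bar>increment w z\<bar> powr p) \<le> ennreal (\<bar>w (snd z)\<bar> powr p) + 0 * 0"
      using AE_lebesgue_imp_AE_fst_snd[OF zero] by eventually_elim (use \<Omega>U in auto)
    have "Lpow p \<Omega> w \<le> Lpow p U w"
      using \<Omega>U by (intro nn_integral_mono) (auto simp: indicator_def)
    then show "Lpow p \<Omega> w < \<infinity>" using Lp by order
    show "(\<integral>\<^sup>+x\<in>\<Omega>. 0 \<partial>lebesgue) < \<infinity>" "(\<integral>\<^sup>+y. 0 * ennreal (tail_weight s p (y::'a)) \<partial>lebesgue) < \<infinity>"
      by simp_all
  qed measurable
  then show "integrable \<mu> (\<lambda>z. \<bar>increment w z\<bar> powr p)"
    by (subst integrable_powr_iff[OF increment_\<mu>_measurable[OF w]])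
qed

text \<open>The pairing makes sense: near the diagonal by Young's inequality, far from it because the
  test function vanishes off \<open>\<Omega>\<close> and the tail of \<open>u\<close> is integrable.\<close>

lemma pairing_integrable:
  assumes u: "u \<in> Wt" and v: "v \<in> W0"
  shows "integrable \<mu> (\<lambda>z. pflux p (increment u z) * increment v z)"
proof -
  obtain U where um[measurable]: "u \<in> borel_measurable lebesgue" and U: "open U" "closure \<Omega> \<subseteq> U"
    and gag: "gagliardo s p U u < \<infinity>" and Lp: "Lpow p U u < \<infinity>"
    and tail: "(\<integral>\<^sup>+x. ennreal (\<bar>u x\<bar> powr (p - 1)) * ennreal (tail_weight s p x) \<partial>lebesgue) < \<infinity>"
    using WtE[OF u] by metis
  have vm[measurable]: "v \<in> borel_measurable lebesgue" using v by measurable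
  have \<Omega>U: "\<Omega> \<subseteq> U" using U closure_subset by blast
  have [measurable]: "U \<in> sets lebesgue" using U(1) by auto
  have [measurable]: "U \<times> U \<in> sets (lebesgue \<Otimes>\<^sub>M lebesgue)" by measurable
  have vLp: "Lpow p \<Omega> v < \<infinity>"
  proof -
    have "Lpow p \<Omega> v \<le> (\<integral>\<^sup>+x. ennreal (\<bar>v x\<bar> powr p) \<partial>lebesgue)"
      by (intro nn_integral_mono) (auto simp: indicator_def)
    also have "\<dots> < \<infinity>" using W0_integrable(1)[OF v] by (simp add: integrable_powr_iff[OF vm])
    finally show ?thesis .
  qed
  have uLp: "Lpow p \<Omega> u < \<infinity>"
  proof -
    have "Lpow p \<Omega> u \<le> Lpow p U u"
      using \<Omega>U by (intro nn_integral_mono) (auto simp: indicator_def)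
    then show ?thesis using Lp by order
  qed
  let ?F = "\<lambda>z. \<bar>pflux p (increment u z) * increment v z\<bar>"
  have F_eq: "?F z = \<bar>increment u z\<bar> powr (p - 1) * \<bar>increment v z\<bar>" for z
    by (simp add: abs_mult abs_pflux)
  let ?a = "\<lambda>x. ennreal (2 powr (p - 1) * (\<bar>u x\<bar> powr (p - 1) * \<bar>v x\<bar>))"
  let ?b = "\<lambda>x. ennreal (2 powr (p - 1) * \<bar>v x\<bar>)"
  let ?c = "\<lambda>x. ennreal (\<bar>u x\<bar> powr (p - 1))"
  have far: "ennreal (\<bar>u x - u y\<bar> powr (p - 1) * \<bar>v x\<bar>) \<le> ?a x + ?b x * ?c y" for x y
  proof -
    have "\<bar>u x - u y\<bar> powr (p - 1) * \<bar>v x\<bar> \<le> 2 powr (p - 1) * (\<bar>u x\<bar> powr (p - 1) + \<bar>u y\<bar> powr (p - 1)) * \<bar>v x\<bar>"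
      using p_pos by (intro mult_right_mono abs_diff_powr_le) auto
    also have "\<dots> = 2 powr (p - 1) * (\<bar>u x\<bar> powr (p - 1) * \<bar>v x\<bar>) + (2 powr (p - 1) * \<bar>v x\<bar>) * \<bar>u y\<bar> powr (p - 1)"
      by (simp add: algebra_simps)
    finally have "ennreal (\<bar>u x - u y\<bar> powr (p - 1) * \<bar>v x\<bar>) \<le> ennreal \<dots>" by (rule ennreal_leI)
    also have "\<dots> = ?a x + ennreal ((2 powr (p - 1) * \<bar>v x\<bar>) * \<bar>u y\<bar> powr (p - 1))"
      by (intro ennreal_plus) auto
    also have "ennreal ((2 powr (p - 1) * \<bar>v x\<bar>) * \<bar>u y\<bar> powr (p - 1)) = ?b x * ?c y"
      by (intro ennreal_mult) auto
    finally show ?thesis .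
  qed
  have "(\<integral>\<^sup>+z. ennreal (?F z) \<partial>\<mu>) < \<infinity>"
  proof (rule nn_integral_\<mu>_finite_by_splitting[OF U, where a = ?a and b = ?b and c = ?c])
    show "AE z in \<mu>. fst z \<notin> \<Omega> \<longrightarrow> snd z \<notin> \<Omega> \<longrightarrow> ?F z = 0"
      using AE_lebesgue_imp_AE_fst_snd[OF W0_zero[OF v]] by eventually_elim auto
    show "AE z in \<mu>. fst z \<in> \<Omega> \<longrightarrow> snd z \<notin> U \<longrightarrow> ennreal (?F z) \<le> ?a (fst z) + ?b (fst z) * ?c (snd z)"
      using AE_lebesgue_imp_AE_fst_snd[OF W0_zero[OF v]]
    proof eventually_elim
      case (elim z)
      show ?case
      proof (intro impI)
        assume "fst z \<in> \<Omega>" "snd z \<notin> U"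
        then have "v (snd z) = 0" using elim \<Omega>U by blast
        then show "ennreal (?F z) \<le> ?a (fst z) + ?b (fst z) * ?c (snd z)"
          unfolding F_eq using far[of "fst z" "snd z"] by simp
      qed
    qed
    show "AE z in \<mu>. snd z \<in> \<Omega> \<longrightarrow> fst z \<notin> U \<longrightarrow> ennreal (?F z) \<le> ?a (snd z) + ?b (snd z) * ?c (fst z)"
      using AE_lebesgue_imp_AE_fst_snd[OF W0_zero[OF v]]
    proof eventually_elim
      case (elim z)
      show ?case
      proof (intro impI)
        assume "snd z \<in> \<Omega>" "fst z \<notin> U"
        then have "v (fst z) = 0" using elim \<Omega>U by blast
        then show "ennreal (?F z) \<le> ?a (snd z) + ?b (snd z) * ?c (fst z)"
          unfolding F_eq using far[of "snd z" "fst z"] by (simp add: abs_minus_commute)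
      qed
    qed
    have "(\<integral>\<^sup>+z\<in>U \<times> U. ennreal (?F z) \<partial>\<mu>) \<le>
        (\<integral>\<^sup>+z. ennreal (\<bar>increment u z\<bar> powr p) * indicator (U \<times> U) z + ennreal (\<bar>increment v z\<bar> powr p) \<partial>\<mu>)"
    proof (intro nn_integral_mono)
      fix z :: "'a \<times> 'a"
      have "?F z \<le> \<bar>increment u z\<bar> powr p + \<bar>increment v z\<bar> powr p"
        unfolding F_eq using p_pos by (intro powr_mult_le_sum) auto
      then have "ennreal (?F z) \<le> ennreal (\<bar>increment u z\<bar> powr p) + ennreal (\<bar>increment v z\<bar> powr p)"
        by (simp add: ennreal_plus[symmetric] ennreal_leI del: ennreal_plus)
      then show "ennreal (?F z) * indicator (U \<times> U) z \<le>
        ennreal (\<bar>increment u z\<bar> powr p) * indicator (U \<times> U) z + ennreal (\<bar>increment v z\<bar> powr p)"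
        by (cases "z \<in> U \<times> U") auto
    qed
    also have "\<dots> = gagliardo s p U u + gagliardo s p UNIV v"
      unfolding gagliardo_UNIV_eq unfolding gagliardo_def by (intro nn_integral_add) measurable
    also have "\<dots> < \<infinity>"
      using gag W0_integrable(2)[OF v] by (simp add: gagliardo_eq_energy)
    finally show "(\<integral>\<^sup>+z\<in>U \<times> U. ennreal (?F z) \<partial>\<mu>) < \<infinity>" .
    show "(\<integral>\<^sup>+x\<in>\<Omega>. ?a x \<partial>lebesgue) < \<infinity>"
    proof -
      have "(\<integral>\<^sup>+x\<in>\<Omega>. ?a x \<partial>lebesgue) \<le> (\<integral>\<^sup>+x. ennreal (2 powr (p - 1)) *
          (ennreal (\<bar>u x\<bar> powr p) * indicator \<Omega> x + ennreal (\<bar>v x\<bar> powr p) * indicator \<Omega> x) \<partial>lebesgue)"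
      proof (intro nn_integral_mono)
        fix x
        have "ennreal (\<bar>u x\<bar> powr (p - 1) * \<bar>v x\<bar>) \<le> ennreal (\<bar>u x\<bar> powr p + \<bar>v x\<bar> powr p)"
          using p_pos by (intro ennreal_leI powr_mult_le_sum) auto
        then have "ennreal (2 powr (p - 1)) * ennreal (\<bar>u x\<bar> powr (p - 1) * \<bar>v x\<bar>) \<le>
            ennreal (2 powr (p - 1)) * ennreal (\<bar>u x\<bar> powr p + \<bar>v x\<bar> powr p)"
          by (intro mult_left_mono) auto
        then have "?a x \<le> ennreal (2 powr (p - 1)) * (ennreal (\<bar>u x\<bar> powr p) + ennreal (\<bar>v x\<bar> powr p))"
          by (simp add: ennreal_mult ennreal_plus)
        then show "?a x * indicator \<Omega> x \<le> ennreal (2 powr (p - 1)) *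
          (ennreal (\<bar>u x\<bar> powr p) * indicator \<Omega> x + ennreal (\<bar>v x\<bar> powr p) * indicator \<Omega> x)"
          by (cases "x \<in> \<Omega>") auto
      qed
      also have "\<dots> = ennreal (2 powr (p - 1)) * (Lpow p \<Omega> u +
          Lpow p \<Omega> v)"
        by (simp add: nn_integral_cmult nn_integral_add)
      also have "\<dots> < \<infinity>" using uLp vLp by (simp add: ennreal_mult_less_top)
      finally show ?thesis .
    qed
    show "(\<integral>\<^sup>+x\<in>\<Omega>. ?b x \<partial>lebesgue) < \<infinity>"
    proof -
      have "(\<integral>\<^sup>+x\<in>\<Omega>. ?b x \<partial>lebesgue) \<le> (\<integral>\<^sup>+x. ennreal (2 powr (p - 1)) *
          (indicator \<Omega> x + ennreal (\<bar>v x\<bar> powr p) * indicator \<Omega> x) \<partial>lebesgue)"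
      proof (intro nn_integral_mono)
        fix x
        have "\<bar>v x\<bar> \<le> 1 + \<bar>v x\<bar> powr p" using powr_le_one_plus[of 1 p "\<bar>v x\<bar>"] p_pos by simp
        then have "ennreal \<bar>v x\<bar> \<le> 1 + ennreal (\<bar>v x\<bar> powr p)"
          by (metis ennreal_1 ennreal_leI ennreal_plus powr_ge_zero zero_le_one)
        then have "ennreal (2 powr (p - 1)) * ennreal \<bar>v x\<bar> \<le> ennreal (2 powr (p - 1)) * (1 + ennreal (\<bar>v x\<bar> powr p))"
          by (intro mult_left_mono) auto
        then show "?b x * indicator \<Omega> x \<le> ennreal (2 powr (p - 1)) *
          (indicator \<Omega> x + ennreal (\<bar>v x\<bar> powr p) * indicator \<Omega> x)"
          by (cases "x \<in> \<Omega>") (auto simp: ennreal_mult)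
      qed
      also have "\<dots> = ennreal (2 powr (p - 1)) * (emeasure lebesgue \<Omega> +
          Lpow p \<Omega> v)"
        by (simp add: nn_integral_cmult nn_integral_add)
      also have "\<dots> < \<infinity>" using dom_finite vLp by (simp add: ennreal_mult_less_top)
      finally show ?thesis .
    qed
    show "(\<integral>\<^sup>+y. ?c y * ennreal (tail_weight s p y) \<partial>lebesgue) < \<infinity>" by (rule tail)
  qed measurable
  then show ?thesis by (intro integrableI_bounded) auto
qed

text \<open>The test function of the comparison principle. It vanishes off \<open>\<Omega>\<close>, where
  \<open>u = 0 \<le> ub\<close>, and near \<open>\<Omega>\<close> its increments are dominated by those of \<open>u - ub\<close>.\<close>

lemma truncation_in_W0:
  assumes u: "u \<in> W0" and ub: "ub \<in> Wt" and pos: "AE x in lebesgue. x \<notin> \<Omega> \<longrightarrow> 0 \<le> ub x"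
  shows "(\<lambda>x. max 0 (u x - ub x)) \<in> W0"
proof -
  obtain U where ubm[measurable]: "ub \<in> borel_measurable lebesgue" and U: "open U" "closure \<Omega> \<subseteq> U"
    and gag: "gagliardo s p U ub < \<infinity>" and Lp: "Lpow p U ub < \<infinity>"
    using WtE[OF ub] by metis
  have um[measurable]: "u \<in> borel_measurable lebesgue" using u by measurable
  have [measurable]: "U \<in> sets lebesgue" using U(1) by auto
  have [measurable]: "U \<times> U \<in> sets (lebesgue \<Otimes>\<^sub>M lebesgue)" by measurable
  let ?w = "\<lambda>x. max 0 (u x - ub x)"
  show ?thesis
  proof (rule extension_by_zero[OF _ _ U])
    show "?w \<in> borel_measurable lebesgue" by measurable
    show "AE x in lebesgue. x \<notin> \<Omega> \<longrightarrow> ?w x = 0"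
      using W0_zero[OF u] pos by eventually_elim auto
    have le: "\<bar>t\<bar> powr p \<le> 2 powr p * (\<bar>a\<bar> powr p + \<bar>b\<bar> powr p)" if "\<bar>t\<bar> \<le> \<bar>a - b\<bar>" for t a b :: real
      using powr_mono2[OF _ _ that, of p] abs_diff_powr_le[of p a b] p_pos by linarith
    have le': "ennreal (\<bar>t\<bar> powr p) \<le> ennreal (2 powr p) * (ennreal (\<bar>a\<bar> powr p) + ennreal (\<bar>b\<bar> powr p))"
      if "\<bar>t\<bar> \<le> \<bar>a - b\<bar>" for t a b :: real
      using ennreal_leI[OF le[OF that]] by (simp add: ennreal_mult ennreal_plus)
    have "gagliardo s p U ?w \<le> (\<integral>\<^sup>+z. ennreal (2 powr p) * (ennreal (\<bar>increment u z\<bar> powr p) +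
        ennreal (\<bar>increment ub z\<bar> powr p) * indicator (U \<times> U) z) \<partial>\<mu>)"
      unfolding gagliardo_def
    proof (intro nn_integral_mono)
      fix z :: "'a \<times> 'a"
      have "\<bar>increment ?w z\<bar> \<le> \<bar>increment u z - increment ub z\<bar>" by (auto simp: max_def abs_if)
      from le'[OF this]
      show "ennreal (\<bar>increment ?w z\<bar> powr p) * indicator (U \<times> U) z \<le> ennreal (2 powr p) *
         (ennreal (\<bar>increment u z\<bar> powr p) + ennreal (\<bar>increment ub z\<bar> powr p) * indicator (U \<times> U) z)"
        by (cases "z \<in> U \<times> U") auto
    qed
    also have "\<dots> = ennreal (2 powr p) * (gagliardo s p UNIV u + gagliardo s p U ub)"
      unfolding gagliardo_UNIV_eq gagliardo_def by (simp add: nn_integral_cmult nn_integral_add)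
    also have "\<dots> < \<infinity>"
      using gag W0_integrable(2)[OF u] by (simp add: gagliardo_eq_energy ennreal_mult_less_top)
    finally show "gagliardo s p U ?w < \<infinity>" .
    have "(\<integral>\<^sup>+x\<in>U. ennreal (\<bar>?w x\<bar> powr p) \<partial>lebesgue) \<le> (\<integral>\<^sup>+x. ennreal (2 powr p) *
        (ennreal (\<bar>u x\<bar> powr p) + ennreal (\<bar>ub x\<bar> powr p) * indicator U x) \<partial>lebesgue)"
    proof (intro nn_integral_mono)
      fix x
      have "\<bar>?w x\<bar> \<le> \<bar>u x - ub x\<bar>" by simp
      from le'[OF this] show "ennreal (\<bar>?w x\<bar> powr p) * indicator U x \<le> ennreal (2 powr p) *
        (ennreal (\<bar>u x\<bar> powr p) + ennreal (\<bar>ub x\<bar> powr p) * indicator U x)"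
        by (cases "x \<in> U") auto
    qed
    also have "\<dots> = ennreal (2 powr p) * ((\<integral>\<^sup>+x. ennreal (\<bar>u x\<bar> powr p) \<partial>lebesgue) +
        Lpow p U ub)"
      by (simp add: nn_integral_cmult nn_integral_add)
    also have "\<dots> < \<infinity>"
      using Lp W0_integrable(1)[OF u] by (simp add: ennreal_mult_less_top integrable_powr_iff[OF um])
    finally show "(\<integral>\<^sup>+x\<in>U. ennreal (\<bar>?w x\<bar> powr p) \<partial>lebesgue) < \<infinity>" .
  qed
qed

text \<open>A function with vanishing increments is constant, and the constant is the value \<open>0\<close> on a ball
  outside the bounded set \<open>\<Omega>\<close>.\<close>

lemma W0_increment_zero:
  assumes w: "w \<in> W0" and inc: "AE z in \<mu>. w (fst z) = w (snd z)"
  shows "AE x in lebesgue. w x = 0"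
proof -
  obtain c where c: "ball c 1 \<inter> \<Omega> = {}" using bounded_unit_ball_outside[OF bounded_dom] by blast
  have "AE x in lebesgue. AE y in lebesgue. x \<noteq> y \<longrightarrow> w x = w y"
    by (rule AE_frac_measure_imp_AE_AE[OF inc])
  then show ?thesis
  proof eventually_elim
    case (elim x)
    show "w x = 0"
    proof (rule ccontr)
      assume nz: "w x \<noteq> 0"
      have "AE y in lebesgue. y \<noteq> x" using AE_not_in[of "{x}" lebesgue] by auto
      with elim W0_zero[OF w] have "AE y in lebesgue. y \<notin> ball c 1"
        by eventually_elim (use nz c in auto)
      then have "ball c 1 \<in> null_sets lebesgue" by (subst (asm) AE_iff_null_sets[symmetric]) auto
      then have "emeasure lebesgue (ball c 1) = 0" by auto
      then show False using emeasure_ball_powr[of 1 c] measure_unit_ball_pos[where 'a='a] by auto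
    qed
  qed
qed

text \<open>Let \<open>w = (u - ub)\<^sup>+\<close>. By strict monotonicity of the flux, the integrand of the difference of
  the two pairings with \<open>w\<close> is nonnegative and vanishes only where \<open>w\<close> has no increment. As its
  integral is not positive, \<open>w\<close> has no increments at all.\<close>

lemma comparison:
  assumes u: "u \<in> W0" and ub: "ub \<in> Wt" and pos: "AE x in lebesgue. x \<notin> \<Omega> \<longrightarrow> 0 \<le> ub x"
    and le: "frac_p_laplacian s p u (\<lambda>x. max 0 (u x - ub x)) \<le>
      frac_p_laplacian s p ub (\<lambda>x. max 0 (u x - ub x))"
  shows "AE x in lebesgue. u x \<le> ub x"
proof -
  define w where "w x = max 0 (u x - ub x)" for x
  have w: "w \<in> W0" unfolding w_def using truncation_in_W0[OF u ub pos] .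
  have i1: "integrable \<mu> (\<lambda>z. pflux p (increment u z) * increment w z)"
    by (rule pairing_integrable[OF W0_subset_Wt[OF u] w])
  have i2: "integrable \<mu> (\<lambda>z. pflux p (increment ub z) * increment w z)"
    by (rule pairing_integrable[OF ub w])
  let ?D = "\<lambda>z. (pflux p (increment u z) - pflux p (increment ub z)) * increment w z"
  have iD: "integrable \<mu> ?D" using i1 i2 by (simp add: left_diff_distrib)
  have D: "?D z \<ge> 0 \<and> (?D z = 0 \<longrightarrow> increment w z = 0)" for z
  proof -
    have mono: "increment u z < increment ub z \<Longrightarrow> increment w z \<le> 0"
      "increment u z > increment ub z \<Longrightarrow> increment w z \<ge> 0"
      "increment u z = increment ub z \<Longrightarrow> increment w z = 0"
      by (auto simp: w_def max_def)
    consider "increment u z < increment ub z" | "increment u z > increment ub z" | "increment u z = increment ub z"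
      by linarith
    then show ?thesis
    proof cases
      case 1
      then show ?thesis using mono(1) pflux_strict_mono[OF p_pos(2) 1] by (auto simp: mult_nonpos_nonpos)
    next
      case 2
      then show ?thesis using mono(2) pflux_strict_mono[OF p_pos(2) 2] by auto
    next
      case 3
      then show ?thesis using mono(3) by auto
    qed
  qed
  have "(LINT z|\<mu>. ?D z) = frac_p_laplacian s p u w - frac_p_laplacian s p ub w"
    unfolding frac_p_laplacian_eq left_diff_distrib using i1 i2 by simp
  also have "\<dots> \<le> 0" using le unfolding w_def by simp
  finally have "(LINT z|\<mu>. ?D z) = 0"
    using Bochner_Integration.integral_nonneg[of \<mu> ?D] D by (intro antisym) auto
  then have "AE z in \<mu>. ?D z = 0"
    using integral_nonneg_eq_0_iff_AE[OF iD] D by auto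
  then have "AE z in \<mu>. w (fst z) = w (snd z)" by eventually_elim (use D in auto)
  then have "AE x in lebesgue. w x = 0" by (rule W0_increment_zero[OF w])
  then show ?thesis by eventually_elim (auto simp: w_def max_def split: if_splits)
qed

end

section \<open>Compactness\<close>

context frac_dirichlet
begin

text \<open>Linearises \<open>t\<close> against \<open>t\<^sup>p\<close>; it stands in for Hoelder's inequality in passing from the
  energy to the \<open>L\<^sup>1\<close> norm.\<close>

lemma powr_ge_self_scaled:
  fixes t \<epsilon> :: real
  assumes "\<epsilon> > 0" "t \<ge> 0"
  shows "t \<le> \<epsilon> + \<epsilon> powr (1 - p) * t powr p"
proof (cases "t \<le> \<epsilon>")
  case True
  then show ?thesis by (simp add: add_increasing2)
next
  case False
  then have t: "t > 0" "\<epsilon> \<le> t" using assms by auto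
  have "t = t powr (1 - p) * t powr p" using t by (simp flip: powr_add)
  also have "\<dots> \<le> \<epsilon> powr (1 - p) * t powr p"
    using t assms p_pos by (intro mult_right_mono powr_mono2') auto
  finally show ?thesis using assms by linarith
qed

lemma energy_density:
  assumes "u \<in> W0"
  shows "(\<integral>\<^sup>+x. frac_density s p UNIV u x \<partial>lebesgue) = ennreal (energy s p u)"
  using gagliardo_UNIV[OF W0_measurable[OF assms], of s p] gagliardo_eq_energy[OF W0_integrable(2)[OF assms]]
  by simp

lemma W0_Lp_bound:
  obtains C where "C \<ge> 0" "\<And>u. u \<in> W0 \<Longrightarrow> (LINT x|lebesgue. \<bar>u x\<bar> powr p) \<le> C * energy s p u"
proof -
  obtain C where C: "C \<ge> 0" and P: "\<And>u. u \<in> borel_measurable lebesgue \<Longrightarrow>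
      (AE x in lebesgue. x \<notin> \<Omega> \<longrightarrow> u x = 0) \<Longrightarrow>
      (\<integral>\<^sup>+x. ennreal (\<bar>u x\<bar> powr p) \<partial>lebesgue) \<le> ennreal C * gagliardo s p UNIV u"
    by (rule fractional_Poincare[OF bounded_dom less_imp_le[OF s_pos] p_pos(1)]) (rule that)
  have "(LINT x|lebesgue. \<bar>u x\<bar> powr p) \<le> C * energy s p u" if u: "u \<in> W0" for u
  proof -
    have "ennreal (LINT x|lebesgue. \<bar>u x\<bar> powr p) = (\<integral>\<^sup>+x. ennreal (\<bar>u x\<bar> powr p) \<partial>lebesgue)"
      using W0_integrable(1)[OF u] by (intro nn_integral_eq_integral[symmetric]) auto
    also have "\<dots> \<le> ennreal C * gagliardo s p UNIV u"
      using W0_measurable[OF u] W0_zero[OF u] by (rule P)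
    also have "\<dots> = ennreal (C * energy s p u)"
      using C energy_nonneg by (simp add: gagliardo_eq_energy[OF W0_integrable(2)[OF u]] ennreal_mult)
    finally show ?thesis using C energy_nonneg by (subst (asm) ennreal_le_iff) auto
  qed
  with C that show thesis by blast
qed

definition vol :: real where "vol = measure lebesgue \<Omega>"

lemma vol: "emeasure lebesgue \<Omega> = ennreal vol" "vol \<ge> 0"
proof -
  show "emeasure lebesgue \<Omega> = ennreal vol"
    unfolding vol_def using dom_finite by (intro emeasure_eq_ennreal_measure) auto
  show "vol \<ge> 0" by (simp add: vol_def)
qed

lemma indicator_dom_integrable: "integrable lebesgue (indicator \<Omega> :: 'a \<Rightarrow> real)"
  using dom_finite by (intro integrable_real_indicator) auto

lemma W0_L1:
  assumes u: "u \<in> W0"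
  shows "integrable lebesgue u" "(LINT x|lebesgue. \<bar>u x\<bar>) \<le> vol + (LINT x|lebesgue. \<bar>u x\<bar> powr p)"
proof -
  have [measurable]: "u \<in> borel_measurable lebesgue" using u by measurable
  have le: "AE x in lebesgue. \<bar>u x\<bar> \<le> indicator \<Omega> x + \<bar>u x\<bar> powr p"
    using W0_zero[OF u]
  proof eventually_elim
    case (elim x)
    then show ?case using powr_le_one_plus[of 1 p "\<bar>u x\<bar>"] p_pos by (cases "x \<in> \<Omega>") auto
  qed
  have i: "integrable lebesgue (\<lambda>x. indicator \<Omega> x + \<bar>u x\<bar> powr p)"
    using W0_integrable(1)[OF u] indicator_dom_integrable by simp
  show iu: "integrable lebesgue u" by (rule integrable_abs_bound[OF i _ le]) measurable
  have "(LINT x|lebesgue. \<bar>u x\<bar>) \<le> (LINT x|lebesgue. indicator \<Omega> x + \<bar>u x\<bar> powr p)"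
    using iu i le by (intro integral_mono_AE) auto
  also have "\<dots> = vol + (LINT x|lebesgue. \<bar>u x\<bar> powr p)"
    using W0_integrable(1)[OF u] indicator_dom_integrable by (simp add: vol_def)
  finally show "(LINT x|lebesgue. \<bar>u x\<bar>) \<le> vol + (LINT x|lebesgue. \<bar>u x\<bar> powr p)" .
qed

text \<open>The value \<open>w x\<close> differs from the average of \<open>w\<close> over a ball containing \<open>x\<close> by the average of
  the increments \<open>w x - w y\<close>. These are controlled by the density of the energy at \<open>x\<close>, with a factor
  \<open>r\<^bsup>ps\<^esup>\<close> that is small on small balls.\<close>

lemma oscillation_on_ball:
  assumes w: "w \<in> W0" and x: "x \<in> ball c r" and r: "r > 0" and \<epsilon>: "\<epsilon> > 0"
  defines "\<omega> \<equiv> measure lebesgue (ball (0::'a) 1)" and "N \<equiv> real DIM('a)"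
  shows "ennreal \<bar>w x\<bar> \<le> ennreal \<epsilon> + ennreal (\<epsilon> powr (1 - p) * (2 powr (N + p * s) * r powr (p * s) / \<omega>)) *
      frac_density s p UNIV w x + ennreal (1 / (\<omega> * r powr N) * \<bar>LINT y|lebesgue. indicator (ball c r) y * w y\<bar>)"
proof -
  have [measurable]: "w \<in> borel_measurable lebesgue" using w by measurable
  have bs [measurable]: "ball c r \<in> sets lebesgue" by auto
  define m where "m = \<omega> * r powr N"
  have \<omega>: "\<omega> > 0" using measure_unit_ball_pos by (auto simp: \<omega>_def)
  have m: "m > 0" using \<omega> r by (simp add: m_def)
  have em: "emeasure lebesgue (ball c r) = ennreal m"
    unfolding m_def \<omega>_def N_def using r by (rule emeasure_ball_powr)
  have iind: "integrable lebesgue (indicator (ball c r) :: 'a \<Rightarrow> real)"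
    using em by (intro integrable_real_indicator bs) simp
  have mm: "measure lebesgue (ball c r) = m" using em m by (simp add: measure_def)
  have iw: "integrable lebesgue (\<lambda>y. indicator (ball c r) y * w y)"
    using W0_L1(1)[OF w] by (rule integrable_mult_indicator[OF bs, of w, simplified])
  have id: "integrable lebesgue (\<lambda>y. indicator (ball c r) y * (w x - w y))"
    using iind iw by (simp add: right_diff_distrib)
  have "m * w x = (LINT y|lebesgue. indicator (ball c r) y * (w x - w y)) + (LINT y|lebesgue. indicator (ball c r) y * w y)"
    using iind iw by (simp add: right_diff_distrib mm)
  then have "\<bar>m * w x\<bar> \<le> \<bar>LINT y|lebesgue. indicator (ball c r) y * (w x - w y)\<bar> +
      \<bar>LINT y|lebesgue. indicator (ball c r) y * w y\<bar>"
    by (simp only: abs_triangle_ineq)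
  then have "m * \<bar>w x\<bar> \<le> \<bar>LINT y|lebesgue. indicator (ball c r) y * (w x - w y)\<bar> +
      \<bar>LINT y|lebesgue. indicator (ball c r) y * w y\<bar>"
    using m by (simp only: abs_mult abs_of_pos)
  also have "\<bar>LINT y|lebesgue. indicator (ball c r) y * (w x - w y)\<bar> \<le>
      (LINT y|lebesgue. \<bar>indicator (ball c r) y * (w x - w y)\<bar>)" by (rule integral_abs_bound)
  finally have "ennreal (m * \<bar>w x\<bar>) \<le> ennreal ((LINT y|lebesgue. \<bar>indicator (ball c r) y * (w x - w y)\<bar>) +
      \<bar>LINT y|lebesgue. indicator (ball c r) y * w y\<bar>)" by (intro ennreal_leI) simp
  also have "\<dots> = ennreal (LINT y|lebesgue. \<bar>indicator (ball c r) y * (w x - w y)\<bar>) +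
      ennreal \<bar>LINT y|lebesgue. indicator (ball c r) y * w y\<bar>"
    by (intro ennreal_plus Bochner_Integration.integral_nonneg) auto
  also have "ennreal (LINT y|lebesgue. \<bar>indicator (ball c r) y * (w x - w y)\<bar>) =
      (\<integral>\<^sup>+y. ennreal \<bar>indicator (ball c r) y * (w x - w y)\<bar> \<partial>lebesgue)"
    using id by (intro nn_integral_eq_integral[symmetric]) auto
  also have "\<dots> \<le> (\<integral>\<^sup>+y. ennreal \<epsilon> * indicator (ball c r) y + ennreal (\<epsilon> powr (1 - p) * (2 * r) powr (N + p * s)) *
      ennreal (frac_kernel s p x y * \<bar>w x - w y\<bar> powr p) \<partial>lebesgue)"
  proof (intro nn_integral_mono)
    fix y
    show "ennreal \<bar>indicator (ball c r) y * (w x - w y)\<bar> \<le> ennreal \<epsilon> * indicator (ball c r) y +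
      ennreal (\<epsilon> powr (1 - p) * (2 * r) powr (N + p * s)) * ennreal (frac_kernel s p x y * \<bar>w x - w y\<bar> powr p)"
    proof (cases "y \<in> ball c r")
      case True
      have "norm (x - y) \<le> 2 * r"
        using True x dist_triangle[of x y c] by (simp add: dist_norm[symmetric] dist_commute)
      then have k: "\<bar>w x - w y\<bar> powr p \<le> (2 * r) powr (N + p * s) * (frac_kernel s p x y * \<bar>w x - w y\<bar> powr p)"
        unfolding N_def using p_pos s_pos by (intro powr_le_kernel) auto
      have "\<bar>w x - w y\<bar> \<le> \<epsilon> + \<epsilon> powr (1 - p) * \<bar>w x - w y\<bar> powr p"
        using \<epsilon> by (intro powr_ge_self_scaled) auto
      also have "\<dots> \<le> \<epsilon> + \<epsilon> powr (1 - p) * ((2 * r) powr (N + p * s) * (frac_kernel s p x y * \<bar>w x - w y\<bar> powr p))"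
        using k by (intro add_left_mono mult_left_mono) auto
      finally have "ennreal \<bar>w x - w y\<bar> \<le> ennreal (\<epsilon> + (\<epsilon> powr (1 - p) * (2 * r) powr (N + p * s)) *
          (frac_kernel s p x y * \<bar>w x - w y\<bar> powr p))"
        by (intro ennreal_leI) (simp add: mult.assoc)
      also have "\<dots> = ennreal \<epsilon> + ennreal ((\<epsilon> powr (1 - p) * (2 * r) powr (N + p * s)) *
          (frac_kernel s p x y * \<bar>w x - w y\<bar> powr p))"
        using \<epsilon> by (intro ennreal_plus) auto
      also have "ennreal ((\<epsilon> powr (1 - p) * (2 * r) powr (N + p * s)) *
          (frac_kernel s p x y * \<bar>w x - w y\<bar> powr p)) = ennreal (\<epsilon> powr (1 - p) * (2 * r) powr (N + p * s)) *
          ennreal (frac_kernel s p x y * \<bar>w x - w y\<bar> powr p)"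
        by (intro ennreal_mult) auto
      finally show ?thesis using True by simp
    qed simp
  qed
  also have "\<dots> = ennreal \<epsilon> * ennreal m + ennreal (\<epsilon> powr (1 - p) * (2 * r) powr (N + p * s)) * frac_density s p UNIV w x"
    unfolding frac_density_def em[symmetric] using bs
    by (subst nn_integral_add) (simp_all add: nn_integral_cmult)
  finally have main: "ennreal (m * \<bar>w x\<bar>) \<le> ennreal \<epsilon> * ennreal m + ennreal (\<epsilon> powr (1 - p) * (2 * r) powr (N + p * s)) *
     frac_density s p UNIV w x + ennreal \<bar>LINT y|lebesgue. indicator (ball c r) y * w y\<bar>"
    by (simp add: add_right_mono)
  have "ennreal \<bar>w x\<bar> = ennreal (1 / m) * ennreal (m * \<bar>w x\<bar>)"
    using m by (simp add: ennreal_mult[symmetric])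
  also have "\<dots> \<le> ennreal (1 / m) * (ennreal \<epsilon> * ennreal m + ennreal (\<epsilon> powr (1 - p) * (2 * r) powr (N + p * s)) *
     frac_density s p UNIV w x + ennreal \<bar>LINT y|lebesgue. indicator (ball c r) y * w y\<bar>)"
    using main by (intro mult_left_mono) auto
  also have "\<dots> = ennreal (1 / m) * (ennreal \<epsilon> * ennreal m) +
      (ennreal (1 / m) * ennreal (\<epsilon> powr (1 - p) * (2 * r) powr (N + p * s))) * frac_density s p UNIV w x +
      ennreal (1 / m) * ennreal \<bar>LINT y|lebesgue. indicator (ball c r) y * w y\<bar>"
    by (simp only: distrib_left mult.assoc)
  also have "ennreal (1 / m) * (ennreal \<epsilon> * ennreal m) = ennreal \<epsilon>"
    using m \<epsilon> by (simp add: ennreal_mult[symmetric])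
  also have "ennreal (1 / m) * ennreal (\<epsilon> powr (1 - p) * (2 * r) powr (N + p * s)) =
      ennreal (1 / m * (\<epsilon> powr (1 - p) * (2 * r) powr (N + p * s)))"
    using m by (intro ennreal_mult[symmetric]) auto
  also have "1 / m * (\<epsilon> powr (1 - p) * (2 * r) powr (N + p * s)) =
      \<epsilon> powr (1 - p) * (2 powr (N + p * s) * r powr (p * s) / \<omega>)"
    using r \<omega> by (simp add: m_def powr_mult powr_add field_simps)
  also have "ennreal (1 / m) * ennreal \<bar>LINT y|lebesgue. indicator (ball c r) y * w y\<bar> =
      ennreal (1 / m * \<bar>LINT y|lebesgue. indicator (ball c r) y * w y\<bar>)"
    using m by (intro ennreal_mult[symmetric]) auto
  finally show ?thesis unfolding m_def .
qed

text \<open>Total boundedness in disguise: cover \<open>\<Omega>\<close> by finitely many small balls, and at each point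
  compare with the average over a ball that contains it. First \<open>\<epsilon>\<close> is chosen for \<open>\<eta>\<close>, then the radius
  for \<open>\<epsilon>\<close> and the bound \<open>K\<close> on the energy.\<close>

lemma L1_by_finitely_many_averages:
  assumes \<eta>: "\<eta> > 0" and K: "K \<ge> 0"
  shows "\<exists>B C. finite B \<and> B \<subseteq> sets lebesgue \<and> C \<ge> 0 \<and> (\<forall>w\<in>W0. energy s p w \<le> K \<longrightarrow>
     (LINT x|lebesgue. \<bar>w x\<bar>) \<le> \<eta> + C * (\<Sum>b\<in>B. \<bar>LINT y|lebesgue. indicator b y * w y\<bar>))"
proof -
  let ?N = "real DIM('a)"
  define \<omega> where "\<omega> = measure lebesgue (ball (0::'a) 1)"
  have \<omega>: "\<omega> > 0" using measure_unit_ball_pos by (auto simp: \<omega>_def)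
  define \<epsilon> where "\<epsilon> = \<eta> / (2 * (vol + 1))"
  have \<epsilon>: "\<epsilon> > 0" "\<epsilon> * vol \<le> \<eta> / 2"
    using \<eta> vol(2) by (auto simp: \<epsilon>_def field_simps)
  define A where "A = \<epsilon> powr (1 - p) * 2 powr (?N + p * s) / \<omega> * (K + 1)"
  have A: "A > 0" using \<epsilon> \<omega> K by (simp add: A_def)
  define r where "r = (\<eta> / (2 * A)) powr (1 / (p * s))"
  have r: "r > 0" using A \<eta> by (simp add: r_def)
  have rps: "r powr (p * s) = \<eta> / (2 * A)"
    using A \<eta> p_pos s_pos by (simp add: r_def powr_powr)
  define c1 where "c1 = \<epsilon> powr (1 - p) * (2 powr (?N + p * s) * r powr (p * s) / \<omega>)"
  have c1: "c1 \<ge> 0" "c1 * (K + 1) = \<eta> / 2"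
  proof -
    show "c1 \<ge> 0" using \<omega> by (simp add: c1_def)
    have "c1 * (K + 1) = A * r powr (p * s)" by (simp add: c1_def A_def)
    then show "c1 * (K + 1) = \<eta> / 2" using A by (simp add: rps)
  qed
  have cpt: "compact (closure \<Omega>)" using bounded_dom by (simp add: compact_closure)
  have cover: "closure \<Omega> \<subseteq> (\<Union>x\<in>closure \<Omega>. ball x r)" using r by auto
  obtain D where D: "D \<subseteq> closure \<Omega>" "finite D" "closure \<Omega> \<subseteq> (\<Union>x\<in>D. ball x r)"
    using compactE_image[OF cpt _ cover] by auto
  define C where "C = vol * (1 / (\<omega> * r powr ?N))"
  have C: "C \<ge> 0" using vol \<omega> r by (simp add: C_def)
  let ?B = "(\<lambda>c. ball c r) ` D"
  have main: "(LINT x|lebesgue. \<bar>w x\<bar>) \<le> \<eta> + C * (\<Sum>b\<in>?B. \<bar>LINT y|lebesgue. indicator b y * w y\<bar>)"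
    if w: "w \<in> W0" and e: "energy s p w \<le> K" for w
  proof -
    have [measurable]: "w \<in> borel_measurable lebesgue" using w by measurable
    let ?S = "\<Sum>b\<in>?B. \<bar>LINT y|lebesgue. indicator b y * w y\<bar>"
    define c0 where "c0 = 1 / (\<omega> * r powr ?N) * ?S"
    have S: "?S \<ge> 0" by (intro sum_nonneg) auto
    then have c: "c0 \<ge> 0" using \<omega> r by (simp add: c0_def)
    have "ennreal (LINT x|lebesgue. \<bar>w x\<bar>) = (\<integral>\<^sup>+x. ennreal \<bar>w x\<bar> \<partial>lebesgue)"
      using W0_L1(1)[OF w] by (intro nn_integral_eq_integral[symmetric]) auto
    also have "\<dots> \<le> (\<integral>\<^sup>+x. (ennreal \<epsilon> + ennreal c0) * indicator \<Omega> x + ennreal c1 * frac_density s p UNIV w x \<partial>lebesgue)"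
    proof (rule nn_integral_mono_AE)
      show "AE x in lebesgue. ennreal \<bar>w x\<bar> \<le> (ennreal \<epsilon> + ennreal c0) * indicator \<Omega> x + ennreal c1 * frac_density s p UNIV w x"
        using W0_zero[OF w]
      proof eventually_elim
        case (elim x)
        show ?case
        proof (cases "x \<in> \<Omega>")
          case True
          then have "x \<in> closure \<Omega>" using closure_subset by blast
          then obtain c where cD: "c \<in> D" "x \<in> ball c r" using D(3) by blast
          have "ennreal \<bar>w x\<bar> \<le> ennreal \<epsilon> + ennreal c1 * frac_density s p UNIV w x +
              ennreal (1 / (\<omega> * r powr ?N) * \<bar>LINT y|lebesgue. indicator (ball c r) y * w y\<bar>)"
            unfolding c1_def \<omega>_def using w cD(2) r \<epsilon>(1) by (rule oscillation_on_ball)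
          also have "\<dots> \<le> ennreal \<epsilon> + ennreal c1 * frac_density s p UNIV w x + ennreal c0"
            unfolding c0_def
          proof (intro add_left_mono ennreal_leI mult_left_mono)
            show "\<bar>LINT y|lebesgue. indicator (ball c r) y * w y\<bar> \<le> ?S"
              using cD(1) D(2) by (intro member_le_sum) auto
          qed (use \<omega> r in simp)
          finally show ?thesis using True by (simp add: add_ac)
        qed (use elim in simp)
      qed
    qed
    also have "\<dots> = (ennreal \<epsilon> + ennreal c0) * ennreal vol + ennreal c1 * ennreal (energy s p w)"
    proof -
      have dm: "frac_density s p UNIV w \<in> borel_measurable lebesgue"
        using W0_measurable[OF w] by (intro frac_density_measurable) auto
      have "(\<integral>\<^sup>+x. ennreal c1 * frac_density s p UNIV w x \<partial>lebesgue) = ennreal c1 * ennreal (energy s p w)"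
        unfolding energy_density[OF w, symmetric] by (intro nn_integral_cmult dm)
      moreover have "(\<integral>\<^sup>+x. (ennreal \<epsilon> + ennreal c0) * indicator \<Omega> x \<partial>lebesgue) = (ennreal \<epsilon> + ennreal c0) * ennreal vol"
        unfolding vol(1)[symmetric] by (intro nn_integral_cmult_indicator dom_sets)
      moreover have "(\<integral>\<^sup>+x. (ennreal \<epsilon> + ennreal c0) * indicator \<Omega> x + ennreal c1 * frac_density s p UNIV w x \<partial>lebesgue) =
          (\<integral>\<^sup>+x. (ennreal \<epsilon> + ennreal c0) * indicator \<Omega> x \<partial>lebesgue) + (\<integral>\<^sup>+x. ennreal c1 * frac_density s p UNIV w x \<partial>lebesgue)"
        by (intro nn_integral_add borel_measurable_times_ennreal borel_measurable_const
            borel_measurable_indicator dm dom_sets)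
      ultimately show ?thesis by simp
    qed
    also have "\<dots> = ennreal ((\<epsilon> + c0) * vol + c1 * energy s p w)"
      using \<epsilon>(1) c vol(2) c1(1) by (simp add: ennreal_plus ennreal_mult)
    finally have "(LINT x|lebesgue. \<bar>w x\<bar>) \<le> (\<epsilon> + c0) * vol + c1 * energy s p w"
      using \<epsilon>(1) c vol(2) c1(1) by (subst (asm) ennreal_le_iff) auto
    also have "\<dots> \<le> (\<epsilon> + c0) * vol + c1 * (K + 1)"
      using e c1 by (intro add_left_mono mult_left_mono) auto
    also have "\<dots> = \<epsilon> * vol + C * ?S + \<eta> / 2"
      unfolding c1 by (simp add: C_def c0_def distrib_right)
    also have "\<dots> \<le> \<eta> + C * ?S" using \<epsilon> by simp
    finally show ?thesis .
  qed
  have "finite ?B" "?B \<subseteq> sets lebesgue" using D by auto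
  with C main show ?thesis by blast
qed

lemma energy_diff_le:
  assumes "u \<in> W0" "v \<in> W0"
  shows "energy s p (\<lambda>x. u x - v x) \<le> 2 powr p * (energy s p u + energy s p v)"
proof -
  have d: "(\<lambda>x. u x - v x) \<in> W0" using W0_lincomb[OF assms, of 1 "-1"] by simp
  have "energy s p (\<lambda>x. u x - v x) \<le>
     (LINT z|\<mu>. 2 powr p * (\<bar>increment u z\<bar> powr p + \<bar>increment v z\<bar> powr p))"
    unfolding energy_def
  proof (rule integral_mono)
    fix z :: "'a \<times> 'a"
    have eq: "increment (\<lambda>x. u x - v x) z = increment u z - increment v z" by simp
    show "\<bar>increment (\<lambda>x. u x - v x) z\<bar> powr p \<le> 2 powr p * (\<bar>increment u z\<bar> powr p + \<bar>increment v z\<bar> powr p)"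
      unfolding eq by (rule abs_diff_powr_le) (use p_pos in simp)
  qed (use W0_integrable(2)[OF d] W0_integrable(2)[OF assms(1)] W0_integrable(2)[OF assms(2)] in auto)
  also have "\<dots> = 2 powr p * (energy s p u + energy s p v)"
    using W0_integrable(2)[OF assms(1)] W0_integrable(2)[OF assms(2)] by (simp add: energy_def)
  finally show ?thesis .
qed

text \<open>Fatou's lemma, applied to the increments.\<close>

lemma AE_limit_in_W0:
  assumes u: "\<And>n. u n \<in> W0" and e: "\<And>n. energy s p (u n) \<le> K"
    and v[measurable]: "v \<in> borel_measurable lebesgue" and conv: "AE x in lebesgue. (\<lambda>n. u n x) \<longlonglongrightarrow> v x"
  shows "v \<in> W0 \<and> energy s p v \<le> K"
proof -
  have [measurable]: "u n \<in> borel_measurable lebesgue" for n using u by measurable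
  have F: "integrable \<mu> (\<lambda>z. \<bar>increment v z\<bar> powr p) \<and> (LINT z|\<mu>. \<bar>increment v z\<bar> powr p) \<le> K"
  proof (rule Fatou_bounded)
    show "integrable \<mu> (\<lambda>z. \<bar>increment (u n) z\<bar> powr p)" for n by (rule W0_integrable(2)[OF u])
    show "AE z in \<mu>. (\<lambda>n. \<bar>increment (u n) z\<bar> powr p) \<longlonglongrightarrow> \<bar>increment v z\<bar> powr p"
      using AE_lebesgue_imp_AE_fst_snd[OF conv]
      by eventually_elim (use p_pos in \<open>intro tendsto_powr2 tendsto_intros; auto\<close>)
    show "(LINT z|\<mu>. \<bar>increment (u n) z\<bar> powr p) \<le> K" for n using e[of n] by (simp add: energy_def)
  qed auto
  have "AE x in lebesgue. \<forall>n. x \<notin> \<Omega> \<longrightarrow> u n x = 0"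
    unfolding AE_all_countable using W0_zero[OF u] by blast
  with conv have "AE x in lebesgue. x \<notin> \<Omega> \<longrightarrow> v x = 0"
    by eventually_elim (auto intro: LIMSEQ_unique)
  then show ?thesis using F W0I[OF v] by (simp add: energy_def)
qed

text \<open>Rellich's theorem. A diagonal subsequence makes countably many averages converge, enough
  to apply the preceding inequality to all differences with every \<open>\<eta> = 1 / (j + 1)\<close>. The subsequence is
  therefore Cauchy in \<open>L\<^sup>1\<close>, and a further subsequence converges almost everywhere.\<close>

lemma W0_compact:
  assumes u: "\<And>n. u n \<in> W0" and e: "\<And>n. energy s p (u n) \<le> K"
  obtains r v where "strict_mono (r :: nat \<Rightarrow> nat)" "v \<in> W0" "AE x in lebesgue. (\<lambda>n. u (r n) x) \<longlonglongrightarrow> v x"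
proof -
  have um[measurable]: "u n \<in> borel_measurable lebesgue" for n using u by measurable
  have K: "K \<ge> 0" using e[of 0] energy_nonneg[of s p "u 0"] by linarith
  define K' where "K' = 2 powr p * (K + K)"
  have K': "K' \<ge> 0" using K by (simp add: K'_def)
  have d: "(\<lambda>x. u n x - u m x) \<in> W0" "energy s p (\<lambda>x. u n x - u m x) \<le> K'" for n m
  proof -
    show "(\<lambda>x. u n x - u m x) \<in> W0" using W0_lincomb[OF u u, of 1 n "-1" m] by simp
    have "energy s p (\<lambda>x. u n x - u m x) \<le> 2 powr p * (energy s p (u n) + energy s p (u m))"
      by (rule energy_diff_le[OF u u])
    also have "\<dots> \<le> K'" unfolding K'_def using e by (intro mult_left_mono add_mono) auto
    finally show "energy s p (\<lambda>x. u n x - u m x) \<le> K'" .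
  qed
  define Q where "Q j B C \<longleftrightarrow> finite B \<and> B \<subseteq> sets lebesgue \<and> C \<ge> 0 \<and> (\<forall>w\<in>W0. energy s p w \<le> K' \<longrightarrow>
     (LINT x|lebesgue. \<bar>w x\<bar>) \<le> 1 / Suc j + C * (\<Sum>b\<in>B. \<bar>LINT y|lebesgue. indicator b y * w y\<bar>))"
    for j :: nat and B :: "'a set set" and C :: real
  have "\<forall>j. \<exists>B C. Q j B C"
    unfolding Q_def using K' by (intro allI L1_by_finitely_many_averages) auto
  then obtain B C where Q: "\<And>j. Q j (B j) (C j)" by metis
  then have B: "\<And>j. finite (B j)" "\<And>j. B j \<subseteq> sets lebesgue" "\<And>j::nat. C j \<ge> 0"
    and BC: "\<And>j w. w \<in> W0 \<Longrightarrow> energy s p w \<le> K' \<Longrightarrow> (LINT x|lebesgue. \<bar>w x\<bar>) \<le>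
       1 / Suc j + C j * (\<Sum>b\<in>B j. \<bar>LINT y|lebesgue. indicator b y * w y\<bar>)"
    unfolding Q_def by blast+
  let ?f = "\<lambda>n b. LINT y|lebesgue. indicator b y * u n y"
  let ?S = "\<Union>j. B j"
  obtain P where P: "P \<ge> 0" "\<And>u. u \<in> W0 \<Longrightarrow> (LINT x|lebesgue. \<bar>u x\<bar> powr p) \<le> P * energy s p u"
    using W0_Lp_bound by blast
  have ib: "integrable lebesgue (\<lambda>y. indicator b y * u n y)" if "b \<in> sets lebesgue" for b n
    using W0_L1(1)[OF u[of n]] by (rule integrable_mult_indicator[OF that, of "u n", simplified])
  have bound: "norm (?f n b) \<le> vol + P * K" if "b \<in> ?S" for n b
  proof -
    have b: "b \<in> sets lebesgue" using that B(2) by blast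
    have "\<bar>?f n b\<bar> \<le> (LINT y|lebesgue. \<bar>indicator b y * u n y\<bar>)" by (rule integral_abs_bound)
    also have "\<dots> \<le> (LINT y|lebesgue. \<bar>u n y\<bar>)"
      using ib[OF b] W0_L1(1)[OF u] by (intro integral_mono) (auto simp: indicator_def)
    also have "\<dots> \<le> vol + (LINT x|lebesgue. \<bar>u n x\<bar> powr p)" by (rule W0_L1(2)[OF u])
    also have "\<dots> \<le> vol + P * energy s p (u n)" using P(2)[OF u] by simp
    also have "\<dots> \<le> vol + P * K" using e P(1) by (intro add_left_mono mult_left_mono)
    finally show ?thesis by simp
  qed
  have "countable ?S" using B(1) by (intro countable_UN) (auto intro: countable_finite)
  then obtain k where k: "strict_mono (k::nat\<Rightarrow>nat)" "\<And>b. b \<in> ?S \<Longrightarrow> \<exists>l. (\<lambda>n. ?f (k n) b) \<longlonglongrightarrow> l"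
    by (rule function_convergent_subsequence[of ?S ?f "vol + P * K"]) (use bound in blast)+
  obtain l where l: "\<And>b. b \<in> ?S \<Longrightarrow> (\<lambda>n. ?f (k n) b) \<longlonglongrightarrow> l b" using k(2) by metis
  have cauchy: "\<exists>N. \<forall>i\<ge>N. \<forall>j\<ge>N. (LINT x|lebesgue. norm (u (k i) x - u (k j) x)) < \<epsilon>" if \<epsilon>: "\<epsilon> > 0" for \<epsilon>
  proof -
    obtain j where j: "1 / Suc j < \<epsilon> / 2" using nat_approx_posE[of "\<epsilon> / 2"] \<epsilon> by auto
    have "(\<lambda>n. C j * (\<Sum>b\<in>B j. \<bar>?f (k n) b - l b\<bar>)) \<longlonglongrightarrow> C j * (\<Sum>b\<in>B j. \<bar>l b - l b\<bar>)"
      using l by (intro tendsto_intros) auto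
    then have "eventually (\<lambda>n. C j * (\<Sum>b\<in>B j. \<bar>?f (k n) b - l b\<bar>) < \<epsilon> / 4) sequentially"
      using \<epsilon> by (intro order_tendstoD(2)) auto
    then obtain N where N: "\<And>n. n \<ge> N \<Longrightarrow> C j * (\<Sum>b\<in>B j. \<bar>?f (k n) b - l b\<bar>) < \<epsilon> / 4"
      unfolding eventually_sequentially by blast
    have "(LINT x|lebesgue. \<bar>u (k n) x - u (k m) x\<bar>) < \<epsilon>" if "n \<ge> N" "m \<ge> N" for n m
    proof -
      have "(LINT x|lebesgue. \<bar>u (k n) x - u (k m) x\<bar>) \<le> 1 / Suc j +
          C j * (\<Sum>b\<in>B j. \<bar>LINT y|lebesgue. indicator b y * (u (k n) y - u (k m) y)\<bar>)"
        using BC[OF d] .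
      also have "(\<Sum>b\<in>B j. \<bar>LINT y|lebesgue. indicator b y * (u (k n) y - u (k m) y)\<bar>) \<le>
          (\<Sum>b\<in>B j. \<bar>?f (k n) b - l b\<bar> + \<bar>?f (k m) b - l b\<bar>)"
      proof (rule sum_mono)
        fix b assume "b \<in> B j"
        then have b: "b \<in> sets lebesgue" using B(2) by blast
        have "(LINT y|lebesgue. indicator b y * (u (k n) y - u (k m) y)) = ?f (k n) b - ?f (k m) b"
          using ib[OF b] by (simp add: right_diff_distrib)
        then show "\<bar>LINT y|lebesgue. indicator b y * (u (k n) y - u (k m) y)\<bar> \<le> \<bar>?f (k n) b - l b\<bar> + \<bar>?f (k m) b - l b\<bar>"
          by linarith
      qed
      finally have "(LINT x|lebesgue. \<bar>u (k n) x - u (k m) x\<bar>) \<le> 1 / Suc j +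
          (C j * (\<Sum>b\<in>B j. \<bar>?f (k n) b - l b\<bar>) + C j * (\<Sum>b\<in>B j. \<bar>?f (k m) b - l b\<bar>))"
        using B(3)[of j] by (simp add: sum.distrib distrib_left mult_left_mono)
      also have "\<dots> < \<epsilon>" using j N[OF that(1)] N[OF that(2)] by linarith
      finally show ?thesis .
    qed
    then show ?thesis by auto
  qed
  obtain r where r: "strict_mono r" "AE x in lebesgue. Cauchy (\<lambda>i. u (k (r i)) x)"
    using cauchy_L1_AE_cauchy_subseq[of lebesgue "\<lambda>n. u (k n)", OF W0_L1(1)[OF u] cauchy] by blast
  define v where "v x = lim (\<lambda>i. u (k (r i)) x)" for x
  have vm: "v \<in> borel_measurable lebesgue" unfolding v_def by measurable
  have conv: "AE x in lebesgue. (\<lambda>i. u (k (r i)) x) \<longlonglongrightarrow> v x"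
    using r(2) by eventually_elim (simp add: v_def Cauchy_convergent_iff convergent_LIMSEQ_iff)
  have "v \<in> W0" using AE_limit_in_W0[of "\<lambda>i. u (k (r i))" K v] u e vm conv by blast
  moreover have "strict_mono (\<lambda>i. k (r i))" using k(1) r(1) by (simp add: strict_mono_def)
  ultimately show thesis using that[of "\<lambda>i. k (r i)" v] conv by blast
qed

end

section \<open>Existence for bounded right-hand sides\<close>

text \<open>\<open>g x t\<close> is the limit of \<open>g x (\<lfloor>n t\<rfloor> / n)\<close>, in which the second argument takes countably many
  values.\<close>

lemma Caratheodory_measurable:
  fixes g :: "'b \<Rightarrow> real \<Rightarrow> real"
  assumes [measurable]: "\<And>t. (\<lambda>x. g x t) \<in> borel_measurable M"
    and cont: "\<And>x. continuous_on UNIV (g x)"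
  shows "(\<lambda>z. g (fst z) (snd z)) \<in> borel_measurable (M \<Otimes>\<^sub>M borel)"
proof (rule borel_measurable_LIMSEQ_real)
  let ?\<phi> = "\<lambda>n t. real_of_int \<lfloor>real (Suc n) * t\<rfloor> / real (Suc n)"
  fix z :: "'b \<times> real"
  have "(\<lambda>n. ?\<phi> n (snd z)) \<longlonglongrightarrow> snd z"
  proof (rule tendsto_sandwich[OF always_eventually always_eventually, rule_format])
    fix n
    define d where "d = real (Suc n)"
    have d: "d > 0" by (simp add: d_def)
    have "d * snd z - 1 \<le> real_of_int \<lfloor>d * snd z\<rfloor>" by linarith
    then have "(d * snd z - 1) / d \<le> real_of_int \<lfloor>d * snd z\<rfloor> / d" using d by (intro divide_right_mono) auto
    then show "snd z - 1 / real (Suc n) \<le> ?\<phi> n (snd z)"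
      unfolding d_def[symmetric] using d by (simp add: diff_divide_distrib)
    have "real_of_int \<lfloor>d * snd z\<rfloor> \<le> d * snd z" by linarith
    then show "?\<phi> n (snd z) \<le> snd z"
      unfolding d_def[symmetric] using d by (simp add: pos_divide_le_eq mult.commute)
  next
    have "(\<lambda>n. snd z - 1 / real (Suc n)) \<longlonglongrightarrow> snd z - 0"
      by (intro tendsto_diff tendsto_const LIMSEQ_Suc lim_1_over_n)
    then show "(\<lambda>n. snd z - 1 / real (Suc n)) \<longlonglongrightarrow> snd z" by simp
  qed simp
  moreover have "isCont (g (fst z)) (snd z)" using cont[of "fst z"] by (simp add: continuous_on_eq_continuous_at)
  ultimately show "(\<lambda>n. g (fst z) (?\<phi> n (snd z))) \<longlonglongrightarrow> g (fst z) (snd z)"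
    by (rule isCont_tendsto_compose[rotated])
next
  let ?\<phi> = "\<lambda>n t. real_of_int \<lfloor>real (Suc n) * t\<rfloor> / real (Suc n)"
  fix n
  show "(\<lambda>z. g (fst z) (?\<phi> n (snd z))) \<in> borel_measurable (M \<Otimes>\<^sub>M borel)"
  proof (rule measurable_compose_countable[where f = "\<lambda>i z. g (fst z) (real_of_int i / real (Suc n))"
        and g = "\<lambda>z. \<lfloor>real (Suc n) * snd z\<rfloor>"])
    show "(\<lambda>z. g (fst z) (real_of_int i / real (Suc n))) \<in> borel_measurable (M \<Otimes>\<^sub>M borel)" for i
      by measurable
    show "(\<lambda>z. \<lfloor>real (Suc n) * snd z\<rfloor>) \<in> M \<Otimes>\<^sub>M borel \<rightarrow>\<^sub>M count_space UNIV"
      by measurable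
  qed
qed

lemma Caratheodory_compose:
  fixes g :: "'b \<Rightarrow> real \<Rightarrow> real"
  assumes "\<And>t. (\<lambda>x. g x t) \<in> borel_measurable M" "\<And>x. continuous_on UNIV (g x)"
    and [measurable]: "u \<in> borel_measurable M"
  shows "(\<lambda>x. g x (u x)) \<in> borel_measurable M"
proof -
  have "(\<lambda>x. (x, u x)) \<in> M \<rightarrow>\<^sub>M (M \<Otimes>\<^sub>M borel)" by measurable
  from measurable_compose[OF this Caratheodory_measurable[OF assms(1,2)]] show ?thesis by simp
qed

text \<open>The primitive is an average of \<open>t g(x, \<theta> t)\<close> over \<open>\<theta> \<in> [0, 1]\<close>, whence its
  measurability along a function.\<close>

lemma Caratheodory_primitive:
  fixes g :: "'b \<Rightarrow> real \<Rightarrow> real"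
  assumes m: "\<And>t. (\<lambda>x. g x t) \<in> borel_measurable M" and cont: "\<And>x. continuous_on UNIV (g x)"
    and bound: "\<And>x t. \<bar>g x t\<bar> \<le> h x"
  obtains F where "\<And>x t. (F x has_real_derivative g x t) (at t)" "\<And>x. F x 0 = 0"
    "\<And>u. u \<in> borel_measurable M \<Longrightarrow> (\<lambda>x. F x (u x)) \<in> borel_measurable M"
    "\<And>x a b. \<bar>F x a - F x b\<bar> \<le> h x * \<bar>a - b\<bar>"
proof -
  have "\<exists>F. (\<forall>t. (F has_real_derivative g x t) (at t)) \<and> F 0 = 0" for x
  proof -
    have "\<exists>F. \<forall>t. -\<infinity> < ereal t \<longrightarrow> ereal t < \<infinity> \<longrightarrow> (F has_vector_derivative g x t) (at t)"
      using cont[of x] by (intro einterval_antiderivative) (auto simp: continuous_on_eq_continuous_at)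
    then obtain F where F: "\<And>t. (F has_real_derivative g x t) (at t)"
      by (auto simp: has_real_derivative_iff_has_vector_derivative)
    have "((\<lambda>t. F t - F 0) has_real_derivative g x t) (at t)" for t
      using F[of t] by (auto intro!: derivative_eq_intros)
    then show ?thesis by (intro exI[of _ "\<lambda>t. F t - F 0"]) auto
  qed
  then obtain F where F: "\<And>x t. (F x has_real_derivative g x t) (at t)" "\<And>x. F x 0 = 0" by metis
  show thesis
  proof (rule that[of F])
    fix u :: "'b \<Rightarrow> real" assume u[measurable]: "u \<in> borel_measurable M"
    have eq: "F x (u x) = (LINT \<theta>|lborel. (u x * g x (\<theta> * u x)) * indicator {0..1} \<theta>)" for x
    proof -
      have "(LINT \<theta>|lborel. (u x * g x (\<theta> * u x)) * indicator {0..1} \<theta>) = F x (1 * u x) - F x (0 * u x)"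
      proof (rule integral_FTC_Icc_real)
        fix \<theta> :: real
        have "((\<lambda>\<theta>. F x (\<theta> * u x)) has_real_derivative g x (\<theta> * u x) * u x) (at \<theta>)"
          by (rule DERIV_chain2[OF F(1)]) (auto intro!: derivative_eq_intros)
        then show "((\<lambda>\<theta>. F x (\<theta> * u x)) has_real_derivative u x * g x (\<theta> * u x)) (at \<theta>)"
          by (simp add: mult.commute)
        have "isCont (g x) (\<theta> * u x)" using cont[of x] by (simp add: continuous_on_eq_continuous_at)
        moreover have "isCont (\<lambda>\<theta>. \<theta> * u x) \<theta>" by (intro continuous_intros)
        ultimately have "isCont (\<lambda>\<theta>. g x (\<theta> * u x)) \<theta>" by (rule isCont_o2[rotated])
        then show "isCont (\<lambda>\<theta>. u x * g x (\<theta> * u x)) \<theta>" by (intro isCont_mult continuous_const)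
      qed simp
      then show ?thesis by (simp add: F(2))
    qed
    have "(\<lambda>z. (fst z, snd z * u (fst z))) \<in> (M \<Otimes>\<^sub>M lborel) \<rightarrow>\<^sub>M (M \<Otimes>\<^sub>M borel)" by measurable
    from measurable_compose[OF this Caratheodory_measurable[OF m cont]]
    have gm[measurable]: "(\<lambda>z. g (fst z) (snd z * u (fst z))) \<in> borel_measurable (M \<Otimes>\<^sub>M lborel)" by simp
    have "(\<lambda>x. LINT \<theta>|lborel. (u x * g x (\<theta> * u x)) * indicator {0..1} \<theta>) \<in> borel_measurable M"
    proof (rule lborel.borel_measurable_lebesgue_integral)
      have "(\<lambda>z. (u (fst z) * g (fst z) (snd z * u (fst z))) * indicator {0..1} (snd z)) \<in> borel_measurable (M \<Otimes>\<^sub>M lborel)"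
        using gm by measurable
      then show "(\<lambda>(x, \<theta>). (u x * g x (\<theta> * u x)) * indicator {0..1} \<theta>) \<in> borel_measurable (M \<Otimes>\<^sub>M lborel)"
        by (simp add: case_prod_unfold)
    qed
    then show "(\<lambda>x. F x (u x)) \<in> borel_measurable M" unfolding eq .
  next
    have le: "\<bar>F x b - F x a\<bar> \<le> h x * \<bar>b - a\<bar>" if ab: "a < b" for x a b
    proof -
      obtain z where "F x b - F x a = (b - a) * g x z" using MVT2[OF ab, of "F x" "g x"] F(1) by blast
      then have "\<bar>F x b - F x a\<bar> = \<bar>b - a\<bar> * \<bar>g x z\<bar>" by (simp add: abs_mult)
      also have "\<dots> \<le> \<bar>b - a\<bar> * h x" using bound by (intro mult_left_mono) auto
      finally show ?thesis by (simp add: mult.commute)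
    qed
    fix x a b
    show "\<bar>F x a - F x b\<bar> \<le> h x * \<bar>a - b\<bar>"
      using le[of a b x] le[of b a x] by (cases a b rule: linorder_cases) (auto simp: abs_minus_commute)
  qed (use F in auto)
qed

locale frac_subcritical = frac_dirichlet +
  fixes q :: real
  assumes p_s_less: "p * s < real DIM('a)"
    and p_less_q: "p < q" and q_subcritical: "q < critical_exponent (real DIM('a)) s p"
begin

lemma q_pos: "q > 1" "q > 0" "q \<ge> 0" "q \<ge> 1"
  using p_ge_2 p_less_q by auto

lemma W0_Lq_bound:
  assumes K: "K \<ge> 0"
  obtains C where "C \<ge> 0" "\<And>u. u \<in> W0 \<Longrightarrow> energy s p u \<le> K \<Longrightarrow>
     integrable lebesgue (\<lambda>x. \<bar>u x\<bar> powr q) \<and> (LINT x|lebesgue. \<bar>u x\<bar> powr q) \<le> C"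
proof -
  obtain P where P: "P \<ge> 0" "\<And>u. u \<in> W0 \<Longrightarrow> (LINT x|lebesgue. \<bar>u x\<bar> powr p) \<le> P * energy s p u"
    using W0_Lp_bound by blast
  define K' where "K' = K + P * K + 1"
  have PK: "P * K \<ge> 0" using P K by simp
  have K': "K' > 0" "K \<le> K'" "P * K \<le> K'" using K PK by (auto simp: K'_def)
  obtain C where C: "C \<ge> 0" and emb: "\<And>u. u \<in> borel_measurable lebesgue \<Longrightarrow>
     gagliardo s p UNIV u \<le> ennreal K' \<Longrightarrow>
     Lpow p UNIV u \<le> ennreal K' \<Longrightarrow>
     Lpow q \<Omega> u \<le> ennreal C"
    by (rule fractional_Sobolev_subcritical[OF s_pos p_pos(1) p_s_less q_pos(3) q_subcritical open_UNIV
          bounded_dom dom_sets zero_less_one subset_UNIV K'(1)]) (rule that)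
  show thesis
  proof (rule that[OF C])
    fix u assume u: "u \<in> W0" and e: "energy s p u \<le> K"
    have um: "u \<in> borel_measurable lebesgue" using u by measurable
    have g: "gagliardo s p UNIV u \<le> ennreal K'"
      unfolding gagliardo_eq_energy[OF W0_integrable(2)[OF u]] using e K'(2) by (intro ennreal_leI) simp
    have "Lpow p UNIV u = ennreal (LINT x|lebesgue. \<bar>u x\<bar> powr p)"
      using nn_integral_eq_integral[OF W0_integrable(1)[OF u]] by simp
    also have "\<dots> \<le> ennreal K'"
    proof (rule ennreal_leI)
      have "P * energy s p u \<le> P * K" using e P(1) by (rule mult_left_mono)
      then show "(LINT x|lebesgue. \<bar>u x\<bar> powr p) \<le> K'" using P(2)[OF u] K'(3) by linarith
    qed
    finally have l: "Lpow p UNIV u \<le> ennreal K'" .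
    have "(\<integral>\<^sup>+y. ennreal (\<bar>u y\<bar> powr q) \<partial>lebesgue) = Lpow q \<Omega> u"
    proof (rule nn_integral_cong_AE)
      show "AE y in lebesgue. ennreal (\<bar>u y\<bar> powr q) = ennreal (\<bar>u y\<bar> powr q) * indicator \<Omega> y"
        using W0_zero[OF u] by eventually_elim (auto simp: indicator_def)
    qed
    also have "\<dots> \<le> ennreal C" by (rule emb[OF um g l])
    finally have le: "(\<integral>\<^sup>+y. ennreal (\<bar>u y\<bar> powr q) \<partial>lebesgue) \<le> ennreal C" .
    have i: "integrable lebesgue (\<lambda>x. \<bar>u x\<bar> powr q)"
      unfolding integrable_powr_iff[OF um] by (rule le_less_trans[OF le]) simp
    moreover have "(LINT x|lebesgue. \<bar>u x\<bar> powr q) \<le> C"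
      using le C by (simp add: nn_integral_eq_integral[OF i])
    ultimately show "integrable lebesgue (\<lambda>x. \<bar>u x\<bar> powr q) \<and> (LINT x|lebesgue. \<bar>u x\<bar> powr q) \<le> C" ..
  qed
qed

lemma W0_Lq: "u \<in> W0 \<Longrightarrow> integrable lebesgue (\<lambda>x. \<bar>u x\<bar> powr q)"
  by (rule W0_Lq_bound[OF energy_nonneg[of s p u]]) blast

text \<open>The points of \<open>\<Omega>\<close> have a positive distance from the complement of \<open>U\<close>, so that the local
  embedding applies.\<close>

lemma Wt_Lq:
  assumes u: "u \<in> Wt"
  shows "integrable lebesgue (\<lambda>x. indicator \<Omega> x * \<bar>u x\<bar> powr q)"
proof -
  obtain U where um[measurable]: "u \<in> borel_measurable lebesgue" and U: "open U" "closure \<Omega> \<subseteq> U"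
    and gag: "gagliardo s p U u < \<infinity>" and Lp: "Lpow p U u < \<infinity>"
    using WtE[OF u] by metis
  obtain d where d: "d > 0" "\<And>x y. x \<in> \<Omega> \<Longrightarrow> y \<in> - U \<Longrightarrow> d \<le> dist x y"
    using separation[OF U] by blast
  have ball: "ball x d \<subseteq> U" if "x \<in> \<Omega>" for x using d(2)[OF that] by fastforce
  define K where "K = enn2real (gagliardo s p U u) + enn2real (Lpow p U u) + 1"
  have K: "K > 0" by (simp add: K_def add_nonneg_pos)
  have g: "gagliardo s p U u \<le> ennreal K"
  proof -
    have "gagliardo s p U u = ennreal (enn2real (gagliardo s p U u))" using gag by (simp add: less_top)
    also have "\<dots> \<le> ennreal K" by (intro ennreal_leI) (simp add: K_def)
    finally show ?thesis .
  qed
  have l: "Lpow p U u \<le> ennreal K"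
  proof -
    have "Lpow p U u = ennreal (enn2real (Lpow p U u))"
      using Lp by (simp add: less_top)
    also have "\<dots> \<le> ennreal K" by (intro ennreal_leI) (simp add: K_def)
    finally show ?thesis .
  qed
  obtain C where C: "C \<ge> 0" and emb: "\<And>u. u \<in> borel_measurable lebesgue \<Longrightarrow>
     gagliardo s p U u \<le> ennreal K \<Longrightarrow>
     Lpow p U u \<le> ennreal K \<Longrightarrow>
     Lpow q \<Omega> u \<le> ennreal C"
    by (rule fractional_Sobolev_subcritical[OF s_pos p_pos(1) p_s_less q_pos(3) q_subcritical U(1)
          bounded_dom dom_sets d(1) ball K]) (assumption, rule that)
  have "(\<integral>\<^sup>+y. ennreal (indicator \<Omega> y * \<bar>u y\<bar> powr q) \<partial>lebesgue) = Lpow q \<Omega> u"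
    by (intro nn_integral_cong) (auto simp: indicator_def)
  also have "\<dots> \<le> ennreal C" by (rule emb[OF um g l])
  also have "\<dots> < \<infinity>" by simp
  finally show ?thesis by (intro integrableI_bounded) (auto simp: indicator_def)
qed

definition q' :: real where "q' = q / (q - 1)"

text \<open>Young's inequality with the exponents \<open>q\<close> and \<open>q'\<close> makes every \<open>h\<close> of \<open>L\<^bsup>q'\<^esup>\<close> an admissible
  right-hand side.\<close>

lemma dual_pairing_integrable:
  assumes h: "integrable lebesgue (\<lambda>x. \<bar>h x\<bar> powr q')" "h \<in> borel_measurable lebesgue"
    and v: "v \<in> W0"
  shows "integrable lebesgue (\<lambda>x. h x * v x)"
    "(LINT x|lebesgue. \<bar>h x\<bar> * \<bar>v x\<bar>) \<le> (LINT x|lebesgue. \<bar>h x\<bar> powr q') + (LINT x|lebesgue. \<bar>v x\<bar> powr q)"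
proof -
  have [measurable]: "v \<in> borel_measurable lebesgue" "h \<in> borel_measurable lebesgue" using v h by measurable
  have le: "\<bar>h x\<bar> * \<bar>v x\<bar> \<le> \<bar>h x\<bar> powr q' + \<bar>v x\<bar> powr q" for x
    using Young_simple[OF q_pos(1), of "\<bar>v x\<bar>" "\<bar>h x\<bar>"] by (simp add: q'_def mult.commute)
  have i: "integrable lebesgue (\<lambda>x. \<bar>h x\<bar> powr q' + \<bar>v x\<bar> powr q)" using h W0_Lq[OF v] by simp
  show hv: "integrable lebesgue (\<lambda>x. h x * v x)"
    by (rule integrable_abs_bound[OF i]) (measurable, use le in \<open>simp add: abs_mult\<close>)
  have "integrable lebesgue (\<lambda>x. \<bar>h x\<bar> * \<bar>v x\<bar>)" using integrable_abs[OF hv] by (simp add: abs_mult)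
  then have "(LINT x|lebesgue. \<bar>h x\<bar> * \<bar>v x\<bar>) \<le> (LINT x|lebesgue. \<bar>h x\<bar> powr q' + \<bar>v x\<bar> powr q)"
    using i le by (intro integral_mono) auto
  then show "(LINT x|lebesgue. \<bar>h x\<bar> * \<bar>v x\<bar>) \<le> (LINT x|lebesgue. \<bar>h x\<bar> powr q') + (LINT x|lebesgue. \<bar>v x\<bar> powr q)"
    using h W0_Lq[OF v] by simp
qed

lemma energy_scale: "energy s p (\<lambda>x. c * u x) = \<bar>c\<bar> powr p * energy s p u"
proof -
  have "\<bar>increment (\<lambda>x. c * u x) z\<bar> powr p = \<bar>c\<bar> powr p * \<bar>increment u z\<bar> powr p" for z
    by (simp add: right_diff_distrib[symmetric] abs_mult powr_mult)
  then show ?thesis by (simp add: energy_def)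
qed

text \<open>Rescaling \<open>v\<close> by \<open>(1 + E)\<^bsup>-1/p\<^esup>\<close>, with \<open>E\<close> its energy, brings the energy below \<open>1\<close>, where the
  embedding gives a uniform bound. The summand \<open>1\<close> covers functions without energy.\<close>

lemma dual_pairing_sublinear:
  assumes h: "integrable lebesgue (\<lambda>x. \<bar>h x\<bar> powr q')" "h \<in> borel_measurable lebesgue"
  obtains C where "C \<ge> 0"
    "\<And>v. v \<in> W0 \<Longrightarrow> (LINT x|lebesgue. \<bar>h x\<bar> * \<bar>v x\<bar>) \<le> C * (1 + energy s p v) powr (1 / p)"
proof -
  obtain D where D: "D \<ge> 0" "\<And>u. u \<in> W0 \<Longrightarrow> energy s p u \<le> 1 \<Longrightarrow>
     integrable lebesgue (\<lambda>x. \<bar>u x\<bar> powr q) \<and> (LINT x|lebesgue. \<bar>u x\<bar> powr q) \<le> D"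
    by (rule W0_Lq_bound[OF zero_le_one]) (rule that)
  define C where "C = (LINT x|lebesgue. \<bar>h x\<bar> powr q') + D"
  have C: "C \<ge> 0" using D(1) by (simp add: C_def)
  show thesis
  proof (rule that[OF C])
    fix v assume v: "v \<in> W0"
    define E where "E = 1 + energy s p v"
    have E: "E \<ge> 1" "E > 0" using energy_nonneg[of s p v] unfolding E_def by linarith+
    define \<rho> where "\<rho> = E powr (1 / p)"
    have \<rho>: "\<rho> > 0" "\<rho> powr p = E" using E p_pos by (auto simp: \<rho>_def powr_powr)
    let ?w = "\<lambda>x. 1 / \<rho> * v x"
    have w: "?w \<in> W0" using W0_lincomb[OF v v, of "1 / \<rho>" 0] by simp
    have "energy s p ?w = energy s p v / E"
      using \<rho> by (subst energy_scale) (simp add: powr_divide)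
    also have "\<dots> \<le> 1" using E by (simp add: E_def)
    finally have "(LINT x|lebesgue. \<bar>?w x\<bar> powr q) \<le> D" using D(2)[OF w] by blast
    then have "(LINT x|lebesgue. \<bar>h x\<bar> * \<bar>?w x\<bar>) \<le> C"
      using dual_pairing_integrable(2)[OF h w] unfolding C_def by linarith
    moreover have "(LINT x|lebesgue. \<bar>h x\<bar> * \<bar>?w x\<bar>) = 1 / \<rho> * (LINT x|lebesgue. \<bar>h x\<bar> * \<bar>v x\<bar>)"
    proof -
      have "\<bar>h x\<bar> * \<bar>?w x\<bar> = 1 / \<rho> * (\<bar>h x\<bar> * \<bar>v x\<bar>)" for x using \<rho> by (simp add: abs_mult)
      then show ?thesis by (simp only: integral_mult_right_zero)
    qed
    ultimately show "(LINT x|lebesgue. \<bar>h x\<bar> * \<bar>v x\<bar>) \<le> C * (1 + energy s p v) powr (1 / p)"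
      using \<rho>(1) unfolding E_def[symmetric] \<rho>_def[symmetric] by (simp add: field_simps)
  qed
qed

text \<open>Direct method: the energy functional is coercive because the right-hand side acts sublinearly,
  minimising sequences converge almost everywhere by compactness, and the energy is lower
  semicontinuous under such convergence by Fatou's lemma.\<close>

lemma weak_solution_exists:
  fixes g :: "'a \<Rightarrow> real \<Rightarrow> real" and h :: "'a \<Rightarrow> real"
  assumes gm: "\<And>t. (\<lambda>x. g x t) \<in> borel_measurable lebesgue" and cont: "\<And>x. continuous_on UNIV (g x)"
    and bound: "\<And>x t. \<bar>g x t\<bar> \<le> h x"
    and h: "integrable lebesgue (\<lambda>x. \<bar>h x\<bar> powr q')" "h \<in> borel_measurable lebesgue"
  obtains u where "u \<in> W0"
    "\<And>\<phi>. \<phi> \<in> W0 \<Longrightarrow> frac_p_laplacian s p u \<phi> = (LINT x|lebesgue. g x (u x) * \<phi> x)"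
proof -
  have [measurable]: "h \<in> borel_measurable lebesgue" by (rule h(2))
  have h0: "h x \<ge> 0" for x using bound[of x 0] by linarith
  obtain F where F: "\<And>x t. (F x has_real_derivative g x t) (at t)" "\<And>x. F x 0 = 0"
    and Fm[measurable (raw)]: "\<And>u. u \<in> borel_measurable lebesgue \<Longrightarrow> (\<lambda>x. F x (u x)) \<in> borel_measurable lebesgue"
    and FL: "\<And>x a b. \<bar>F x a - F x b\<bar> \<le> h x * \<bar>a - b\<bar>"
    using Caratheodory_primitive[OF gm cont bound] by blast
  have gum: "(\<lambda>x. g x (u x)) \<in> borel_measurable lebesgue" if "u \<in> borel_measurable lebesgue" for u
    using gm cont that by (rule Caratheodory_compose)
  have hv: "integrable lebesgue (\<lambda>x. h x * \<bar>v x\<bar>)" if "v \<in> W0" for v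
    using integrable_abs[OF dual_pairing_integrable(1)[OF h that]] h0 by (simp add: abs_mult)
  have Fi: "integrable lebesgue (\<lambda>x. F x (v x))" if v: "v \<in> W0" for v
  proof (rule integrable_abs_bound[OF hv[OF v]])
    show "(\<lambda>x. F x (v x)) \<in> borel_measurable lebesgue" using v by (intro Fm W0_measurable)
    show "AE x in lebesgue. \<bar>F x (v x)\<bar> \<le> h x * \<bar>v x\<bar>" using FL[of _ "v _" 0] F(2) by simp
  qed
  define J where "J v = energy s p v / p - (LINT x|lebesgue. F x (v x))" for v
  obtain C where C: "C \<ge> 0"
    "\<And>v. v \<in> W0 \<Longrightarrow> (LINT x|lebesgue. \<bar>h x\<bar> * \<bar>v x\<bar>) \<le> C * (1 + energy s p v) powr (1 / p)"
    using dual_pairing_sublinear[OF h] by blast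
  define C' where "C' = (1 / (1 / (2 * p))) powr (1 / (p - 1))"
  have C': "a * b \<le> 1 / (2 * p) * a powr p + C' * b powr (p / (p - 1))" if "a \<ge> 0" "b \<ge> 0" for a b
    unfolding C'_def using that p_pos by (intro Young_weighted) auto
  define L where "L = 1 / (2 * p) + C' * C powr (p / (p - 1))"
  \<comment> \<open>coercivity: half of the energy absorbs the sublinear term\<close>
  have J_lower: "energy s p v / (2 * p) - L \<le> J v" if v: "v \<in> W0" for v
  proof -
    have "(LINT x|lebesgue. F x (v x)) \<le> (LINT x|lebesgue. h x * \<bar>v x\<bar>)"
      using Fi[OF v] hv[OF v] FL[of _ "v _" 0] F(2) by (intro integral_mono) (auto dest: abs_le_D1)
    also have "\<dots> \<le> C * (1 + energy s p v) powr (1 / p)"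
      using C(2)[OF v] h0 by simp
    also have "\<dots> = (1 + energy s p v) powr (1 / p) * C" by simp
    also have "\<dots> \<le> 1 / (2 * p) * ((1 + energy s p v) powr (1 / p)) powr p + C' * C powr (p / (p - 1))"
      using C(1) by (intro C') auto
    also have "((1 + energy s p v) powr (1 / p)) powr p = 1 + energy s p v"
      using p_pos energy_nonneg[of s p v] by (simp add: powr_powr)
    also have "1 / (2 * p) * (1 + energy s p v) + C' * C powr (p / (p - 1)) = energy s p v / (2 * p) + L"
      by (simp add: L_def distrib_left)
    finally have "(LINT x|lebesgue. F x (v x)) \<le> energy s p v / (2 * p) + L" .
    moreover have "energy s p v / p = energy s p v / (2 * p) + energy s p v / (2 * p)" by simp
    ultimately show ?thesis unfolding J_def by linarith
  qed
  have bdd: "bdd_below (J ` W0)"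
  proof (rule bdd_belowI2)
    show "- L \<le> J v" if "v \<in> W0" for v
    proof -
      have "energy s p v / (2 * p) \<ge> 0" using p_pos by simp
      then show ?thesis using J_lower[OF that] by linarith
    qed
  qed
  have ne: "W0 \<noteq> {}"
  proof -
    have "(\<lambda>_. 0) \<in> W0" by (simp add: W0_iff)
    then show ?thesis by blast
  qed
  define m where "m = Inf (J ` W0)"
  have "\<exists>v\<in>W0. J v < m + 1 / Suc n" for n
  proof -
    have "\<exists>y\<in>J ` W0. y < m + 1 / Suc n"
      by (rule cInf_lessD[of "J ` W0", folded m_def]) (use ne in auto)
    then show ?thesis by blast
  qed
  then obtain v where v: "\<And>n. v n \<in> W0" "\<And>n. J (v n) < m + 1 / Suc n" by metis
  define K where "K = 2 * p * (m + 1 + L)"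
  have eK: "energy s p (v n) \<le> K" for n
  proof -
    have "1 / real (Suc n) \<le> 1" by simp
    then have "energy s p (v n) / (2 * p) \<le> m + 1 + L" using J_lower[OF v(1)[of n]] v(2)[of n] by linarith
    then show ?thesis using p_pos by (simp add: K_def field_simps)
  qed
  have K: "K \<ge> 0" using eK[of 0] energy_nonneg[of s p "v 0"] by linarith
  obtain r u where r: "strict_mono (r :: nat \<Rightarrow> nat)" and u: "u \<in> W0"
    and conv: "AE x in lebesgue. (\<lambda>n. v (r n) x) \<longlonglongrightarrow> u x"
    using W0_compact[of v K, OF v(1) eK] by blast
  obtain D where D: "\<And>u. u \<in> W0 \<Longrightarrow> energy s p u \<le> K \<Longrightarrow>
     integrable lebesgue (\<lambda>x. \<bar>u x\<bar> powr q) \<and> (LINT x|lebesgue. \<bar>u x\<bar> powr q) \<le> D"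
    by (rule W0_Lq_bound[OF K]) (rule that)
  have "(\<lambda>n. LINT x|lebesgue. \<bar>v (r n) x - u x\<bar> * \<bar>h x\<bar>) \<longlonglongrightarrow> 0"
    using D[OF v(1) eK] h(1) unfolding q'_def
    by (intro AE_bounded_imp_weak_convergence(4)[OF q_pos(1) _ _ _ conv, where K = D])
      (auto intro: W0_measurable v(1) u)
  then have lim0: "(\<lambda>n. (LINT x|lebesgue. F x (v (r n) x)) - (LINT x|lebesgue. F x (u x))) \<longlonglongrightarrow> 0"
  proof (rule Lim_null_comparison[rotated], intro always_eventually allI)
    fix n
    have d: "(\<lambda>x. v (r n) x - u x) \<in> W0" using W0_lincomb[OF v(1) u, of 1 _ "-1"] by simp
    have "(LINT x|lebesgue. F x (v (r n) x)) - (LINT x|lebesgue. F x (u x)) =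
        (LINT x|lebesgue. F x (v (r n) x) - F x (u x))"
      using Fi[OF v(1)] Fi[OF u] by simp
    also have "\<bar>\<dots>\<bar> \<le> (LINT x|lebesgue. \<bar>F x (v (r n) x) - F x (u x)\<bar>)" by (rule integral_abs_bound)
    also have "\<dots> \<le> (LINT x|lebesgue. h x * \<bar>v (r n) x - u x\<bar>)"
      using Fi[OF v(1)] Fi[OF u] hv[OF d] FL by (intro integral_mono) auto
    finally show "norm ((LINT x|lebesgue. F x (v (r n) x)) - (LINT x|lebesgue. F x (u x))) \<le>
        (LINT x|lebesgue. \<bar>v (r n) x - u x\<bar> * \<bar>h x\<bar>)"
      using h0 by (simp add: mult.commute)
  qed
  \<comment> \<open>the tails of the subsequence bound the energy of the limit up to \<open>e\<close>\<close>
  have Ju: "J u \<le> m"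
  proof (rule field_le_epsilon)
    fix e :: real assume e: "e > 0"
    let ?IF = "LINT x|lebesgue. F x (u x)"
    have "(\<lambda>n. 1 / real (Suc n) + ((LINT x|lebesgue. F x (v (r n) x)) - ?IF)) \<longlonglongrightarrow> 0 + 0"
      by (intro tendsto_add lim0 LIMSEQ_Suc lim_1_over_n)
    then have "eventually (\<lambda>n. 1 / real (Suc n) + ((LINT x|lebesgue. F x (v (r n) x)) - ?IF) < e) sequentially"
      using e by (intro order_tendstoD(2)) auto
    then obtain n0 where n0: "\<And>n. n \<ge> n0 \<Longrightarrow> 1 / real (Suc n) + ((LINT x|lebesgue. F x (v (r n) x)) - ?IF) < e"
      unfolding eventually_sequentially by blast
    have "energy s p u \<le> p * (m + ?IF + e)"
    proof (rule AE_limit_in_W0[THEN conjunct2])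
      show "v (r (n + n0)) \<in> W0" for n by (rule v(1))
      show "energy s p (v (r (n + n0))) \<le> p * (m + ?IF + e)" for n
      proof -
        let ?k = "n + n0"
        have "?k \<le> r ?k" using r by (rule seq_suble)
        then have "1 / real (Suc (r ?k)) \<le> 1 / real (Suc ?k)" by (intro divide_left_mono) auto
        then have "energy s p (v (r ?k)) / p \<le> m + ?IF + e"
          using v(2)[of "r ?k"] n0[of ?k] unfolding J_def by linarith
        then show ?thesis using p_pos by (simp add: field_simps)
      qed
      show "u \<in> borel_measurable lebesgue" using u by measurable
      show "AE x in lebesgue. (\<lambda>n. v (r (n + n0)) x) \<longlonglongrightarrow> u x"
        using conv by eventually_elim (rule LIMSEQ_ignore_initial_segment)
    qed
    then show "J u \<le> m + e" unfolding J_def using p_pos by (simp add: field_simps)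
  qed
  have Jmin: "J u \<le> J w" if "w \<in> W0" for w
    using Ju cInf_lower[OF imageI[OF that] bdd] unfolding m_def by linarith
  \<comment> \<open>compare with \<open>u + t \<phi>\<close> and let \<open>t\<close> tend to \<open>0\<close>; the choice \<open>- \<phi>\<close> gives the opposite sign\<close>
  have variation: "0 \<le> frac_p_laplacian s p u \<phi> - (LINT x|lebesgue. g x (u x) * \<phi> x)" if \<phi>: "\<phi> \<in> W0" for \<phi>
  proof -
    define t where "t n = 1 / real (Suc n)" for n
    have t: "t n > 0" "t n \<le> 1" for n by (auto simp: t_def)
    have tlim: "t \<longlonglongrightarrow> 0" unfolding t_def by (intro LIMSEQ_Suc lim_1_over_n)
    define w where "w n x = u x + t n * \<phi> x" for n x
    have w: "w n \<in> W0" for n unfolding w_def using W0_lincomb[OF u \<phi>, of 1 "t n"] by simp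
    have [measurable]: "u \<in> borel_measurable lebesgue" "\<phi> \<in> borel_measurable lebesgue" "w n \<in> borel_measurable lebesgue" for n
      using u \<phi> w by measurable
    have inc: "increment (w n) z = increment u z + t n * increment \<phi> z" for n z
      by (simp add: w_def algebra_simps)
    let ?A = "\<lambda>n z. pflux p (increment (w n) z) * increment \<phi> z"
    let ?B = "\<lambda>n x. (F x (w n x) - F x (u x)) / t n"
    have Ai: "integrable \<mu> (?A n)" for n by (rule pairing_integrable[OF W0_subset_Wt[OF w] \<phi>])
    have ineq: "(LINT x|lebesgue. ?B n x) \<le> (LINT z|\<mu>. ?A n z)" for n
    proof -
      have "energy s p (w n) / p - energy s p u / p = (LINT z|\<mu>. \<bar>increment (w n) z\<bar> powr p / p - \<bar>increment u z\<bar> powr p / p)"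
        using W0_integrable(2)[OF w] W0_integrable(2)[OF u] by (simp add: energy_def)
      also have "\<dots> \<le> (LINT z|\<mu>. t n * ?A n z)"
      proof (rule integral_mono)
        fix z
        have "\<bar>increment (w n) z\<bar> powr p / p - \<bar>increment u z\<bar> powr p / p \<le>
            pflux p (increment (w n) z) * (increment (w n) z - increment u z)"
          by (rule powr_convex_tangent[OF p_pos(2)])
        also have "\<dots> = t n * ?A n z" unfolding inc by (simp add: mult_ac)
        finally show "\<bar>increment (w n) z\<bar> powr p / p - \<bar>increment u z\<bar> powr p / p \<le> t n * ?A n z" .
      qed (use W0_integrable(2)[OF w] W0_integrable(2)[OF u] Ai in auto)
      also have "\<dots> = t n * (LINT z|\<mu>. ?A n z)" by simp
      finally have "(LINT x|lebesgue. F x (w n x)) - (LINT x|lebesgue. F x (u x)) \<le> t n * (LINT z|\<mu>. ?A n z)"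
        using Jmin[OF w[of n]] unfolding J_def by linarith
      then have "((LINT x|lebesgue. F x (w n x)) - (LINT x|lebesgue. F x (u x))) / t n \<le> (LINT z|\<mu>. ?A n z)"
        using t by (simp add: field_simps)
      then show ?thesis using Fi[OF w] Fi[OF u] by simp
    qed
    have limA: "(\<lambda>n. LINT z|\<mu>. ?A n z) \<longlonglongrightarrow> (LINT z|\<mu>. pflux p (increment u z) * increment \<phi> z)"
    proof (rule integral_dominated_convergence)
      show "integrable \<mu> (\<lambda>z. 2 powr p * (\<bar>increment u z\<bar> powr p + \<bar>increment \<phi> z\<bar> powr p) + \<bar>increment \<phi> z\<bar> powr p)"
        using W0_integrable(2)[OF u] W0_integrable(2)[OF \<phi>] by simp
      show "AE z in \<mu>. (\<lambda>n. ?A n z) \<longlonglongrightarrow> pflux p (increment u z) * increment \<phi> z"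
      proof (intro AE_I2 tendsto_mult tendsto_const pflux_tendsto[OF p_pos(2)])
        fix z
        have "(\<lambda>n. increment u z + t n * increment \<phi> z) \<longlonglongrightarrow> increment u z + 0 * increment \<phi> z"
          by (intro tendsto_intros tlim)
        then show "(\<lambda>n. increment (w n) z) \<longlonglongrightarrow> increment u z" unfolding inc by simp
      qed
      show "AE z in \<mu>. norm (?A n z) \<le> 2 powr p * (\<bar>increment u z\<bar> powr p + \<bar>increment \<phi> z\<bar> powr p) + \<bar>increment \<phi> z\<bar> powr p" for n
      proof (intro AE_I2)
        fix z
        have "\<bar>?A n z\<bar> = \<bar>increment (w n) z\<bar> powr (p - 1) * \<bar>increment \<phi> z\<bar>"
          by (simp add: abs_mult abs_pflux)
        also have "\<dots> \<le> \<bar>increment (w n) z\<bar> powr p + \<bar>increment \<phi> z\<bar> powr p"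
          using p_pos by (intro powr_mult_le_sum) auto
        also have "\<bar>increment (w n) z\<bar> powr p \<le> 2 powr p * (\<bar>increment u z\<bar> powr p + \<bar>t n * increment \<phi> z\<bar> powr p)"
          unfolding inc using p_pos by (intro abs_add_powr_le) simp
        also have "\<bar>t n * increment \<phi> z\<bar> powr p \<le> \<bar>increment \<phi> z\<bar> powr p"
          using t[of n] p_pos by (intro powr_mono2) (auto simp: abs_mult mult_left_le_one_le)
        finally show "norm (?A n z) \<le> 2 powr p * (\<bar>increment u z\<bar> powr p + \<bar>increment \<phi> z\<bar> powr p) + \<bar>increment \<phi> z\<bar> powr p"
          by simp
      qed
      show "?A n \<in> borel_measurable \<mu>" for n by (rule borel_measurable_integrable[OF Ai])
      show "(\<lambda>z. pflux p (increment u z) * increment \<phi> z) \<in> borel_measurable \<mu>"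
        by (rule borel_measurable_integrable[OF pairing_integrable[OF W0_subset_Wt[OF u] \<phi>]])
    qed
    have limB: "(\<lambda>n. LINT x|lebesgue. ?B n x) \<longlonglongrightarrow> (LINT x|lebesgue. g x (u x) * \<phi> x)"
    proof (rule integral_dominated_convergence)
      show "integrable lebesgue (\<lambda>x. h x * \<bar>\<phi> x\<bar>)" by (rule hv[OF \<phi>])
      show "(\<lambda>x. g x (u x) * \<phi> x) \<in> borel_measurable lebesgue" using gum by measurable
      show "?B n \<in> borel_measurable lebesgue" for n by measurable
      show "AE x in lebesgue. (\<lambda>n. ?B n x) \<longlonglongrightarrow> g x (u x) * \<phi> x"
      proof (intro AE_I2)
        fix x
        have "((\<lambda>\<tau>. F x (u x + \<tau> * \<phi> x)) has_real_derivative g x (u x + 0 * \<phi> x) * \<phi> x) (at 0)"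
          by (rule DERIV_chain2[OF F(1)]) (auto intro!: derivative_eq_intros)
        then have *: "((\<lambda>\<tau>. (F x (u x + \<tau> * \<phi> x) - F x (u x)) / \<tau>) \<longlongrightarrow> g x (u x) * \<phi> x) (at 0)"
          by (simp add: DERIV_def)
        have "filterlim t (at 0) sequentially"
          using tlim t by (auto simp: filterlim_at less_imp_neq[THEN not_sym])
        from filterlim_compose[OF * this] show "(\<lambda>n. ?B n x) \<longlonglongrightarrow> g x (u x) * \<phi> x"
          by (simp add: w_def)
      qed
      show "AE x in lebesgue. norm (?B n x) \<le> h x * \<bar>\<phi> x\<bar>" for n
      proof (intro AE_I2)
        fix x
        have "\<bar>F x (w n x) - F x (u x)\<bar> \<le> h x * \<bar>w n x - u x\<bar>" by (rule FL)
        also have "\<dots> = h x * \<bar>\<phi> x\<bar> * t n" using t[of n] by (simp add: w_def abs_mult)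
        finally show "norm (?B n x) \<le> h x * \<bar>\<phi> x\<bar>" using t[of n] by (simp add: field_simps)
      qed
    qed
    have "(LINT x|lebesgue. g x (u x) * \<phi> x) \<le> (LINT z|\<mu>. pflux p (increment u z) * increment \<phi> z)"
      by (rule LIMSEQ_le[OF limB limA]) (use ineq in auto)
    then show ?thesis by (simp add: frac_p_laplacian_eq)
  qed
  show thesis
  proof (rule that[OF u])
    fix \<phi> assume \<phi>: "\<phi> \<in> W0"
    show "frac_p_laplacian s p u \<phi> = (LINT x|lebesgue. g x (u x) * \<phi> x)"
      using variation[OF \<phi>] variation[OF W0_minus[OF \<phi>]] by (simp add: frac_p_laplacian_minus_test)
  qed
qed

end

section \<open>Solutions between sub- and supersolutions\<close>

text \<open>A right-hand side that has its properties at every point and vanishes off \<open>\<Omega>\<close>. The general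
  case reduces to it by a change on a null set.\<close>

locale frac_problem = frac_subcritical +
  fixes f :: "'a \<Rightarrow> real \<Rightarrow> real" and c0 :: real
  assumes f_measurable: "\<And>t. (\<lambda>x. f x t) \<in> borel_measurable lebesgue"
    and f_continuous: "\<And>x. continuous_on UNIV (f x)"
    and f_outside: "\<And>x t. x \<notin> \<Omega> \<Longrightarrow> f x t = 0"
    and f_growth: "\<And>x t. \<bar>f x t\<bar> \<le> c0 * (1 + \<bar>t\<bar> powr (q - 1))"
begin

abbreviation "sol \<equiv> solution s p \<Omega> f"
abbreviation "subsol \<equiv> subsolution s p \<Omega> f"
abbreviation "supersol \<equiv> supersolution s p \<Omega> f"

lemma c0_nonneg: "c0 \<ge> 0"
  using f_growth[of undefined 0] q_pos p_less_q p_ge_2 by simp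

lemma set_integral_f: "(LINT x:\<Omega>|lebesgue. f x (u x) * v x) = (LINT x|lebesgue. f x (u x) * v x)"
  unfolding set_lebesgue_integral_def
  by (rule Bochner_Integration.integral_cong) (auto simp: indicator_def f_outside)

lemma f_compose_measurable:
  "u \<in> borel_measurable lebesgue \<Longrightarrow> (\<lambda>x. f x (u x)) \<in> borel_measurable lebesgue"
  by (rule Caratheodory_compose[OF f_measurable f_continuous])

lemma sol_iff: "sol u \<longleftrightarrow> u \<in> W0 \<and> (\<forall>v\<in>W0. frac_p_laplacian s p u v = (LINT x|lebesgue. f x (u x) * v x))"
  by (simp add: solution_def set_integral_f)

lemma sol_imp_super:
  assumes "sol u" shows "supersol u"
proof -
  have u: "u \<in> W0" and eq: "\<And>v. v \<in> W0 \<Longrightarrow> frac_p_laplacian s p u v = (LINT x|lebesgue. f x (u x) * v x)"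
    using assms by (auto simp: sol_iff)
  have "AE x in lebesgue. x \<in> - \<Omega> \<longrightarrow> 0 \<le> u x" using W0_zero[OF u] by eventually_elim auto
  then show ?thesis
    using W0_subset_Wt[OF u] eq by (auto simp: supersolution_def set_integral_f frac_sobolev0_nonneg_def)
qed

text \<open>Dominates \<open>f(x, t)\<close> for all \<open>\<bar>t\<bar> \<le> b x\<close>, and lies in the dual space \<open>L\<^bsup>q'\<^esup>\<close> if \<open>b\<close> is in
  \<open>L\<^sup>q(\<Omega>)\<close>, because \<open>(q - 1) q' = q\<close>.\<close>

definition envelope :: "('a \<Rightarrow> real) \<Rightarrow> 'a \<Rightarrow> real" where
  "envelope b x = indicator \<Omega> x * (c0 * (1 + b x powr (q - 1)))"

lemma envelope_nonneg: "envelope b x \<ge> 0"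
  using c0_nonneg by (simp add: envelope_def)

lemma f_le_envelope:
  assumes "\<bar>t\<bar> \<le> b x" shows "\<bar>f x t\<bar> \<le> envelope b x"
proof (cases "x \<in> \<Omega>")
  case True
  have "\<bar>f x t\<bar> \<le> c0 * (1 + \<bar>t\<bar> powr (q - 1))" by (rule f_growth)
  also have "\<dots> \<le> c0 * (1 + b x powr (q - 1))"
    using assms c0_nonneg q_pos by (intro mult_left_mono add_left_mono powr_mono2) auto
  finally show ?thesis using True by (simp add: envelope_def)
qed (simp add: f_outside envelope_def)

lemma envelope_measurable [measurable]:
  assumes [measurable]: "b \<in> borel_measurable lebesgue"
  shows "envelope b \<in> borel_measurable lebesgue"
  unfolding envelope_def by measurable

lemma envelope_dual:
  assumes [measurable]: "b \<in> borel_measurable lebesgue" and b0: "\<And>x. b x \<ge> 0"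
    and b: "integrable lebesgue (\<lambda>x. indicator \<Omega> x * b x powr q)"
  shows "integrable lebesgue (\<lambda>x. \<bar>envelope b x\<bar> powr q')"
proof (rule integrable_abs_bound)
  have q': "q' > 0" "(q - 1) * q' = q" using q_pos by (auto simp: q'_def)
  show "integrable lebesgue (\<lambda>x. c0 powr q' * (2 powr q' * (indicator \<Omega> x + indicator \<Omega> x * b x powr q)))"
    using b indicator_dom_integrable by simp
  show "AE x in lebesgue. \<bar>\<bar>envelope b x\<bar> powr q'\<bar> \<le>
      c0 powr q' * (2 powr q' * (indicator \<Omega> x + indicator \<Omega> x * b x powr q))"
  proof (intro AE_I2)
    fix x
    show "\<bar>\<bar>envelope b x\<bar> powr q'\<bar> \<le> c0 powr q' * (2 powr q' * (indicator \<Omega> x + indicator \<Omega> x * b x powr q))"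
    proof (cases "x \<in> \<Omega>")
      case True
      have "\<bar>envelope b x\<bar> powr q' = c0 powr q' * (1 + b x powr (q - 1)) powr q'"
        using True c0_nonneg by (simp add: envelope_def powr_mult)
      also have "\<dots> \<le> c0 powr q' * (2 powr q' * (1 powr q' + (b x powr (q - 1)) powr q'))"
        using q' by (intro mult_left_mono powr_sum_le) auto
      also have "(b x powr (q - 1)) powr q' = b x powr q" by (simp add: powr_powr q')
      finally show ?thesis using True by simp
    qed (simp add: envelope_def)
  qed
qed measurable

lemma Lq_on_domain_add:
  assumes "u \<in> borel_measurable lebesgue" "v \<in> borel_measurable lebesgue"
    and "integrable lebesgue (\<lambda>x. indicator \<Omega> x * \<bar>u x\<bar> powr q)"
      "integrable lebesgue (\<lambda>x. indicator \<Omega> x * \<bar>v x\<bar> powr q)"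
  shows "integrable lebesgue (\<lambda>x. indicator \<Omega> x * (\<bar>u x\<bar> + \<bar>v x\<bar>) powr q)"
proof (rule integrable_abs_bound)
  show "integrable lebesgue (\<lambda>x. 2 powr q * (indicator \<Omega> x * \<bar>u x\<bar> powr q + indicator \<Omega> x * \<bar>v x\<bar> powr q))"
    using assms by simp
  show "AE x in lebesgue. \<bar>indicator \<Omega> x * (\<bar>u x\<bar> + \<bar>v x\<bar>) powr q\<bar> \<le>
     2 powr q * (indicator \<Omega> x * \<bar>u x\<bar> powr q + indicator \<Omega> x * \<bar>v x\<bar> powr q)"
    using powr_sum_le[of "\<bar>u _\<bar>" "\<bar>v _\<bar>" q] q_pos by (intro AE_I2) (auto simp: indicator_def)
qed (use assms in measurable)

text \<open>Truncating \<open>f\<close> at \<open>lu\<close> and at \<open>min(u\<^sub>1, u\<^sub>2)\<close> makes it bounded, but comparison with the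
  minimum would require the minimum to be a supersolution. Instead the distance of the truncation at
  the minimum to the truncation at each \<open>u\<^sub>i\<close> is subtracted. Above \<open>u\<^sub>i\<close> the resulting \<open>g\<close> lies below
  \<open>f(x, u\<^sub>i)\<close>, whichever of the two functions is smaller there, so the solution of the truncated problem
  is compared with \<open>u\<^sub>1\<close> and \<open>u\<^sub>2\<close> separately. Below \<open>lu\<close> all truncations agree and \<open>g = f(x, lu)\<close>,
  and between the bounds \<open>g = f\<close>.\<close>

lemma solution_between:
  assumes lu: "subsol lu" and u1: "supersol u1" and u2: "supersol u2"
    and le: "AE x in lebesgue. x \<in> \<Omega> \<longrightarrow> lu x \<le> u1 x" "AE x in lebesgue. x \<in> \<Omega> \<longrightarrow> lu x \<le> u2 x"
  obtains u where "sol u" "AE x in lebesgue. lu x \<le> u x" "AE x in lebesgue. u x \<le> u1 x"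
    "AE x in lebesgue. u x \<le> u2 x"
proof -
  have Wt: "lu \<in> Wt" "u1 \<in> Wt" "u2 \<in> Wt"
    using lu u1 u2 by (auto simp: subsolution_def supersolution_def)
  have [measurable]: "lu \<in> borel_measurable lebesgue" "u1 \<in> borel_measurable lebesgue" "u2 \<in> borel_measurable lebesgue"
    using Wt by (auto intro: Wt_measurable)
  define T where "T w x t = max (lu x) (min t (w x))" for w :: "'a \<Rightarrow> real" and x t
  define w where "w x = min (u1 x) (u2 x)" for x
  define g where "g x t = f x (T w x t) - \<bar>f x (T u1 x t) - f x (T w x t)\<bar> - \<bar>f x (T u2 x t) - f x (T w x t)\<bar>" for x t
  define b where "b x = \<bar>\<bar>lu x\<bar> + \<bar>u1 x\<bar>\<bar> + \<bar>u2 x\<bar>" for x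
  have [measurable]: "w \<in> borel_measurable lebesgue" "b \<in> borel_measurable lebesgue"
    unfolding w_def b_def by measurable
  have b0: "b x \<ge> 0" for x by (simp add: b_def)
  have bq: "integrable lebesgue (\<lambda>x. indicator \<Omega> x * b x powr q)"
    unfolding b_def
    by (intro Lq_on_domain_add) (use Lq_on_domain_add[OF _ _ Wt_Lq[OF Wt(1)] Wt_Lq[OF Wt(2)]] Wt_Lq[OF Wt(3)] in \<open>simp_all\<close>)
  have Tb: "\<bar>T w x t\<bar> \<le> b x" "\<bar>T u1 x t\<bar> \<le> b x" "\<bar>T u2 x t\<bar> \<le> b x" for x t
    by (auto simp: T_def w_def b_def max_def min_def)
  have ub: "\<bar>lu x\<bar> \<le> b x" "\<bar>u1 x\<bar> \<le> b x" "\<bar>u2 x\<bar> \<le> b x" for x by (auto simp: b_def)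
  define h where "h x = 5 * envelope b x" for x
  have hm[measurable]: "h \<in> borel_measurable lebesgue" unfolding h_def by measurable
  have h: "integrable lebesgue (\<lambda>x. \<bar>h x\<bar> powr q')"
    using envelope_dual[OF _ b0 bq] by (simp add: h_def abs_mult powr_mult)
  have Tm: "(\<lambda>x. T w x t) \<in> borel_measurable lebesgue" if "w \<in> borel_measurable lebesgue" for w t
    unfolding T_def using that by measurable
  have gm: "(\<lambda>x. g x t) \<in> borel_measurable lebesgue" for t
    unfolding g_def by (intro borel_measurable_diff borel_measurable_abs f_compose_measurable Tm) measurable
  have Tc: "continuous_on UNIV (T w x)" for w x
    unfolding T_def by (intro continuous_intros)
  have fTc: "continuous_on UNIV (\<lambda>t. f x (T w x t))" for w x
    by (rule continuous_on_compose2[OF f_continuous Tc]) auto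
  have gc: "continuous_on UNIV (g x)" for x
    unfolding g_def[abs_def] by (intro continuous_intros fTc)
  have gb: "\<bar>g x t\<bar> \<le> h x" for x t
    using f_le_envelope[where b=b, OF Tb(1)[of x t]] f_le_envelope[where b=b, OF Tb(2)[of x t]] f_le_envelope[where b=b, OF Tb(3)[of x t]]
    unfolding g_def h_def by linarith
  obtain u where u: "u \<in> W0" and eq: "\<And>\<phi>. \<phi> \<in> W0 \<Longrightarrow> frac_p_laplacian s p u \<phi> = (LINT x|lebesgue. g x (u x) * \<phi> x)"
    using weak_solution_exists[OF gm gc gb h hm] by blast
  have um[measurable]: "u \<in> borel_measurable lebesgue" using u by measurable
  have gu[measurable]: "(\<lambda>x. g x (u x)) \<in> borel_measurable lebesgue" by (rule Caratheodory_compose[OF gm gc um])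
  have gi: "integrable lebesgue (\<lambda>x. g x (u x) * \<phi> x)" if \<phi>: "\<phi> \<in> W0" for \<phi>
  proof (rule integrable_abs_bound)
    show "integrable lebesgue (\<lambda>x. \<bar>h x * \<phi> x\<bar>)" using dual_pairing_integrable(1)[OF h hm \<phi>] by (rule integrable_abs)
    show "(\<lambda>x. g x (u x) * \<phi> x) \<in> borel_measurable lebesgue" using W0_measurable[OF \<phi>] by measurable
    show "AE x in lebesgue. \<bar>g x (u x) * \<phi> x\<bar> \<le> \<bar>h x * \<phi> x\<bar>"
    proof (intro AE_I2)
      fix x
      have "\<bar>g x (u x)\<bar> \<le> \<bar>h x\<bar>" using gb[of x "u x"] by linarith
      then show "\<bar>g x (u x) * \<phi> x\<bar> \<le> \<bar>h x * \<phi> x\<bar>" by (simp add: abs_mult mult_right_mono)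
    qed
  qed
  have fi: "integrable lebesgue (\<lambda>x. f x (v x) * \<phi> x)"
    if \<phi>: "\<phi> \<in> W0" and vm: "v \<in> borel_measurable lebesgue" and v: "\<And>x. \<bar>v x\<bar> \<le> b x" for \<phi> v
  proof (rule integrable_abs_bound)
    show "integrable lebesgue (\<lambda>x. \<bar>h x * \<phi> x\<bar>)" using dual_pairing_integrable(1)[OF h hm \<phi>] by (rule integrable_abs)
    show "(\<lambda>x. f x (v x) * \<phi> x) \<in> borel_measurable lebesgue"
      using W0_measurable[OF \<phi>] f_compose_measurable[OF vm] by measurable
    have "\<bar>f x (v x)\<bar> \<le> \<bar>h x\<bar>" for x
      using f_le_envelope[where b=b, OF v[of x]] envelope_nonneg[of b x] unfolding h_def by simp
    then show "AE x in lebesgue. \<bar>f x (v x) * \<phi> x\<bar> \<le> \<bar>h x * \<phi> x\<bar>"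
      by (intro AE_I2) (auto simp: abs_mult intro!: mult_right_mono)
  qed
  have lower: "AE x in lebesgue. lu x \<le> u x"
  proof -
    have out: "AE x in lebesgue. x \<notin> \<Omega> \<longrightarrow> 0 \<le> - lu x"
      using lu by (auto simp: subsolution_def elim: eventually_mono)
    let ?v = "\<lambda>x. max 0 (- u x - - lu x)"
    have v: "?v \<in> W0" by (rule truncation_in_W0[OF W0_minus[OF u] Wt_minus[OF Wt(1)] out])
    have "frac_p_laplacian s p lu ?v \<le> (LINT x|lebesgue. f x (lu x) * ?v x)"
      using lu v by (auto simp: subsolution_def set_integral_f frac_sobolev0_nonneg_def)
    also have "\<dots> = (LINT x|lebesgue. g x (u x) * ?v x)"
    proof (rule Bochner_Integration.integral_cong[OF refl])
      fix x
      show "f x (lu x) * ?v x = g x (u x) * ?v x"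
      proof (cases "u x < lu x")
        case True
        then have "T w x (u x) = lu x" "T u1 x (u x) = lu x" "T u2 x (u x) = lu x"
          by (auto simp: T_def max_def min_def)
        then show ?thesis by (simp add: g_def)
      qed auto
    qed
    also have "\<dots> = frac_p_laplacian s p u ?v" by (rule eq[OF v, symmetric])
    finally have "AE x in lebesgue. - u x \<le> - lu x"
      by (intro comparison[OF W0_minus[OF u] Wt_minus[OF Wt(1)] out]) (simp add: frac_p_laplacian_minus)
    then show ?thesis by simp
  qed
  have upper: "AE x in lebesgue. u x \<le> v x"
    if v: "supersol v" and le: "AE x in lebesgue. x \<in> \<Omega> \<longrightarrow> lu x \<le> v x" and vb: "\<And>x. \<bar>v x\<bar> \<le> b x"
      and g_le: "\<And>x. lu x \<le> v x \<Longrightarrow> v x < u x \<Longrightarrow> g x (u x) \<le> f x (v x)" for v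
  proof -
    have vt: "v \<in> Wt" using v by (simp add: supersolution_def)
    have out: "AE x in lebesgue. x \<notin> \<Omega> \<longrightarrow> 0 \<le> v x"
      using v by (auto simp: supersolution_def elim: eventually_mono)
    let ?v = "\<lambda>x. max 0 (u x - v x)"
    have vW: "?v \<in> W0" by (rule truncation_in_W0[OF u vt out])
    have "frac_p_laplacian s p u ?v = (LINT x|lebesgue. g x (u x) * ?v x)" by (rule eq[OF vW])
    also have "\<dots> \<le> (LINT x|lebesgue. f x (v x) * ?v x)"
    proof (rule integral_mono_AE[OF gi[OF vW] fi[OF vW Wt_measurable[OF vt] vb]])
      show "AE x in lebesgue. g x (u x) * ?v x \<le> f x (v x) * ?v x"
        using le W0_zero[OF vW]
      proof eventually_elim
        case (elim x)
        show ?case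
        proof (cases "x \<in> \<Omega> \<and> v x < u x")
          case True
          then show ?thesis using g_le[of x] elim by (intro mult_right_mono) auto
        next
          case False
          then have "?v x = 0" using elim by auto
          then show ?thesis by simp
        qed
      qed
    qed
    also have "\<dots> \<le> frac_p_laplacian s p v ?v"
      using v vW by (auto simp: supersolution_def set_integral_f frac_sobolev0_nonneg_def)
    finally show ?thesis by (rule comparison[OF u vt out])
  qed
  have up1: "AE x in lebesgue. u x \<le> u1 x"
  proof (rule upper[OF u1 le(1) ub(2)])
    fix x assume "lu x \<le> u1 x" "u1 x < u x"
    then have T: "T u1 x (u x) = u1 x" by (simp add: T_def)
    show "g x (u x) \<le> f x (u1 x)" unfolding g_def T by linarith
  qed
  have up2: "AE x in lebesgue. u x \<le> u2 x"
  proof (rule upper[OF u2 le(2) ub(3)])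
    fix x assume "lu x \<le> u2 x" "u2 x < u x"
    then have T: "T u2 x (u x) = u2 x" by (simp add: T_def)
    show "g x (u x) \<le> f x (u2 x)" unfolding g_def T by linarith
  qed
  have "sol u" unfolding sol_iff
  proof (intro conjI ballI u)
    fix \<phi> assume \<phi>: "\<phi> \<in> W0"
    have [measurable]: "\<phi> \<in> borel_measurable lebesgue" using \<phi> by measurable
    have "(LINT x|lebesgue. g x (u x) * \<phi> x) = (LINT x|lebesgue. f x (u x) * \<phi> x)"
    proof (rule integral_cong_AE)
      show "(\<lambda>x. f x (u x) * \<phi> x) \<in> borel_measurable lebesgue"
        using f_compose_measurable[OF um] by measurable
      show "AE x in lebesgue. g x (u x) * \<phi> x = f x (u x) * \<phi> x"
        using lower up1 up2
      proof eventually_elim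
        case (elim x)
        then have "T w x (u x) = u x" "T u1 x (u x) = u x" "T u2 x (u x) = u x"
          by (auto simp: T_def w_def)
        then show ?case by (simp add: g_def)
      qed
    qed measurable
    then show "frac_p_laplacian s p u \<phi> = (LINT x|lebesgue. f x (u x) * \<phi> x)" using eq[OF \<phi>] by simp
  qed
  then show thesis using that lower up1 up2 by blast
qed

section \<open>Extremal solutions\<close>

lemma solution_set_iff:
  "u \<in> solution_set s p \<Omega> f lu uu \<longleftrightarrow> sol u \<and> (AE x in lebesgue. lu x \<le> u x) \<and> (AE x in lebesgue. u x \<le> uu x)"
  by (auto simp: solution_set_def sol_iff)

text \<open>Testing the equation of \<open>w\<^sub>n\<close> with \<open>w\<^sub>n\<close> itself bounds the energies. The fluxes are then bounded
  in \<open>L\<close> to the conjugate exponent of \<open>p\<close> and converge almost everywhere, hence weakly, while the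
  right-hand sides are dominated by the envelope.\<close>

lemma solution_set_closed:
  assumes lu: "lu \<in> Wt" and uu: "uu \<in> Wt"
    and w: "\<And>n. w n \<in> solution_set s p \<Omega> f lu uu"
    and u[measurable]: "u \<in> borel_measurable lebesgue" and conv: "AE x in lebesgue. (\<lambda>n. w n x) \<longlonglongrightarrow> u x"
  shows "u \<in> solution_set s p \<Omega> f lu uu"
proof -
  define b where "b x = \<bar>lu x\<bar> + \<bar>uu x\<bar>" for x
  have [measurable]: "lu \<in> borel_measurable lebesgue" "uu \<in> borel_measurable lebesgue"
    using lu uu by (auto intro: Wt_measurable)
  have bm[measurable]: "b \<in> borel_measurable lebesgue" unfolding b_def by measurable
  have b0: "b x \<ge> 0" for x by (simp add: b_def)
  have bq: "integrable lebesgue (\<lambda>x. indicator \<Omega> x * b x powr q)"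
    unfolding b_def by (rule Lq_on_domain_add[OF _ _ Wt_Lq[OF lu] Wt_Lq[OF uu]]) measurable
  let ?h = "envelope b"
  have hm[measurable]: "?h \<in> borel_measurable lebesgue" by measurable
  have h: "integrable lebesgue (\<lambda>x. \<bar>?h x\<bar> powr q')" by (rule envelope_dual[OF bm b0 bq])
  have wsol: "w n \<in> W0" "\<And>v. v \<in> W0 \<Longrightarrow> frac_p_laplacian s p (w n) v = (LINT x|lebesgue. f x (w n x) * v x)" for n
    using w by (auto simp: solution_set_iff sol_iff)
  have [measurable]: "w n \<in> borel_measurable lebesgue" for n using wsol(1) by measurable
  have between: "AE x in lebesgue. \<forall>n. lu x \<le> w n x \<and> w n x \<le> uu x"
    unfolding AE_all_countable using w by (auto simp: solution_set_iff)
  have wb: "AE x in lebesgue. \<forall>n. \<bar>w n x\<bar> \<le> b x"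
    using between
  proof eventually_elim
    case (elim x)
    have "\<bar>w n x\<bar> \<le> b x" for n using spec[OF elim, of n] unfolding b_def by linarith
    then show ?case ..
  qed
  have fw: "AE x in lebesgue. \<forall>n. \<bar>f x (w n x)\<bar> \<le> ?h x"
    using wb by eventually_elim (auto intro: f_le_envelope)
  define K where "K = (LINT x|lebesgue. \<bar>?h x\<bar> powr q' + indicator \<Omega> x * b x powr q)"
  have energy_w: "energy s p (w n) \<le> K" for n
  proof -
    have "energy s p (w n) = frac_p_laplacian s p (w n) (w n)"
      unfolding energy_def frac_p_laplacian_eq using p_pos by (simp add: pflux_times_self)
    also have "\<dots> = (LINT x|lebesgue. f x (w n x) * w n x)" by (rule wsol(2)[OF wsol(1)])
    also have "\<dots> \<le> K"
      unfolding K_def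
    proof (rule integral_mono_AE')
      show "integrable lebesgue (\<lambda>x. \<bar>?h x\<bar> powr q' + indicator \<Omega> x * b x powr q)" using h bq by simp
      show "AE x in lebesgue. f x (w n x) * w n x \<le> \<bar>?h x\<bar> powr q' + indicator \<Omega> x * b x powr q"
        using fw wb
      proof eventually_elim
        case (elim x)
        show ?case
        proof (cases "x \<in> \<Omega>")
          case True
          have "f x (w n x) * w n x \<le> \<bar>w n x\<bar> * \<bar>f x (w n x)\<bar>" by (metis abs_ge_self abs_mult mult.commute)
          also have "\<dots> \<le> b x * \<bar>?h x\<bar>"
            using elim envelope_nonneg[of b x] b0 by (intro mult_mono) auto
          also have "\<dots> \<le> b x powr q + \<bar>?h x\<bar> powr q'"
            unfolding q'_def using b0 by (intro Young_simple q_pos) auto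
          finally show ?thesis using True by simp
        qed (simp add: f_outside)
      qed
    qed (use b0 in auto)
    finally show ?thesis .
  qed
  have uW: "u \<in> W0" using AE_limit_in_W0[OF wsol(1) energy_w u conv] by blast
  have "frac_p_laplacian s p u \<phi> = (LINT x|lebesgue. f x (u x) * \<phi> x)" if \<phi>: "\<phi> \<in> W0" for \<phi>
  proof -
    have [measurable]: "\<phi> \<in> borel_measurable lebesgue" using \<phi> by measurable
    \<comment> \<open>\<open>p / (p - 1)\<close> and \<open>p\<close> are conjugate, in the form that the lemma on weak convergence uses\<close>
    have pp: "(p - 1) * (p / (p - 1)) = p" "p / (p - 1) / (p / (p - 1) - 1) = p" "p / (p - 1) > 1"
      using p_pos by (auto simp: field_simps)
    have pw: "\<bar>pflux p t\<bar> powr (p / (p - 1)) = \<bar>t\<bar> powr p" for t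
      unfolding abs_pflux powr_powr pp ..
    have lhs: "(\<lambda>n. LINT z|\<mu>. pflux p (increment (w n) z) * increment \<phi> z) \<longlonglongrightarrow>
        (LINT z|\<mu>. pflux p (increment u z) * increment \<phi> z)"
    proof (rule AE_bounded_imp_weak_convergence(5)[OF pp(3), where K = K])
      show "AE z in \<mu>. (\<lambda>n. pflux p (increment (w n) z)) \<longlonglongrightarrow> pflux p (increment u z)"
        using AE_lebesgue_imp_AE_fst_snd[OF conv]
        by eventually_elim (auto intro!: pflux_tendsto p_pos tendsto_diff)
      show "integrable \<mu> (\<lambda>z. \<bar>pflux p (increment (w n) z)\<bar> powr (p / (p - 1)))" for n
        unfolding pw by (rule W0_integrable(2)[OF wsol(1)])
      show "(LINT z|\<mu>. \<bar>pflux p (increment (w n) z)\<bar> powr (p / (p - 1))) \<le> K" for n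
        unfolding pw using energy_w[of n] by (simp add: energy_def)
      show "integrable \<mu> (\<lambda>z. \<bar>increment \<phi> z\<bar> powr (p / (p - 1) / (p / (p - 1) - 1)))"
        unfolding pp by (rule W0_integrable(2)[OF \<phi>])
    qed measurable
    have rhs: "(\<lambda>n. LINT x|lebesgue. f x (w n x) * \<phi> x) \<longlonglongrightarrow> (LINT x|lebesgue. f x (u x) * \<phi> x)"
    proof (rule integral_dominated_convergence)
      show "integrable lebesgue (\<lambda>x. \<bar>?h x * \<phi> x\<bar>)"
        using dual_pairing_integrable(1)[OF h hm \<phi>] by (rule integrable_abs)
      show "AE x in lebesgue. (\<lambda>n. f x (w n x) * \<phi> x) \<longlonglongrightarrow> f x (u x) * \<phi> x"
        using conv
      proof eventually_elim
        case (elim x)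
        have "isCont (f x) (u x)" using f_continuous[of x] by (simp add: continuous_on_eq_continuous_at)
        from isCont_tendsto_compose[OF this elim] show ?case by (intro tendsto_mult tendsto_const)
      qed
      show "AE x in lebesgue. norm (f x (w n x) * \<phi> x) \<le> \<bar>?h x * \<phi> x\<bar>" for n
        using fw
      proof eventually_elim
        case (elim x)
        have "\<bar>f x (w n x)\<bar> \<le> \<bar>?h x\<bar>" using spec[OF elim, of n] by linarith
        then show ?case by (simp add: abs_mult mult_right_mono)
      qed
    qed (use f_compose_measurable in measurable)
    show ?thesis
      using LIMSEQ_unique[OF lhs] rhs wsol(2)[OF \<phi>] unfolding frac_p_laplacian_eq by simp
  qed
  moreover have "AE x in lebesgue. lu x \<le> u x \<and> u x \<le> uu x"
    using between conv by eventually_elim (auto intro: LIMSEQ_le_const LIMSEQ_le_const2)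
  ultimately show ?thesis using uW by (auto simp: solution_set_iff sol_iff)
qed

text \<open>Two solutions are supersolutions, so that there is a solution below both: the set is directed.
  Along a decreasing sequence whose integrals tend to their infimum \<open>m\<close> over all solutions, the limit
  \<open>u\<^sub>0\<close> is a solution of integral \<open>m\<close>. A solution below both \<open>u\<^sub>0\<close> and a given solution \<open>u\<close>
  has an integral of at least \<open>m\<close>, so it equals \<open>u\<^sub>0\<close>.\<close>

lemma smallest_solution:
  assumes pair: "sub_supersolution_pair s p \<Omega> f lu uu"
  obtains u0 where "u0 \<in> solution_set s p \<Omega> f lu uu"
    "\<And>u. u \<in> solution_set s p \<Omega> f lu uu \<Longrightarrow> AE x in lebesgue. u0 x \<le> u x"
proof -
  let ?S = "solution_set s p \<Omega> f lu uu"
  have lu: "subsol lu" and uu: "supersol uu" and le: "AE x in lebesgue. x \<in> \<Omega> \<longrightarrow> lu x \<le> uu x"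
    using pair by (auto simp: sub_supersolution_pair_def)
  have Wt: "lu \<in> Wt" "uu \<in> Wt" using lu uu by (auto simp: subsolution_def supersolution_def)
  have W0: "u \<in> W0" if "u \<in> ?S" for u using that by (simp add: solution_set_iff sol_iff)
  obtain us where us: "us \<in> ?S" using solution_between[OF lu uu uu le le] by (auto simp: solution_set_iff)
  have directed: "\<exists>w\<in>?S. (AE x in lebesgue. w x \<le> u x) \<and> (AE x in lebesgue. w x \<le> v x)"
    if u: "u \<in> ?S" and v: "v \<in> ?S" for u v
  proof -
    have "AE x in lebesgue. x \<in> \<Omega> \<longrightarrow> lu x \<le> u x" "AE x in lebesgue. x \<in> \<Omega> \<longrightarrow> lu x \<le> v x"
      using u v by (auto simp: solution_set_iff elim: eventually_mono)
    moreover have "supersol u" "supersol v" using u v by (auto simp: solution_set_iff intro: sol_imp_super)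
    ultimately obtain w where w: "sol w" "AE x in lebesgue. lu x \<le> w x" "AE x in lebesgue. w x \<le> u x"
      "AE x in lebesgue. w x \<le> v x"
      using solution_between[OF lu] by blast
    have "AE x in lebesgue. u x \<le> uu x" using u by (simp add: solution_set_iff)
    with w(3) have "AE x in lebesgue. w x \<le> uu x" by eventually_elim simp
    with w have "w \<in> ?S" by (simp add: solution_set_iff)
    with w show ?thesis by blast
  qed
  define I where "I u = (LINT x|lebesgue. u x)" for u :: "'a \<Rightarrow> real"
  have iu: "integrable lebesgue u" if "u \<in> ?S" for u by (rule W0_L1(1)[OF W0[OF that]])
  have mono: "I u \<le> I v" if "u \<in> ?S" "v \<in> ?S" "AE x in lebesgue. u x \<le> v x" for u v
    unfolding I_def using iu that by (intro integral_mono_AE)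
  have ilu: "integrable lebesgue (\<lambda>x. indicator \<Omega> x * lu x)"
  proof (rule integrable_abs_bound)
    show "integrable lebesgue (\<lambda>x. indicator \<Omega> x + indicator \<Omega> x * \<bar>lu x\<bar> powr q)"
      using Wt_Lq[OF Wt(1)] indicator_dom_integrable by simp
    show "(\<lambda>x. indicator \<Omega> x * lu x) \<in> borel_measurable lebesgue"
      using Wt_measurable[OF Wt(1)] by measurable
    show "AE x in lebesgue. \<bar>indicator \<Omega> x * lu x\<bar> \<le> indicator \<Omega> x + indicator \<Omega> x * \<bar>lu x\<bar> powr q"
      using powr_le_one_plus[of 1 q "\<bar>lu _\<bar>"] q_pos by (intro AE_I2) (auto simp: indicator_def)
  qed
  have bdd: "bdd_below (I ` ?S)"
  proof (rule bdd_belowI2)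
    fix u assume u: "u \<in> ?S"
    have "AE x in lebesgue. lu x \<le> u x" using u by (simp add: solution_set_iff)
    with W0_zero[OF W0[OF u]] have "AE x in lebesgue. indicator \<Omega> x * lu x \<le> u x"
      by eventually_elim (auto simp: indicator_def)
    then show "(LINT x|lebesgue. indicator \<Omega> x * lu x) \<le> I u"
      unfolding I_def using ilu iu[OF u] by (intro integral_mono_AE)
  qed
  define m where "m = Inf (I ` ?S)"
  have m: "m \<le> I u" if "u \<in> ?S" for u unfolding m_def by (rule cInf_lower[OF imageI[OF that] bdd])
  have "\<exists>v\<in>?S. I v < m + 1 / Suc n" for n
  proof -
    have "\<exists>y\<in>I ` ?S. y < m + 1 / Suc n"
      by (rule cInf_lessD[of "I ` ?S", folded m_def]) (use us in auto)
    then show ?thesis by blast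
  qed
  then obtain v where v: "\<And>n. v n \<in> ?S" "\<And>n. I (v n) < m + 1 / Suc n" by metis
  have "\<exists>w. \<forall>n. (w n \<in> ?S \<and> (AE x in lebesgue. w n x \<le> v n x)) \<and> (AE x in lebesgue. w (Suc n) x \<le> w n x)"
  proof (rule dependent_nat_choice)
    show "\<exists>w. w \<in> ?S \<and> (AE x in lebesgue. w x \<le> v 0 x)" using v(1)[of 0] by (intro exI[of _ "v 0"]) auto
  next
    fix w n assume "w \<in> ?S \<and> (AE x in lebesgue. w x \<le> v n x)"
    then show "\<exists>y. (y \<in> ?S \<and> (AE x in lebesgue. y x \<le> v (Suc n) x)) \<and> (AE x in lebesgue. y x \<le> w x)"
      using directed[of w "v (Suc n)"] v(1) by blast
  qed
  then obtain w where w: "\<And>n. w n \<in> ?S" "\<And>n. AE x in lebesgue. w n x \<le> v n x"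
    "\<And>n. AE x in lebesgue. w (Suc n) x \<le> w n x" by blast
  define u0 where "u0 x = lim (\<lambda>n. w n x)" for x
  have [measurable]: "w n \<in> borel_measurable lebesgue" for n using W0[OF w(1)] by measurable
  have u0m: "u0 \<in> borel_measurable lebesgue" unfolding u0_def by measurable
  have "AE x in lebesgue. \<forall>n. w (Suc n) x \<le> w n x \<and> lu x \<le> w n x"
    unfolding AE_all_countable using w(1,3) by (auto simp: solution_set_iff)
  then have conv: "AE x in lebesgue. (\<lambda>n. w n x) \<longlonglongrightarrow> u0 x \<and> (\<forall>n. u0 x \<le> w n x)"
  proof eventually_elim
    case (elim x)
    then have d: "decseq (\<lambda>n. w n x)" by (auto intro: decseq_SucI)
    have "\<forall>n. lu x \<le> w n x" using elim by blast
    from decseq_convergent[OF d this] have "convergent (\<lambda>n. w n x)" by (metis convergentI)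
    then have c: "(\<lambda>n. w n x) \<longlonglongrightarrow> u0 x" by (simp add: u0_def convergent_LIMSEQ_iff)
    then show ?case using decseq_ge[OF d c] by blast
  qed
  have u0: "u0 \<in> ?S"
  proof (rule solution_set_closed[OF Wt w(1) u0m])
    show "AE x in lebesgue. (\<lambda>n. w n x) \<longlonglongrightarrow> u0 x" using conv by eventually_elim simp
  qed
  have "I u0 \<le> m"
  proof (rule field_le_epsilon)
    fix e :: real assume "e > 0"
    then obtain n where n: "1 / Suc n < e" using nat_approx_posE by blast
    have "AE x in lebesgue. u0 x \<le> w n x" using conv by eventually_elim simp
    then have "I u0 \<le> I (w n)" by (rule mono[OF u0 w(1)])
    also have "\<dots> \<le> I (v n)" by (rule mono[OF w(1) v(1) w(2)])
    finally show "I u0 \<le> m + e" using v(2)[of n] n by linarith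
  qed
  show thesis
  proof (rule that[OF u0])
    fix u assume u: "u \<in> ?S"
    obtain y where y: "y \<in> ?S" "AE x in lebesgue. y x \<le> u0 x" "AE x in lebesgue. y x \<le> u x"
      using directed[OF u0 u] by blast
    have "(LINT x|lebesgue. u0 x - y x) = I u0 - I y" using iu[OF u0] iu[OF y(1)] by (simp add: I_def)
    also have "\<dots> \<le> 0" using \<open>I u0 \<le> m\<close> m[OF y(1)] by linarith
    finally have "(LINT x|lebesgue. u0 x - y x) = 0"
      using integral_nonneg_AE[of "\<lambda>x. u0 x - y x" lebesgue] y(2) by simp
    then have "AE x in lebesgue. u0 x - y x = 0"
      using integral_nonneg_eq_0_iff_AE[of lebesgue "\<lambda>x. u0 x - y x"] iu[OF u0] iu[OF y(1)] y(2) by simp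
    with y(3) show "AE x in lebesgue. u0 x \<le> u x" by eventually_elim simp
  qed
qed

text \<open>The operator is odd. Under \<open>u \<mapsto> - u\<close> and \<open>f(x, t) \<mapsto> - f(x, - t)\<close> sub- and supersolutions change
  places, and so do the smallest and the biggest solution.\<close>

lemma reflected_problem: "frac_problem s p \<Omega> q (\<lambda>x t. - f x (- t)) c0"
proof
  show "(\<lambda>x. - f x (- t)) \<in> borel_measurable lebesgue" for t using f_measurable[of "- t"] by measurable
  show "continuous_on UNIV (\<lambda>t. - f x (- t))" for x
    by (intro continuous_on_minus continuous_on_compose2[OF f_continuous[of x]] continuous_intros) auto
  show "- f x (- t) = 0" if "x \<notin> \<Omega>" for x t using f_outside[OF that] by simp
  show "\<bar>- f x (- t)\<bar> \<le> c0 * (1 + \<bar>t\<bar> powr (q - 1))" for x t using f_growth[of x "- t"] by simp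
qed

lemma sub_supersolution_pair_reflect:
  assumes "sub_supersolution_pair s p \<Omega> f lu uu"
  shows "sub_supersolution_pair s p \<Omega> (\<lambda>x t. - f x (- t)) (\<lambda>x. - uu x) (\<lambda>x. - lu x)"
  using assms
  by (auto simp: sub_supersolution_pair_def subsolution_def supersolution_def Wt_minus frac_p_laplacian_minus
      set_lebesgue_integral_def)

lemma solution_set_reflect:
  "(\<lambda>x. - u x) \<in> solution_set s p \<Omega> (\<lambda>x t. - f x (- t)) (\<lambda>x. - uu x) (\<lambda>x. - lu x) \<longleftrightarrow>
   u \<in> solution_set s p \<Omega> f lu uu"
proof -
  have "(\<lambda>x. - u x) \<in> W0 \<longleftrightarrow> u \<in> W0" using W0_minus[of u] W0_minus[of "\<lambda>x. - u x"] by auto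
  moreover have "(AE x in lebesgue. - uu x \<le> - u x \<and> - u x \<le> - lu x) \<longleftrightarrow> (AE x in lebesgue. lu x \<le> u x \<and> u x \<le> uu x)"
    by (intro AE_cong) auto
  ultimately show ?thesis
    by (auto simp: solution_set_def solution_def frac_p_laplacian_minus set_lebesgue_integral_def)
qed

lemma biggest_solution:
  assumes pair: "sub_supersolution_pair s p \<Omega> f lu uu"
  obtains u1 where "u1 \<in> solution_set s p \<Omega> f lu uu"
    "\<And>u. u \<in> solution_set s p \<Omega> f lu uu \<Longrightarrow> AE x in lebesgue. u x \<le> u1 x"
proof -
  interpret r: frac_problem s p \<Omega> q "\<lambda>x t. - f x (- t)" c0 by (rule reflected_problem)
  obtain u0 where u0: "u0 \<in> solution_set s p \<Omega> (\<lambda>x t. - f x (- t)) (\<lambda>x. - uu x) (\<lambda>x. - lu x)"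
    "\<And>u. u \<in> solution_set s p \<Omega> (\<lambda>x t. - f x (- t)) (\<lambda>x. - uu x) (\<lambda>x. - lu x) \<Longrightarrow> AE x in lebesgue. u0 x \<le> u x"
    using r.smallest_solution[OF sub_supersolution_pair_reflect[OF pair]] by blast
  show thesis
  proof (rule that[of "\<lambda>x. - u0 x"])
    show "(\<lambda>x. - u0 x) \<in> solution_set s p \<Omega> f lu uu"
      using solution_set_reflect[of "\<lambda>x. - u0 x" uu lu] u0(1) by simp
    fix u assume "u \<in> solution_set s p \<Omega> f lu uu"
    then have "AE x in lebesgue. u0 x \<le> - u x" using u0(2)[of "\<lambda>x. - u x"] solution_set_reflect by blast
    then show "AE x in lebesgue. u x \<le> - u0 x" by eventually_elim simp
  qed
qed

end

section \<open>The theorem\<close>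

lemma lebesgue_measurable_AE_cong:
  fixes f g :: "'a::euclidean_space \<Rightarrow> real"
  assumes "f \<in> borel_measurable lebesgue" "AE x in lebesgue. f x = g x"
  shows "g \<in> borel_measurable lebesgue"
proof (rule measurableI)
  fix A :: "real set" assume A: "A \<in> sets borel"
  obtain N where N: "N \<in> null_sets lebesgue" "{x. f x \<noteq> g x} \<subseteq> N"
    using assms(2) by (auto simp: eventually_ae_filter)
  have "g -` A \<inter> N \<in> sets lebesgue"
    using completion.complete2[of "g -` A \<inter> N" N lborel] N(1) by auto
  moreover have "f -` A \<in> sets lebesgue" using measurable_sets[OF assms(1) A] by simp
  ultimately have "(f -` A - N) \<union> (g -` A \<inter> N) \<in> sets lebesgue" using N(1) by auto
  moreover have fg: "f x = g x" if "x \<notin> N" for x using N(2) that by blast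
  have "g -` A = (f -` A - N) \<union> (g -` A \<inter> N)" by (auto simp: fg)
  ultimately show "g -` A \<inter> space lebesgue \<in> sets lebesgue" by simp
qed simp

text \<open>By completeness of Lebesgue measure the two functions are measurable together; if they are
  not, both integrals have the default value \<open>0\<close>.\<close>

lemma lebesgue_integral_AE_cong:
  fixes f g :: "'a::euclidean_space \<Rightarrow> real"
  assumes ae: "AE x in lebesgue. f x = g x"
  shows "integral\<^sup>L lebesgue f = integral\<^sup>L lebesgue g"
proof (cases "f \<in> borel_measurable lebesgue")
  case True
  then show ?thesis using lebesgue_measurable_AE_cong[OF True ae] ae by (intro integral_cong_AE)
next
  case False
  have "AE x in lebesgue. g x = f x" using ae by eventually_elim simp
  then have "g \<notin> borel_measurable lebesgue" using False lebesgue_measurable_AE_cong by blast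
  with False show ?thesis
    by (metis borel_measurable_integrable not_integrable_integral_eq)
qed

theorem theorem3p5:
  fixes \<Omega> :: "'a::euclidean_space set"
    and f :: "'a \<Rightarrow> real \<Rightarrow> real"
    and lu uu :: "'a \<Rightarrow> real"
    and s p q c0 :: real
  assumes "DIM('a) > 1"
    and "p \<ge> 2"
    and "0 < s" and "s < 1"
    and "real DIM('a) > p * s"
    and "bounded_C11_domain \<Omega>"
    and "caratheodory \<Omega> f"
    and "c0 > 0"
    and "p < q" and "q < critical_exponent (real DIM('a)) s p"
    and "AE x in lebesgue. x \<in> \<Omega> \<longrightarrow> (\<forall>t. \<bar>f x t\<bar> \<le> c0 * (1 + \<bar>t\<bar> powr (q - 1)))"
    and "lu \<in> frac_sobolev_tilde s p \<Omega>"
    and "uu \<in> frac_sobolev_tilde s p \<Omega>"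
    and "sub_supersolution_pair s p \<Omega> f lu uu"
  shows "\<exists>u0\<in>solution_set s p \<Omega> f lu uu. \<exists>u1\<in>solution_set s p \<Omega> f lu uu.
           \<forall>u\<in>solution_set s p \<Omega> f lu uu.
             (AE x in lebesgue. u0 x \<le> u x) \<and> (AE x in lebesgue. u x \<le> u1 x)"
proof -
  have \<Omega>: "open \<Omega>" "bounded \<Omega>" using assms(6) by (auto simp: bounded_C11_domain_def)
  then have [measurable]: "\<Omega> \<in> sets lebesgue" by auto
  have "AE x in lebesgue. x \<in> \<Omega> \<longrightarrow> continuous_on UNIV (f x) \<and>
      (\<forall>t. \<bar>f x t\<bar> \<le> c0 * (1 + \<bar>t\<bar> powr (q - 1)))"
    using assms(7,11) unfolding caratheodory_def by auto
  then obtain N where N: "N \<in> null_sets lebesgue" and good: "\<And>x. x \<in> \<Omega> \<Longrightarrow> x \<notin> N \<Longrightarrow>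
      continuous_on UNIV (f x) \<and> (\<forall>t. \<bar>f x t\<bar> \<le> c0 * (1 + \<bar>t\<bar> powr (q - 1)))"
    by (auto simp: eventually_ae_filter subset_eq)
  \<comment> \<open>\<open>N\<close> contains the points where \<open>f x\<close> is not continuous or violates the growth condition\<close>
  define f' where "f' x t = (if x \<in> \<Omega> - N then f x t else 0)" for x t
  have [measurable]: "N \<in> sets lebesgue" using N by auto
  interpret frac_problem s p \<Omega> q f' c0
  proof
    show "(\<lambda>x. f' x t) \<in> borel_measurable lebesgue" for t
    proof -
      have "(\<lambda>x. f x t) \<in> borel_measurable (lebesgue_on \<Omega>)" using assms(7) by (simp add: caratheodory_def)
      then have [measurable]: "(\<lambda>x. if x \<in> \<Omega> then f x t else 0) \<in> borel_measurable lebesgue"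
        by (rule borel_measurable_if_I) measurable
      have "(\<lambda>x. indicator (- N) x * (if x \<in> \<Omega> then f x t else 0)) \<in> borel_measurable lebesgue" by measurable
      also have "(\<lambda>x. indicator (- N) x * (if x \<in> \<Omega> then f x t else 0)) = (\<lambda>x. f' x t)"
        by (auto simp: f'_def fun_eq_iff)
      finally show ?thesis .
    qed
    show "continuous_on UNIV (f' x)" for x
      using good[of x] by (cases "x \<in> \<Omega> - N") (auto simp: f'_def[abs_def])
    show "\<bar>f' x t\<bar> \<le> c0 * (1 + \<bar>t\<bar> powr (q - 1))" for x t
      using good[of x] assms(8) by (auto simp: f'_def)
  qed (use assms \<Omega> in \<open>auto simp: f'_def\<close>)
  have eq: "(LINT x:\<Omega>|lebesgue. f x (u x) * v x) = (LINT x:\<Omega>|lebesgue. f' x (u x) * v x)" for u v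
    unfolding set_lebesgue_integral_def
  proof (rule lebesgue_integral_AE_cong)
    show "AE x in lebesgue. indicator \<Omega> x *\<^sub>R (f x (u x) * v x) = indicator \<Omega> x *\<^sub>R (f' x (u x) * v x)"
      using AE_not_in[OF N] by eventually_elim (auto simp: f'_def indicator_def)
  qed
  have S: "solution_set s p \<Omega> f lu uu = solution_set s p \<Omega> f' lu uu"
    unfolding solution_set_def solution_def eq ..
  have pair: "sub_supersolution_pair s p \<Omega> f' lu uu"
    using assms(14) unfolding sub_supersolution_pair_def subsolution_def supersolution_def eq .
  obtain u0 where "u0 \<in> solution_set s p \<Omega> f' lu uu"
    "\<And>u. u \<in> solution_set s p \<Omega> f' lu uu \<Longrightarrow> AE x in lebesgue. u0 x \<le> u x"
    using smallest_solution[OF pair] by blast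
  moreover obtain u1 where "u1 \<in> solution_set s p \<Omega> f' lu uu"
    "\<And>u. u \<in> solution_set s p \<Omega> f' lu uu \<Longrightarrow> AE x in lebesgue. u x \<le> u1 x"
    using biggest_solution[OF pair] by blast
  ultimately show ?thesis unfolding S by blast
qed

end
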